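(* Let $R$ be an integral domain of characteristic zero, let $G$ be an $m$-dimensional formal group law over $R$, and let $\mathfrak{g}$ be the Lie algebra associated to $G$. Then there exists an isomorphism $$\tilde\Phi: H^n(\tilde G,R)\to H^n(\mathfrak{g},R)$$ between the modified group cohomology of $G$ with coefficients in $R$ and the Lie algebra cohomology of $\mathfrak{g}$ with coefficients in $R$, given by $f\mapsto\tilde\phi(f)$, where $\tilde\phi$ is the cochain map described in the context.
   Context: An $m$-dimensional formal group law over $R$ is an $m$-tuple $G=(G^{(1)},\dots,G^{(m)})$ of power series in $R[[\mathbf{X},\mathbf{Y}]]$, $\mathbf X=(X_1,\dots,X_m)$, $\mathbf Y=(Y_1,\dots,Y_m)$, with $G^{(j)}(\mathbf{X},\mathbf{Y})=X_j+Y_j+\sum_{l,k}\gamma^j_{lk}X_lY_k+(\text{terms of total degree}\ge3)$ and $G(G(\mathbf{X},\mathbf{Y}),\mathbf{Z})=G(\mathbf{X},G(\mathbf{Y},\mathbf{Z}))$. Its Lie algebra $\mathfrak{g}$ is the free $R$-module on $e_1,\dots,e_m$ with $[e_l,e_k]=\sum_j(\gamma^j_{lk}-\gamma^j_{kl})e_j$. Modified ring of functions: with $Q(R)$ the quotient field, $\underline t=(t^{(1)},\dots,t^{(m)})$, $\tilde{\mathcal{O}}(G)=\{\sum_{\underline j}b_{\underline j}\underline t^{\underline j}\in Q(R)[[\underline t]] : \underline j!\,b_{\underline j}\in R\}$, where $\underline j!=j_1!\cdots j_m!$. Its $n$-fold completed tensor power (for the total-degree filtration) is $\tilde K^n(G,R)=\{\sum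 b_{\underline j_1,\dots,\underline j_n}\underline t_1^{\underline j_1}\cdots\underline t_n^{\underline j_n}\in Q(R)[[\underline t_1,\dots,\underline t_n]] : \underline j_1!\cdots\underline j_n!\,b_{\underline j_1,\dots,\underline j_n}\in R\}$, with $\tilde K^0=R$. The differential is $$(\partial f)(\underline t_1,\dots,\underline t_{n+1})=f(\underline t_2,\dots,\underline t_{n+1})+\sum_{i=1}^n(-1)^if(\underline t_1,\dots,G(\underline t_i,\underline t_{i+1}),\dots,\underline t_{n+1})+(-1)^{n+1}f(\underline t_1,\dots,\underline t_n).$$ $H^n(\tilde G,R)$ is the cohomology of $(\tilde K^\bullet(G,R),\partial)$. $H^n(\mathfrak{g},R)$ is the cohomology of $C^n(\mathfrak{g},R)=\mathrm{Hom}_R(\bigwedge^n\mathfrak{g},R)$ with $\partial'(\omega)(x_1\wedge\dots\wedge x_{n+1})=\sum_{r<s}(-1)^{r+s}\omega([x_r,x_s]\wedge x_1\wedge\dots\wedge\widehat{x_r}\wedge\dots\wedge\widehat{x_s}\wedge\dots\wedge x_{n+1})$. The cochain map $\tilde\phi:\tilde K^n(G,R)\to C^n(\mathfrak{g},R)$ is the identity for $n=0$, and for $n\ge1$ $$\tilde\phi(f)(e_{i_1}\wedge\dots\wedge e_{i_n})=\sum_{\alpha\in S_n}\mathrm{sgn}(\alpha)\frac{\partial^nf}{\partial t_1^{(i_{\alpha(1)})}\cdots\partial t_n^{(i_{\alpha(n)})}}(0).$$ *)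

theory Defs
  imports
    "HOL-Analysis.Finite_Cartesian_Product"
    "HOL-Library.Poly_Mapping"
    "HOL-Library.FuncSet"
    "HOL-Algebra.AbelCoset"
    "HOL-Algebra.Module"
    "HOL-Combinatorics.Permutations"
    "HOL-Computational_Algebra.Polynomial_Factorial"
begin

section \<open>Formal power series in several variables\<close>

text \<open>A power series with variables in \<^typ>\<open>'v\<close> is its family of coefficients, indexed by the
  finitely supported exponents \<^typ>\<open>'v \<Rightarrow>\<^sub>0 nat\<close>.\<close>

typedef ('v, 'a) mfps = "UNIV :: (('v \<Rightarrow>\<^sub>0 nat) \<Rightarrow> 'a) set"
  morphisms mfps_coeff Abs_mfps ..

lemma mfps_coeff_Abs [simp]: "mfps_coeff (Abs_mfps c) = c"
  by (simp add: Abs_mfps_inverse)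

lemma mfps_eqI: "(\<And>e. mfps_coeff f e = mfps_coeff g e) \<Longrightarrow> f = g"
  by (metis ext mfps_coeff_inject)

definition exp_splits :: "('v \<Rightarrow>\<^sub>0 nat) \<Rightarrow> (('v \<Rightarrow>\<^sub>0 nat) \<times> ('v \<Rightarrow>\<^sub>0 nat)) set" where
  "exp_splits e = {(a, b). a + b = e}"

lemma finite_exp_splits: "finite (exp_splits e)"
proof -
  have le: "Poly_Mapping.lookup a v \<le> Poly_Mapping.lookup e v \<and> Poly_Mapping.lookup b v \<le> Poly_Mapping.lookup e v" if "a + b = e" for a b v
    unfolding that[symmetric] by (auto simp: Poly_Mapping.lookup_add)
  let ?F = "PiE (Poly_Mapping.keys e) (\<lambda>v. {..Poly_Mapping.lookup e v})"
  let ?g = "\<lambda>a. restrict (Poly_Mapping.lookup a) (Poly_Mapping.keys e)"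
  let ?S = "{a. \<forall>v. Poly_Mapping.lookup a v \<le> Poly_Mapping.lookup e v}"
  have "inj_on ?g ?S"
  proof (rule inj_onI)
    fix a b assume a: "a \<in> ?S" and b: "b \<in> ?S" and eq: "?g a = ?g b"
    have "Poly_Mapping.lookup a v = Poly_Mapping.lookup b v" for v
    proof (cases "v \<in> Poly_Mapping.keys e")
      case True then show ?thesis using fun_cong[OF eq, of v] by simp
    next
      case False
      then have "Poly_Mapping.lookup e v = 0" by (simp add: Poly_Mapping.in_keys_iff)
      then show ?thesis using a b by (metis le_zero_eq mem_Collect_eq)
    qed
    then show "a = b" by (rule poly_mapping_eqI)
  qed
  moreover have "?g ` ?S \<subseteq> ?F" by (auto simp: PiE_def)
  moreover have "finite ?F" by (intro finite_PiE) auto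
  ultimately have "finite ?S" by (meson finite_imageD finite_subset)
  moreover have "exp_splits e \<subseteq> ?S \<times> ?S" using le by (auto simp: exp_splits_def)
  ultimately show ?thesis by (meson finite_SigmaI finite_subset)
qed

instantiation mfps :: (type, comm_ring_1) comm_ring_1
begin

definition "0 = Abs_mfps (\<lambda>_. 0)"
definition "1 = Abs_mfps (\<lambda>e. if e = 0 then 1 else 0)"
definition "f + g = Abs_mfps (\<lambda>e. mfps_coeff f e + mfps_coeff g e)"
definition "f - g = Abs_mfps (\<lambda>e. mfps_coeff f e - mfps_coeff g e)"
definition "- f = Abs_mfps (\<lambda>e. - mfps_coeff f e)"
definition "f * g = Abs_mfps (\<lambda>e. \<Sum>(a, b) \<in> exp_splits e. mfps_coeff f a * mfps_coeff g b)"

instance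
proof
  fix f g h :: "('a, 'b) mfps"
  show "f * g = g * f"
  proof (rule mfps_eqI)
    fix e :: "'a \<Rightarrow>\<^sub>0 nat"
    show "mfps_coeff (f * g) e = mfps_coeff (g * f) e"
      unfolding times_mfps_def mfps_coeff_Abs
      by (rule sum.reindex_bij_witness[where i = prod.swap and j = prod.swap])
        (auto simp: exp_splits_def add.commute mult.commute)
  qed
  show "f * g * h = f * (g * h)"
  proof (rule mfps_eqI)
    fix e :: "'a \<Rightarrow>\<^sub>0 nat"
    let ?L = "SIGMA p : exp_splits e. exp_splits (fst p)"
    let ?R = "SIGMA p : exp_splits e. exp_splits (snd p)"
    have "mfps_coeff (f * g * h) e =
      (\<Sum>(p, q)\<in>?L. mfps_coeff f (fst q) * mfps_coeff g (snd q) * mfps_coeff h (snd p))"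
      by (simp add: times_mfps_def case_prod_unfold sum_distrib_right
          sum.Sigma finite_exp_splits)
    also have "\<dots> =
      (\<Sum>(p, q)\<in>?R. mfps_coeff f (fst p) * mfps_coeff g (fst q) * mfps_coeff h (snd q))"
      by (rule sum.reindex_bij_witness[where
            i = "\<lambda>(p, q). ((fst p + fst q, snd q), (fst p, fst q))" and
            j = "\<lambda>(p, q). ((fst q, snd q + snd p), (snd q, snd p))"])
        (auto simp: exp_splits_def add.assoc)
    also have "\<dots> = mfps_coeff (f * (g * h)) e"
      by (simp add: times_mfps_def case_prod_unfold sum_distrib_left
          sum.Sigma finite_exp_splits mult.assoc)
    finally show "mfps_coeff (f * g * h) e = mfps_coeff (f * (g * h)) e" .
  qed
  show "(f + g) * h = f * h + g * h"
    by (rule mfps_eqI)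
      (simp add: times_mfps_def plus_mfps_def case_prod_unfold distrib_right sum.distrib)
  show "1 * f = f"
  proof (rule mfps_eqI)
    fix e :: "'a \<Rightarrow>\<^sub>0 nat"
    have "mfps_coeff (1 * f) e =
      (\<Sum>p\<in>exp_splits e. if p = (0, e) then mfps_coeff f e else 0)"
      unfolding times_mfps_def one_mfps_def mfps_coeff_Abs
      by (rule sum.cong) (auto simp: exp_splits_def split: if_splits)
    also have "\<dots> = mfps_coeff f e"
      using finite_exp_splits[of e] by (subst sum.delta) (auto simp: exp_splits_def)
    finally show "mfps_coeff (1 * f) e = mfps_coeff f e" .
  qed
  have "mfps_coeff (0 :: ('a, 'b) mfps) 0 \<noteq> mfps_coeff 1 0"
    by (simp add: zero_mfps_def one_mfps_def)
  then show "(0 :: ('a, 'b) mfps) \<noteq> 1" by metis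
qed (simp_all add: zero_mfps_def plus_mfps_def minus_mfps_def uminus_mfps_def algebra_simps
      mfps_coeff_inverse)

end

definition mfps_const :: "'a::zero \<Rightarrow> ('v, 'a) mfps" where
  "mfps_const c = Abs_mfps (\<lambda>e. if e = 0 then c else 0)"

definition mfps_X :: "'v \<Rightarrow> ('v, 'a::zero_neq_one) mfps" where
  "mfps_X v = Abs_mfps (\<lambda>e. if e = Poly_Mapping.single v 1 then 1 else 0)"

definition mfps_map :: "('a \<Rightarrow> 'b) \<Rightarrow> ('v, 'a) mfps \<Rightarrow> ('v, 'b) mfps" where
  "mfps_map h f = Abs_mfps (\<lambda>e. h (mfps_coeff f e))"

definition mfps_deriv :: "'v \<Rightarrow> ('v, 'a::comm_ring_1) mfps \<Rightarrow> ('v, 'a) mfps" where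
  "mfps_deriv v f = Abs_mfps (\<lambda>e.
     of_nat (Suc (Poly_Mapping.lookup e v)) * mfps_coeff f (e + Poly_Mapping.single v 1))"

text \<open>Substitution of \<^term>\<open>s w\<close> for each variable \<^term>\<open>w\<close>. When \<^term>\<open>f\<close> involves finitely
  many variables and every \<^term>\<open>s w\<close> has zero constant term, only finitely many
  \<^term>\<open>d\<close> contribute to a given coefficient, so that the \<^const>\<open>Sum_any\<close> is the expected sum.\<close>

definition mfps_subst ::
  "('w \<Rightarrow> ('v, 'a::comm_ring_1) mfps) \<Rightarrow> ('w, 'a) mfps \<Rightarrow> ('v, 'a) mfps" where
  "mfps_subst s f = Abs_mfps (\<lambda>e. Sum_any (\<lambda>d.
     mfps_coeff f d * mfps_coeff (\<Prod>w\<in>Poly_Mapping.keys d. s w ^ Poly_Mapping.lookup d w) e))"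

definition exp_degree :: "('v \<Rightarrow>\<^sub>0 nat) \<Rightarrow> nat" where
  "exp_degree e = (\<Sum>v\<in>Poly_Mapping.keys e. Poly_Mapping.lookup e v)"

definition exp_fact :: "('v \<Rightarrow>\<^sub>0 nat) \<Rightarrow> nat" where
  "exp_fact e = (\<Prod>v\<in>Poly_Mapping.keys e. fact (Poly_Mapping.lookup e v))"


section \<open>Formal group laws and their Lie algebras\<close>

text \<open>In a formal group law, the variable \<^term>\<open>Inl j\<close> is $X_j$ and \<^term>\<open>Inr j\<close> is $Y_j$;
  the dimension is the cardinality of \<^typ>\<open>'m\<close>.\<close>

definition fgl_apply ::
  "('m \<Rightarrow> ('m + 'm, 'a::comm_ring_1) mfps) \<Rightarrow> ('m \<Rightarrow> ('v, 'a) mfps) \<Rightarrow> ('m \<Rightarrow> ('v, 'a) mfps)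
    \<Rightarrow> 'm \<Rightarrow> ('v, 'a) mfps" where
  "fgl_apply G A B j = mfps_subst (case_sum A B) (G j)"

definition fgl_gamma :: "('m \<Rightarrow> ('m + 'm, 'a::comm_ring_1) mfps) \<Rightarrow> 'm \<Rightarrow> 'm \<Rightarrow> 'm \<Rightarrow> 'a" where
  "fgl_gamma G j l k =
     mfps_coeff (G j) (Poly_Mapping.single (Inl l) 1 + Poly_Mapping.single (Inr k) 1)"

definition formal_group_law :: "('m::finite \<Rightarrow> ('m + 'm, 'a::comm_ring_1) mfps) \<Rightarrow> bool" where
  "formal_group_law G \<longleftrightarrow>
     (\<forall>j e. exp_degree e \<le> 2 \<longrightarrow>
        mfps_coeff (G j) e =
        mfps_coeff (mfps_X (Inl j) + mfps_X (Inr j) +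
          (\<Sum>l\<in>UNIV. \<Sum>k\<in>UNIV. mfps_const (fgl_gamma G j l k) * mfps_X (Inl l) * mfps_X (Inr k))) e) \<and>
     (let X = (\<lambda>l. mfps_X (0, l)); Y = (\<lambda>l. mfps_X (1, l));
          Z = (\<lambda>l. mfps_X (2, l)) :: 'm \<Rightarrow> (nat \<times> 'm, 'a) mfps
      in fgl_apply G (fgl_apply G X Y) Z = fgl_apply G X (fgl_apply G Y Z))"

definition fgl_bracket ::
  "('m::finite \<Rightarrow> ('m + 'm, 'a::comm_ring_1) mfps) \<Rightarrow> 'a ^ 'm \<Rightarrow> 'a ^ 'm \<Rightarrow> 'a ^ 'm" where
  "fgl_bracket G x y =
     (\<chi> j. \<Sum>l\<in>UNIV. \<Sum>k\<in>UNIV. x $ l * y $ k * (fgl_gamma G j l k - fgl_gamma G j k l))"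


section \<open>Quotient modules, duals and cohomology\<close>

text \<open>The base ring is a type \<^typ>\<open>'r\<close>. Modules over it are \<^const>\<open>carrier\<close>-based records of
  \<open>HOL-Algebra\<close>, whose fields \<^const>\<open>monoid.mult\<close> and \<^const>\<open>monoid.one\<close> carry no meaning.\<close>

inductive_set submodule_span :: "('r, 'c) module \<Rightarrow> 'c set \<Rightarrow> 'c set"
  for M :: "('r, 'c) module" and S :: "'c set" where
  zero: "\<zero>\<^bsub>M\<^esub> \<in> submodule_span M S"
| base: "x \<in> S \<Longrightarrow> x \<in> submodule_span M S"
| add: "x \<in> submodule_span M S \<Longrightarrow> y \<in> submodule_span M S \<Longrightarrow> x \<oplus>\<^bsub>M\<^esub> y \<in> submodule_span M S"
| smult: "x \<in> submodule_span M S \<Longrightarrow> r \<odot>\<^bsub>M\<^esub> x \<in> submodule_span M S"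

definition quotient_module :: "('r, 'c) module \<Rightarrow> 'c set \<Rightarrow> ('r, 'c set) module" where
  "quotient_module M B =
     \<lparr>carrier = a_rcosets\<^bsub>M\<^esub> B, monoid.mult = undefined, monoid.one = undefined,
      ring.zero = B, ring.add = set_add M,
      module.smult = (\<lambda>r C. \<Union>x\<in>C. B +>\<^bsub>M\<^esub> (r \<odot>\<^bsub>M\<^esub> x))\<rparr>"

text \<open>\<open>Hom\<^sub>R(M, R)\<close>, as functionals that are \<^const>\<open>undefined\<close> outside the carrier of \<open>M\<close>.\<close>

definition dual_module :: "('r::comm_ring_1, 'c) module \<Rightarrow> ('r, 'c \<Rightarrow> 'r) module" where
  "dual_module M =
     \<lparr>carrier = {w \<in> extensional (carrier M).
         (\<forall>x\<in>carrier M. \<forall>y\<in>carrier M. w (x \<oplus>\<^bsub>M\<^esub> y) = w x + w y) \<and>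
         (\<forall>r. \<forall>x\<in>carrier M. w (r \<odot>\<^bsub>M\<^esub> x) = r * w x)},
      monoid.mult = undefined, monoid.one = undefined,
      ring.zero = (\<lambda>x\<in>carrier M. 0), ring.add = (\<lambda>w v. \<lambda>x\<in>carrier M. w x + v x),
      module.smult = (\<lambda>r w. \<lambda>x\<in>carrier M. r * w x)\<rparr>"

definition module_iso :: "('r, 'c) module \<Rightarrow> ('r, 'd) module \<Rightarrow> ('c \<Rightarrow> 'd) \<Rightarrow> bool" where
  "module_iso M N h \<longleftrightarrow>
     bij_betw h (carrier M) (carrier N) \<and>
     (\<forall>x\<in>carrier M. \<forall>y\<in>carrier M. h (x \<oplus>\<^bsub>M\<^esub> y) = h x \<oplus>\<^bsub>N\<^esub> h y) \<and>
     (\<forall>r. \<forall>x\<in>carrier M. h (r \<odot>\<^bsub>M\<^esub> x) = r \<odot>\<^bsub>N\<^esub> h x)"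

definition cocycles :: "(nat \<Rightarrow> ('r, 'c) module) \<Rightarrow> (nat \<Rightarrow> 'c \<Rightarrow> 'c) \<Rightarrow> nat \<Rightarrow> 'c set" where
  "cocycles K d n = {f \<in> carrier (K n). d n f = \<zero>\<^bsub>K (Suc n)\<^esub>}"

definition coboundaries :: "(nat \<Rightarrow> ('r, 'c) module) \<Rightarrow> (nat \<Rightarrow> 'c \<Rightarrow> 'c) \<Rightarrow> nat \<Rightarrow> 'c set" where
  "coboundaries K d n = (case n of 0 \<Rightarrow> {\<zero>\<^bsub>K 0\<^esub>} | Suc k \<Rightarrow> d k ` carrier (K k))"

definition cohomology ::
  "(nat \<Rightarrow> ('r, 'c) module) \<Rightarrow> (nat \<Rightarrow> 'c \<Rightarrow> 'c) \<Rightarrow> nat \<Rightarrow> ('r, 'c set) module" where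
  "cohomology K d n =
     quotient_module ((K n)\<lparr>carrier := cocycles K d n\<rparr>) (coboundaries K d n)"

definition cohomology_class ::
  "(nat \<Rightarrow> ('r, 'c) module) \<Rightarrow> (nat \<Rightarrow> 'c \<Rightarrow> 'c) \<Rightarrow> nat \<Rightarrow> 'c \<Rightarrow> 'c set" where
  "cohomology_class K d n f = coboundaries K d n +>\<^bsub>K n\<^esub> f"


section \<open>Modified cohomology of a formal group law\<close>

text \<open>The variable \<^term>\<open>(i, l)\<close> is the \<open>l\<close>-th coordinate of the \<open>i\<close>-th point. Points are numbered
  from \<open>0\<close>, so an element of \<open>group_cochains n\<close> involves the points \<open>0, \<dots>, n - 1\<close> only.\<close>

definition group_cochains ::
  "nat \<Rightarrow> ('r::idom, (nat \<times> 'm::finite, 'r fract) mfps) module" where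
  "group_cochains n =
     \<lparr>carrier = {f. \<forall>e. (mfps_coeff f e \<noteq> 0 \<longrightarrow> Poly_Mapping.keys e \<subseteq> {..<n} \<times> UNIV) \<and>
                      of_nat (exp_fact e) * mfps_coeff f e \<in> range to_fract},
      monoid.mult = undefined, monoid.one = undefined,
      ring.zero = 0, ring.add = (+), module.smult = (\<lambda>r f. mfps_const (to_fract r) * f)\<rparr>"

text \<open>Because of the numbering from \<open>0\<close>, the summand for \<open>i\<close> below is the one for \<open>i + 1\<close> in the
  usual notation, whence the sign.\<close>

definition group_diff ::
  "('m::finite \<Rightarrow> ('m + 'm, 'r::idom) mfps) \<Rightarrow> nat
    \<Rightarrow> (nat \<times> 'm, 'r fract) mfps \<Rightarrow> (nat \<times> 'm, 'r fract) mfps" where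
  "group_diff G n f =
     mfps_subst (\<lambda>(k, l). mfps_X (Suc k, l)) f +
     (\<Sum>i<n. (-1) ^ Suc i *
        mfps_subst (\<lambda>(k, l).
          if k < i then mfps_X (k, l)
          else if k = i then
            fgl_apply (\<lambda>j. mfps_map to_fract (G j))
              (\<lambda>j. mfps_X (i, j)) (\<lambda>j. mfps_X (Suc i, j)) l
          else mfps_X (Suc k, l)) f) +
     (-1) ^ Suc n * f"

abbreviation group_cohomology ::
  "('m::finite \<Rightarrow> ('m + 'm, 'r::idom) mfps) \<Rightarrow> nat
    \<Rightarrow> ('r, (nat \<times> 'm, 'r fract) mfps set) module" where
  "group_cohomology G \<equiv> cohomology group_cochains (group_diff G)"


section \<open>Lie algebra cohomology\<close>

text \<open>The exterior power \<open>\<Lambda>\<^sup>n (R\<^sup>m)\<close> is the free module on the \<open>n\<close>-tuples of vectors modulo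
  the multilinear and alternating relations.\<close>

definition free_tuples :: "nat \<Rightarrow> ('r::comm_ring_1, ('r ^ 'm::finite) list \<Rightarrow>\<^sub>0 'r) module" where
  "free_tuples n =
     \<lparr>carrier = {p. Poly_Mapping.keys p \<subseteq> {xs. length xs = n}},
      monoid.mult = undefined, monoid.one = undefined,
      ring.zero = 0, ring.add = (+), module.smult = (\<lambda>r. Poly_Mapping.map ((*) r))\<rparr>"

definition wedge_relations :: "nat \<Rightarrow> (('r::comm_ring_1 ^ 'm::finite) list \<Rightarrow>\<^sub>0 'r) set" where
  "wedge_relations n = submodule_span (free_tuples n)
     ({Poly_Mapping.single (xs[i := x + y]) 1
         - Poly_Mapping.single (xs[i := x]) 1 - Poly_Mapping.single (xs[i := y]) 1
       | xs i x y. length xs = n \<and> i < n} \<union>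
      {Poly_Mapping.single (xs[i := r *s x]) 1 - Poly_Mapping.single (xs[i := x]) r
       | xs i r x. length xs = n \<and> i < n} \<union>
      {Poly_Mapping.single xs 1 | xs i j. length xs = n \<and> i < j \<and> j < n \<and> xs ! i = xs ! j})"

definition exterior_power ::
  "nat \<Rightarrow> ('r::comm_ring_1, (('r ^ 'm::finite) list \<Rightarrow>\<^sub>0 'r) set) module" where
  "exterior_power n = quotient_module (free_tuples n) (wedge_relations n)"

definition wedge :: "('r::comm_ring_1 ^ 'm::finite) list \<Rightarrow> (('r ^ 'm) list \<Rightarrow>\<^sub>0 'r) set" where
  "wedge xs = wedge_relations (length xs) +>\<^bsub>free_tuples (length xs)\<^esub> Poly_Mapping.single xs 1"

definition lie_cochains ::
  "nat \<Rightarrow> ('r::comm_ring_1, (('r ^ 'm::finite) list \<Rightarrow>\<^sub>0 'r) set \<Rightarrow> 'r) module" where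
  "lie_cochains n = dual_module (exterior_power n)"

lemma free_tuples_simps [simp]:
  "carrier (free_tuples n) = {p. Poly_Mapping.keys p \<subseteq> {xs. length xs = n}}"
  "\<zero>\<^bsub>free_tuples n\<^esub> = 0" "p \<oplus>\<^bsub>free_tuples n\<^esub> q = p + q"
  "r \<odot>\<^bsub>free_tuples n\<^esub> p = Poly_Mapping.map ((*) r) p"
  by (simp_all add: free_tuples_def)

lemma lookup_map_times [simp]:
  "Poly_Mapping.lookup (Poly_Mapping.map ((*) r) p) k = r * Poly_Mapping.lookup p k"
  for r :: "'r::comm_ring_1"
  by (cases "Poly_Mapping.lookup p k = 0") (auto simp: Poly_Mapping.map.rep_eq when_def)

lemma abelian_group_free_tuples:
  "abelian_group (free_tuples n :: ('r::comm_ring_1, ('r ^ 'm::finite) list \<Rightarrow>\<^sub>0 'r) module)"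
proof (rule abelian_groupI)
  fix x assume "x \<in> carrier (free_tuples n :: ('r, ('r ^ 'm) list \<Rightarrow>\<^sub>0 'r) module)"
  then show "\<exists>y\<in>carrier (free_tuples n :: ('r, ('r ^ 'm) list \<Rightarrow>\<^sub>0 'r) module). y \<oplus>\<^bsub>free_tuples n\<^esub> x = \<zero>\<^bsub>free_tuples n\<^esub>"
    by (intro bexI[of _ "- x"]) auto
next
  fix x y :: "('r ^ 'm) list \<Rightarrow>\<^sub>0 'r"
  assume "x \<in> carrier (free_tuples n)" "y \<in> carrier (free_tuples n)"
  then show "x \<oplus>\<^bsub>free_tuples n\<^esub> y \<in> carrier (free_tuples n)"
    using Poly_Mapping.keys_add[of x y] by auto
qed (simp_all add: add.assoc add.commute)

lemma wedge_relations_subset: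
  "wedge_relations n \<subseteq> carrier (free_tuples n :: ('r::comm_ring_1, ('r ^ 'm::finite) list \<Rightarrow>\<^sub>0 'r) module)"
proof
  fix p :: "('r ^ 'm) list \<Rightarrow>\<^sub>0 'r"
  assume "p \<in> wedge_relations n"
  then have "\<forall>xs. Poly_Mapping.lookup p xs \<noteq> 0 \<longrightarrow> length xs = n"
    unfolding wedge_relations_def
  proof (induction rule: submodule_span.induct)
    case (base x)
    then show ?case
      by (auto simp: Poly_Mapping.lookup_minus Poly_Mapping.lookup_single when_def split: if_splits)
  next
    case (add x y)
    show ?case
    proof (intro allI impI)
      fix xs assume "Poly_Mapping.lookup (x \<oplus>\<^bsub>free_tuples n\<^esub> y) xs \<noteq> 0"
      then have "Poly_Mapping.lookup x xs \<noteq> 0 \<or> Poly_Mapping.lookup y xs \<noteq> 0"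
        by (auto simp: Poly_Mapping.lookup_add)
      then show "length xs = n" using add.IH by blast
    qed
  next
    case (smult x r)
    then show ?case by simp (metis mult_zero_right)
  qed simp
  then show "p \<in> carrier (free_tuples n)" by (auto simp: Poly_Mapping.in_keys_iff)
qed

lemma wedge_relations_closed:
  fixes b b' :: "('r::comm_ring_1 ^ 'm::finite) list \<Rightarrow>\<^sub>0 'r"
  shows "(0 :: ('r ^ 'm) list \<Rightarrow>\<^sub>0 'r) \<in> wedge_relations n"
    and "b \<in> wedge_relations n \<Longrightarrow> b' \<in> wedge_relations n \<Longrightarrow> b + b' \<in> wedge_relations n"
    and "b \<in> wedge_relations n \<Longrightarrow> Poly_Mapping.map ((*) r) b \<in> wedge_relations n"
    and "b \<in> wedge_relations n \<Longrightarrow> - b \<in> wedge_relations n"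
proof -
  note span = submodule_span.intros[where M = "free_tuples n", unfolded free_tuples_simps]
  show "(0 :: ('r ^ 'm) list \<Rightarrow>\<^sub>0 'r) \<in> wedge_relations n"
    unfolding wedge_relations_def by (rule span(1))
  show "b + b' \<in> wedge_relations n" if "b \<in> wedge_relations n" "b' \<in> wedge_relations n"
    using that unfolding wedge_relations_def by (rule span(3))
  show *: "Poly_Mapping.map ((*) r) b \<in> wedge_relations n" if "b \<in> wedge_relations n" for r
    using that unfolding wedge_relations_def by (rule span(4))
  have "- b = Poly_Mapping.map ((*) (-1)) b" by (rule poly_mapping_eqI) simp
  then show "- b \<in> wedge_relations n" if "b \<in> wedge_relations n"
    using *[OF that] by metis
qed

lemma abelian_subgroup_wedge_relations:
  "abelian_subgroup (wedge_relations n)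
     (free_tuples n :: ('r::comm_ring_1, ('r ^ 'm::finite) list \<Rightarrow>\<^sub>0 'r) module)"
proof -
  let ?F = "free_tuples n :: ('r, ('r ^ 'm) list \<Rightarrow>\<^sub>0 'r) module"
  let ?B = "wedge_relations n :: (('r ^ 'm) list \<Rightarrow>\<^sub>0 'r) set"
  interpret abelian_group ?F by (rule abelian_group_free_tuples)
  have inv: "\<ominus>\<^bsub>?F\<^esub> x = - x" if "x \<in> carrier ?F" for x
    using that by (intro minus_equality) auto
  have "subgroup ?B (add_monoid ?F)"
  proof (rule subgroup.intro)
    show "?B \<subseteq> carrier (add_monoid ?F)" using wedge_relations_subset by simp
    show "x \<otimes>\<^bsub>add_monoid ?F\<^esub> y \<in> ?B" if "x \<in> ?B" "y \<in> ?B" for x y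
      using wedge_relations_closed(2)[OF that] by simp
    show "\<one>\<^bsub>add_monoid ?F\<^esub> \<in> ?B" using wedge_relations_closed(1) by simp
    show "inv\<^bsub>add_monoid ?F\<^esub> x \<in> ?B" if "x \<in> ?B" for x
      using inv[of x] that wedge_relations_subset[of n] wedge_relations_closed(4)[OF that]
      by (auto simp: a_inv_def)
  qed
  then show ?thesis
    by (intro abelian_subgroupI3 abelian_group_axioms additive_subgroupI)
qed

lemma exterior_power_simps:
  fixes p q :: "('r::comm_ring_1 ^ 'm::finite) list \<Rightarrow>\<^sub>0 'r" and n :: nat
  defines "F \<equiv> free_tuples n :: ('r, ('r ^ 'm) list \<Rightarrow>\<^sub>0 'r) module"
  defines "c \<equiv> (\<lambda>p. wedge_relations n +>\<^bsub>F\<^esub> p)"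
  shows "carrier (exterior_power n) = c ` carrier F"
    and "p \<in> carrier F \<Longrightarrow> q \<in> carrier F \<Longrightarrow> c p \<oplus>\<^bsub>exterior_power n\<^esub> c q = c (p + q)"
    and "r \<odot>\<^bsub>exterior_power n\<^esub> c p = c (Poly_Mapping.map ((*) r) p)"
    and "c p = {b + p | b. b \<in> wedge_relations n}"
proof -
  interpret abelian_subgroup "wedge_relations n" F
    unfolding F_def by (rule abelian_subgroup_wedge_relations)
  show "carrier (exterior_power n) = c ` carrier F"
    by (auto simp: exterior_power_def quotient_module_def F_def c_def A_RCOSETS_def RCOSETS_def
        a_r_coset_def)
  show "c p \<oplus>\<^bsub>exterior_power n\<^esub> c q = c (p + q)" if "p \<in> carrier F" "q \<in> carrier F"
    using a_rcos_sum[OF that] by (simp add: exterior_power_def quotient_module_def F_def c_def)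
  have c: "c p = {b + p | b. b \<in> wedge_relations n}" for p
    by (auto simp: c_def F_def a_r_coset_def r_coset_def)
  then show "c p = {b + p | b. b \<in> wedge_relations n}" .
  have shift: "c (b + p) = c p" if b: "b \<in> wedge_relations n" for b p
  proof (intro Set.set_eqI iffI)
    show "x \<in> c p" if "x \<in> c (b + p)" for x
      using that wedge_relations_closed(2)[OF _ b] by (auto simp: c simp flip: add.assoc)
    show "x \<in> c (b + p)" if x: "x \<in> c p" for x
    proof -
      obtain b' where b': "b' \<in> wedge_relations n" "x = b' + p" using x by (auto simp: c)
      have "x = (b' + - b) + (b + p)" using b' by simp
      then show ?thesis
        using wedge_relations_closed(2)[OF b'(1) wedge_relations_closed(4)[OF b]] unfolding c by blast
    qed
  qed
  have map_add: "Poly_Mapping.map ((*) r) (x + y) =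
      Poly_Mapping.map ((*) r) x + Poly_Mapping.map ((*) r) y" for x y :: "('r ^ 'm) list \<Rightarrow>\<^sub>0 'r"
    by (rule poly_mapping_eqI) (simp add: Poly_Mapping.lookup_add distrib_left)
  have "c (Poly_Mapping.map ((*) r) x) = c (Poly_Mapping.map ((*) r) p)" if x: "x \<in> c p" for x
  proof -
    obtain b where "b \<in> wedge_relations n" "x = b + p" using x by (auto simp: c)
    then show ?thesis by (simp add: map_add shift wedge_relations_closed(3))
  qed
  moreover have "p \<in> c p" using wedge_relations_closed(1) by (force simp: c)
  ultimately have "(\<Union>x\<in>c p. c (Poly_Mapping.map ((*) r) x)) = c (Poly_Mapping.map ((*) r) p)"
    by blast
  then show "r \<odot>\<^bsub>exterior_power n\<^esub> c p = c (Poly_Mapping.map ((*) r) p)"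
    by (simp add: exterior_power_def quotient_module_def c_def F_def)
qed

text \<open>Functionals on the exterior power are the same as alternating multilinear forms.\<close>

lemma ex1_lie_cochain:
  fixes a :: "('r::comm_ring_1 ^ 'm::finite) list \<Rightarrow> 'r"
  assumes add: "\<And>xs i x y. length xs = n \<Longrightarrow> i < n \<Longrightarrow>
        a (xs[i := x + y]) = a (xs[i := x]) + a (xs[i := y])"
    and smult: "\<And>xs i r x. length xs = n \<Longrightarrow> i < n \<Longrightarrow> a (xs[i := r *s x]) = r * a (xs[i := x])"
    and alt: "\<And>xs i j. length xs = n \<Longrightarrow> i < j \<Longrightarrow> j < n \<Longrightarrow> xs ! i = xs ! j \<Longrightarrow> a xs = 0"
  shows "\<exists>!w. w \<in> carrier (lie_cochains n) \<and> (\<forall>xs. length xs = n \<longrightarrow> w (wedge xs) = a xs)"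
proof -
  let ?F = "free_tuples n :: ('r, ('r ^ 'm) list \<Rightarrow>\<^sub>0 'r) module"
  let ?E = "exterior_power n :: ('r, (('r ^ 'm) list \<Rightarrow>\<^sub>0 'r) set) module"
  let ?sm = "\<lambda>r. Poly_Mapping.map ((*) r)"
  define c where "c = a_r_coset ?F (wedge_relations n)"
  note E = exterior_power_simps[where 'r = 'r and 'm = 'm and n = n, folded c_def]
  define lin where "lin p = (\<Sum>xs\<in>Poly_Mapping.keys p. Poly_Mapping.lookup p xs * a xs)" for p
  have lin_eq: "lin p = (\<Sum>xs\<in>S. Poly_Mapping.lookup p xs * a xs)"
    if "finite S" "Poly_Mapping.keys p \<subseteq> S" for p S
    unfolding lin_def using that by (intro sum.mono_neutral_left) (auto simp: Poly_Mapping.in_keys_iff)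
  have lin_add: "lin (p + q) = lin p + lin q" for p q
    using Poly_Mapping.keys_add[of p q]
    by (simp add: lin_eq[of "Poly_Mapping.keys p \<union> Poly_Mapping.keys q"] Poly_Mapping.lookup_add distrib_right sum.distrib)
  have lin_sm: "lin (?sm r p) = r * lin p" for r p
    by (subst lin_eq[of "Poly_Mapping.keys p"])
      (auto simp: Poly_Mapping.in_keys_iff lin_def sum_distrib_left mult.assoc)
  have lin_minus: "lin (p - q) = lin p - lin q" for p q
    using lin_add[of "p - q" q] by simp
  have lin_single: "lin (Poly_Mapping.single xs r) = r * a xs" for xs r
    by (simp add: lin_def)
  have lin_rel: "lin b = 0" if "b \<in> wedge_relations n" for b
    using that unfolding wedge_relations_def
  proof (induction rule: submodule_span.induct)
    case zero then show ?case by (simp add: lin_def)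
  next
    case (base x)
    then show ?case
      by (auto simp: lin_minus lin_single add smult alt)
  next
    case (add x y) then show ?case by (simp add: lin_add)
  next
    case (smult x r) then show ?case by (simp add: lin_sm)
  qed
  define w where "w = (\<lambda>C\<in>carrier ?E. lin (SOME p. p \<in> C))"
  have w: "w (c p) = lin p" if "p \<in> carrier ?F" for p
  proof -
    have "p \<in> c p" using E(4)[of p] wedge_relations_closed(1) by force
    then have "(SOME q. q \<in> c p) \<in> c p" by (rule someI)
    then have "lin (SOME q. q \<in> c p) = lin p" unfolding E(4) by (auto simp: lin_add lin_rel)
    then show ?thesis using that by (simp add: w_def E)
  qed
  have single: "Poly_Mapping.single xs r \<in> carrier ?F" if "length xs = n" for xs r
    using that by simp
  have wedge: "wedge xs = c (Poly_Mapping.single xs 1)" if "length xs = n" for xs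
    using that by (simp add: wedge_def c_def)
  have closed: "p + q \<in> carrier ?F" if "p \<in> carrier ?F" "q \<in> carrier ?F" for p q
    using that Poly_Mapping.keys_add[of p q] by auto
  have closed_sm: "?sm r p \<in> carrier ?F" if "p \<in> carrier ?F" for p r
  proof -
    have "Poly_Mapping.keys (?sm r p) \<subseteq> Poly_Mapping.keys p"
      by (auto simp: Poly_Mapping.in_keys_iff)
    then show ?thesis using that by auto
  qed
  show ?thesis
  proof (intro ex1I[of _ w] conjI allI impI)
    have "w \<in> extensional (carrier ?E)" by (simp add: w_def)
    moreover have "w (C \<oplus>\<^bsub>?E\<^esub> D) = w C + w D" if CD: "C \<in> carrier ?E" "D \<in> carrier ?E" for C D
    proof -
      obtain p q where pq: "p \<in> carrier ?F" "q \<in> carrier ?F" "C = c p" "D = c q"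
        using CD unfolding E(1) by blast
      then show ?thesis by (simp only: E(2) w closed lin_add)
    qed
    moreover have "w (r \<odot>\<^bsub>?E\<^esub> C) = r * w C" if C: "C \<in> carrier ?E" for r C
    proof -
      obtain p where p: "p \<in> carrier ?F" "C = c p" using C unfolding E(1) by blast
      then show ?thesis by (simp only: E(3) w closed_sm lin_sm)
    qed
    ultimately show "w \<in> carrier (lie_cochains n)"
      by (simp add: lie_cochains_def dual_module_def)
    show "w (wedge xs) = a xs" if "length xs = n" for xs
      using that by (simp add: wedge w single lin_single del: free_tuples_simps)
  next
    fix v
    assume "v \<in> carrier (lie_cochains n) \<and> (\<forall>xs. length xs = n \<longrightarrow> v (wedge xs) = a xs)"
    then have v: "v \<in> carrier (lie_cochains n)"
      and vw: "\<And>xs. length xs = n \<Longrightarrow> v (wedge xs) = a xs" by blast+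
    have v_add: "v (c (p + q)) = v (c p) + v (c q)" if pq: "p \<in> carrier ?F" "q \<in> carrier ?F" for p q
    proof -
      have "v (c p \<oplus>\<^bsub>?E\<^esub> c q) = v (c p) + v (c q)"
        using v pq unfolding lie_cochains_def dual_module_def E(1) by auto
      then show ?thesis by (simp only: E(2)[OF pq])
    qed
    have v_sm: "v (c (?sm r p)) = r * v (c p)" if p: "p \<in> carrier ?F" for p r
    proof -
      have "v (r \<odot>\<^bsub>?E\<^esub> c p) = r * v (c p)"
        using v p unfolding lie_cochains_def dual_module_def E(1) by auto
      then show ?thesis by (simp only: E(3))
    qed
    have "?sm 0 0 = (0 :: ('r ^ 'm) list \<Rightarrow>\<^sub>0 'r)" by (rule poly_mapping_eqI) simp
    then have v0: "v (c 0) = 0" using v_sm[of 0 0] by simp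
    have v_sum: "v (c (\<Sum>xs\<in>S. Poly_Mapping.single xs (g xs))) = (\<Sum>xs\<in>S. g xs * a xs)"
      if "finite S" "S \<subseteq> {xs. length xs = n}" for S g
      using that
    proof (induction S rule: finite_induct)
      case empty then show ?case by (simp add: v0)
    next
      case (insert xs S)
      have "Poly_Mapping.keys (\<Sum>xs\<in>S. Poly_Mapping.single xs (g xs)) \<subseteq> (\<Union>xs\<in>S. Poly_Mapping.keys (Poly_Mapping.single xs (g xs)))"
        by (rule Poly_Mapping.keys_sum)
      also have "\<dots> \<subseteq> {xs. length xs = n}" using insert.prems by (auto split: if_splits)
      finally have S: "(\<Sum>xs\<in>S. Poly_Mapping.single xs (g xs)) \<in> carrier ?F" by simp
      have len: "length xs = n" using insert.prems by simp
      have "Poly_Mapping.single xs (g xs) = ?sm (g xs) (Poly_Mapping.single xs 1)"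
        by (rule poly_mapping_eqI) (simp add: Poly_Mapping.lookup_single when_def)
      then have "v (c (Poly_Mapping.single xs (g xs))) = g xs * a xs"
        using v_sm[OF single[OF len], of "g xs" 1] vw len by (simp add: wedge)
      then show ?case
        using insert v_add[OF single[OF len] S] by simp
    qed
    have vp: "v (c p) = lin p" if "p \<in> carrier ?F" for p
    proof -
      have "p = (\<Sum>xs\<in>Poly_Mapping.keys p. Poly_Mapping.single xs (Poly_Mapping.lookup p xs))"
        by (rule poly_mapping_eqI)
          (simp add: Poly_Mapping.lookup_sum Poly_Mapping.lookup_single when_def Poly_Mapping.in_keys_iff)
      then show ?thesis
        using v_sum[of "Poly_Mapping.keys p" "Poly_Mapping.lookup p"] that by (simp add: lin_def)
    qed
    show "v = w"
    proof (rule extensionalityI[where A = "carrier ?E"])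
      show "v \<in> extensional (carrier ?E)" using v by (simp add: lie_cochains_def dual_module_def)
      show "w \<in> extensional (carrier ?E)" by (simp add: w_def)
      show "v C = w C" if "C \<in> carrier ?E" for C
        using that vp w by (auto simp: E(1) simp del: free_tuples_simps)
    qed
  qed
qed

text \<open>Here \<^term>\<open>nths xs (- {r, s})\<close> is \<^term>\<open>xs\<close> with its \<open>r\<close>-th and \<open>s\<close>-th entries removed.
  Counting from \<open>0\<close> shifts both \<open>r\<close> and \<open>s\<close> and leaves the sign unchanged. The description by
  \<open>THE\<close> is meaningful because the right-hand side is multilinear and alternating in
  \<^term>\<open>xs\<close>; see \<open>ex1_lie_cochain\<close>.\<close>

definition lie_diff ::
  "('r::comm_ring_1 ^ 'm::finite \<Rightarrow> 'r ^ 'm \<Rightarrow> 'r ^ 'm) \<Rightarrow> nat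
    \<Rightarrow> ((('r ^ 'm) list \<Rightarrow>\<^sub>0 'r) set \<Rightarrow> 'r) \<Rightarrow> ((('r ^ 'm) list \<Rightarrow>\<^sub>0 'r) set \<Rightarrow> 'r)" where
  "lie_diff br n w = (THE v. v \<in> carrier (lie_cochains (Suc n)) \<and>
     (\<forall>xs. length xs = Suc n \<longrightarrow>
        v (wedge xs) =
        (\<Sum>s<Suc n. \<Sum>r<s. (-1) ^ (r + s) * w (wedge (br (xs ! r) (xs ! s) # nths xs (- {r, s}))))))"

abbreviation lie_cohomology ::
  "('r::comm_ring_1 ^ 'm::finite \<Rightarrow> 'r ^ 'm \<Rightarrow> 'r ^ 'm) \<Rightarrow> nat
    \<Rightarrow> ('r, ((('r ^ 'm) list \<Rightarrow>\<^sub>0 'r) set \<Rightarrow> 'r) set) module" where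
  "lie_cohomology br \<equiv> cohomology lie_cochains (lie_diff br)"


section \<open>The cochain map\<close>

text \<open>\<^term>\<open>axis i 1\<close> is the basis vector \<open>e\<^sub>i\<close>. The mixed derivatives at \<open>0\<close> of a modified
  cochain lie in the base ring, and their signed sum alternates in the list of indices, so that
  there is exactly one functional with the prescribed values on the wedges of basis vectors. For \<open>n = 0\<close> the map sends a constant to its value on the empty
  wedge product, i.e. it is the identity of the base ring.\<close>

definition tilde_phi ::
  "nat \<Rightarrow> (nat \<times> 'm::finite, 'r::idom fract) mfps \<Rightarrow> ((('r ^ 'm) list \<Rightarrow>\<^sub>0 'r) set \<Rightarrow> 'r)" where
  "tilde_phi n f = (THE w. w \<in> carrier (lie_cochains n) \<and>
     (\<forall>is. length is = n \<longrightarrow>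
        to_fract (w (wedge (map (\<lambda>i. axis i 1) is))) =
        (\<Sum>p | p permutes {..<n}. of_int (sign p) *
           mfps_coeff (foldr (\<lambda>k. mfps_deriv (k, is ! p k)) [0..<n] f) 0)))"

end

theory Submission
  imports Defs "Jordan_Normal_Form.Determinant"
begin

text \<open>Multiplying the coefficients of a cochain by the factorials of their exponents turns
  \<open>K\<^sup>n\<close> into the functions on lists of \<open>n\<close> exponents, with values in \<open>R\<close>, and the differential into
  that of the bar complex of an algebra with basis the exponents (the enveloping algebra of the Lie
  algebra), whose structure constants are those of the additive group up to terms of lower degree.

  The bar complex carries an acyclic matching, in the sense of discrete Morse theory, in which a list
  is unmatched exactly if it is a strictly increasing list of unit exponents. The matching is
  compatible with the order by total degree, and then by the number of ascending pairs of variables.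
  Hence a cocycle that vanishes on the unmatched lists and on the upper half of the matching is zero,
  and every cochain agrees on the upper half with a coboundary. Since antisymmetrization over the
  lists of unit exponents is a cochain map to the Chevalley-Eilenberg complex, and an alternating
  function is determined by its values on increasing lists, it induces an isomorphism.\<close>

section \<open>Exponents\<close>

text \<open>\<open>R\<close> need not contain the rationals, so neither the symmetrization
  isomorphism of Poincare-Birkhoff-Witt nor a rational contracting homotopy is at hand, and every
  division has to be justified. Two facts help. A power series without constant term has divided
  powers with divided power coefficients, so the structure constants rescaled by factorials lie in
  \<open>R\<close>. And the matching pairs lists through faces with leading coefficient 1, so the
  systems to be solved are triangular with diagonal entries 1 or -1. Degree alone does not make them
  triangular, as several faces of a list share its total exponent. Those among them that are neither
  the partner nor collapsible merge a variable with a larger one to its right; this destroys an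
  ascending pair, whence the second component of the order. The bar complex is unnormalized, like
  the complex of group cochains, so lists with zero entries have to be matched too. Characteristic
  zero is used to cancel factorials, and to cancel 2 where a skew-symmetric form is shown to vanish
  on repeated vectors.\<close>

abbreviation lookup :: "('v \<Rightarrow>\<^sub>0 'a::zero) \<Rightarrow> 'v \<Rightarrow> 'a" where "lookup \<equiv> Poly_Mapping.lookup"
abbreviation keys :: "('v \<Rightarrow>\<^sub>0 'a::zero) \<Rightarrow> 'v set" where "keys \<equiv> Poly_Mapping.keys"
abbreviation single :: "'v \<Rightarrow> 'a::zero \<Rightarrow> 'v \<Rightarrow>\<^sub>0 'a" where "single \<equiv> Poly_Mapping.single"

lemma exp_degree_UNIV: "exp_degree e = (\<Sum>v\<in>UNIV. lookup e v)" for e :: "'m::finite \<Rightarrow>\<^sub>0 nat"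
  unfolding exp_degree_def
  by (rule sum.mono_neutral_left) (auto simp: in_keys_iff)

lemma exp_degree_superset:
  assumes "finite S" "keys e \<subseteq> S"
  shows "exp_degree e = (\<Sum>v\<in>S. lookup e v)"
  unfolding exp_degree_def using assms by (intro sum.mono_neutral_left) (auto simp: in_keys_iff)

lemma exp_degree_zero [simp]: "exp_degree 0 = 0"
  by (simp add: exp_degree_def)

lemma exp_degree_add [simp]: "exp_degree (a + b) = exp_degree a + exp_degree b"
  using keys_add[of a b]
  by (simp add: exp_degree_superset[of "keys a \<union> keys b"] lookup_add sum.distrib)

lemma exp_degree_eq_0_iff [simp]: "exp_degree e = 0 \<longleftrightarrow> e = 0"
  by (auto simp: exp_degree_def in_keys_iff intro!: poly_mapping_eqI)

lemma exp_degree_single [simp]: "exp_degree (single v k) = k"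
  by (simp add: exp_degree_def)

lemma lookup_le_exp_degree: "lookup e v \<le> exp_degree e"
proof (cases "v \<in> keys e")
  case True
  then show ?thesis unfolding exp_degree_def by (intro member_le_sum) auto
qed (simp add: in_keys_iff)

lemma finite_exponents_of_degree_le:
  assumes V: "finite V"
  shows "finite {e :: 'v \<Rightarrow>\<^sub>0 nat. keys e \<subseteq> V \<and> exp_degree e \<le> N}"
proof -
  let ?A = "{e :: 'v \<Rightarrow>\<^sub>0 nat. keys e \<subseteq> V \<and> exp_degree e \<le> N}"
  let ?f = "\<lambda>e. restrict (lookup e) V"
  have "inj_on ?f ?A"
  proof (rule inj_onI)
    fix a b assume a: "a \<in> ?A" and b: "b \<in> ?A" and eq: "?f a = ?f b"
    show "a = b"
    proof (rule poly_mapping_eqI)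
      fix v
      show "lookup a v = lookup b v"
      proof (cases "v \<in> V")
        case True
        then show ?thesis using fun_cong[OF eq, of v] by simp
      next
        case False
        then have "v \<notin> keys a" "v \<notin> keys b" using a b by blast+
        then show ?thesis by (simp add: in_keys_iff)
      qed
    qed
  qed
  moreover have "?f ` ?A \<subseteq> PiE V (\<lambda>_. {..N})"
    by (auto intro: order_trans[OF lookup_le_exp_degree])
  moreover have "finite (PiE V (\<lambda>_. {..N}))" using V by (intro finite_PiE) auto
  ultimately show ?thesis by (meson finite_imageD finite_subset)
qed

lemma finite_exponents_le [simp]: "finite {e :: 'm::finite \<Rightarrow>\<^sub>0 nat. exp_degree e \<le> N}"
  using finite_exponents_of_degree_le[of "UNIV :: 'm set" N] by simp

abbreviation unit_exp :: "'v \<Rightarrow> 'v \<Rightarrow>\<^sub>0 nat" where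
  "unit_exp v \<equiv> single v (Suc 0)"

lemma unit_exp_neq_0 [simp]: "unit_exp v \<noteq> 0" "0 \<noteq> unit_exp v"
  by (metis exp_degree_single exp_degree_zero nat.distinct(1))+

lemma unit_exp_eq_iff [simp]: "unit_exp v = unit_exp w \<longleftrightarrow> v = w"
  by (metis lookup_single_eq lookup_single_not_eq nat.distinct(1))

lemma exp_minus_unit:
  assumes "v \<in> keys a"
  shows "unit_exp v + (a - unit_exp v) = a"
  using assms by (intro poly_mapping_eqI) (auto simp: lookup_add lookup_minus lookup_single when_def in_keys_iff)

lemma exp_degree_1E:
  assumes "exp_degree a = 1"
  obtains v where "a = unit_exp v"
proof -
  have "a \<noteq> 0" using assms by auto
  then obtain v where "v \<in> keys a" by (meson ex_in_conv keys_eq_empty)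
  note eq = exp_minus_unit[OF this]
  then have "exp_degree (unit_exp v) + exp_degree (a - unit_exp v) = exp_degree a"
    by (metis exp_degree_add)
  then have "a - unit_exp v = 0" using assms by simp
  then have "a = unit_exp v" using eq by simp
  then show ?thesis by (rule that)
qed

lemma exp_add_eq_0_iff [simp]: "a + b = 0 \<longleftrightarrow> a = 0 \<and> b = 0" for a b :: "'v \<Rightarrow>\<^sub>0 nat"
  by (metis exp_degree_add exp_degree_eq_0_iff add_is_0)

lemma keys_exp_add: "keys (a + b) = keys a \<union> keys b"
  for a b :: "'v \<Rightarrow>\<^sub>0 nat"
  by (auto simp: in_keys_iff lookup_add)


section \<open>The bar complex of a filtered algebra\<close>

text \<open>\<open>mu a b L\<close> is the coefficient of the basis element \<open>L\<close> in the product of the basis elements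
  \<open>a\<close> and \<open>b\<close>.\<close>

locale structure_constants =
  fixes mu :: "('m::finite \<Rightarrow>\<^sub>0 nat) \<Rightarrow> ('m \<Rightarrow>\<^sub>0 nat) \<Rightarrow> ('m \<Rightarrow>\<^sub>0 nat) \<Rightarrow> 'r::comm_ring_1"
  assumes mu_degree: "exp_degree a + exp_degree b < exp_degree L \<Longrightarrow> mu a b L = 0"
    and mu_top: "exp_degree L = exp_degree a + exp_degree b \<Longrightarrow> mu a b L = (if L = a + b then 1 else 0)"
    and mu_zero: "mu a b 0 = (if a = 0 \<and> b = 0 then 1 else 0)"
    and mu_assoc: "(\<Sum>L | exp_degree L \<le> exp_degree a + exp_degree b. mu a b L * mu L c M) =
      (\<Sum>L | exp_degree L \<le> exp_degree b + exp_degree c. mu b c L * mu a L M)"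
begin

text \<open>A function \<open>f\<close> on exponents is read as a linear functional on the algebra,
  and \<open>merge a b f\<close> is its value at the product of the basis elements \<open>a\<close>
  and \<open>b\<close>. The product itself is never formed: merging two neighbours in a list means
  evaluating the cochain in that slot.\<close>

definition merge :: "('m \<Rightarrow>\<^sub>0 nat) \<Rightarrow> ('m \<Rightarrow>\<^sub>0 nat) \<Rightarrow> (('m \<Rightarrow>\<^sub>0 nat) \<Rightarrow> 'r) \<Rightarrow> 'r" where
  "merge a b f = (\<Sum>L | exp_degree L \<le> exp_degree a + exp_degree b. mu a b L * f L)"

lemma merge_superset:
  assumes "exp_degree a + exp_degree b \<le> N"
  shows "merge a b f = (\<Sum>L | exp_degree L \<le> N. mu a b L * f L)"
  unfolding merge_def using assms mu_degree
  by (intro sum.mono_neutral_left) (auto simp: not_le)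

text \<open>By \<open>mu_degree\<close> and \<open>mu_top\<close> the product of \<open>a\<close>
  and \<open>b\<close> is \<open>a + b\<close> plus terms of lower degree, on which \<open>f\<close>
  vanishes.\<close>

lemma merge_top:
  assumes "\<And>L. exp_degree L < exp_degree a + exp_degree b \<Longrightarrow> f L = 0"
  shows "merge a b f = f (a + b)"
proof -
  have "merge a b f = (\<Sum>L | exp_degree L \<le> exp_degree a + exp_degree b. if L = a + b then f L else 0)"
    unfolding merge_def
  proof (rule sum.cong[OF refl])
    fix L :: "'m \<Rightarrow>\<^sub>0 nat"
    assume "L \<in> {L. exp_degree L \<le> exp_degree a + exp_degree b}"
    then show "mu a b L * f L = (if L = a + b then f L else 0)"
      using assms[of L] mu_top[of L a b] by (cases "exp_degree L = exp_degree a + exp_degree b") auto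
  qed
  then show ?thesis by (subst (asm) sum.delta) auto
qed

lemma merge_eq_0:
  assumes "\<And>L. exp_degree L < exp_degree a + exp_degree b \<Longrightarrow> f L = 0" "f (a + b) = 0"
  shows "merge a b f = 0"
  using merge_top[OF assms(1)] assms(2) by simp

lemma merge_sum: "finite I \<Longrightarrow> merge a b (\<lambda>L. \<Sum>i\<in>I. f i L) = (\<Sum>i\<in>I. merge a b (f i))"
  unfolding merge_def by (simp add: sum_distrib_left) (rule sum.swap)

lemma merge_add: "merge a b (\<lambda>L. f L + g L) = merge a b f + merge a b g"
  unfolding merge_def by (simp add: distrib_left sum.distrib)

lemma merge_scale: "merge a b (\<lambda>L. r * f L) = r * merge a b f"
  unfolding merge_def sum_distrib_left by (simp add: algebra_simps)

lemma merge_zero: "merge 0 0 f = f 0"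
  using merge_top[of 0 0 f] by simp

text \<open>The projection to the coefficient of the exponent \<open>0\<close> is the augmentation
  of the algebra, and \<open>mu_zero\<close> says that it is multiplicative.\<close>

lemma merge_counit: "merge a b (\<lambda>L. if L = 0 then r else 0) = (if a = 0 \<and> b = 0 then r else 0)"
proof -
  have "merge a b (\<lambda>L. if L = 0 then r else 0) =
     (\<Sum>L :: 'm \<Rightarrow>\<^sub>0 nat | exp_degree L \<le> exp_degree a + exp_degree b. if L = 0 then mu a b 0 * r else 0)"
    unfolding merge_def by (intro sum.cong refl) auto
  then show ?thesis by (simp add: mu_zero)
qed

text \<open>Associativity of the product, tested on a functional. The bounds of the inner sums
  depend on \<open>L\<close>, so they are enlarged to the common bound \<open>N\<close> before the
  sums are exchanged.\<close>

lemma merge_assoc: "merge a b (\<lambda>L. merge L c f) = merge b c (\<lambda>L. merge a L f)"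
proof -
  define N where "N = exp_degree a + exp_degree b + exp_degree c"
  let ?S = "\<lambda>N. {L :: 'm \<Rightarrow>\<^sub>0 nat. exp_degree L \<le> N}"
  have "merge a b (\<lambda>L. merge L c f) =
      (\<Sum>L\<in>?S (exp_degree a + exp_degree b). mu a b L * (\<Sum>M\<in>?S N. mu L c M * f M))"
    unfolding merge_def[of a b]
    by (intro sum.cong refl arg_cong2[where f = "(*)"] merge_superset) (auto simp: N_def)
  also have "\<dots> = (\<Sum>M\<in>?S N. (\<Sum>L\<in>?S (exp_degree a + exp_degree b). mu a b L * mu L c M) * f M)"
    by (simp add: sum_distrib_left sum_distrib_right mult.assoc) (rule sum.swap)
  also have "\<dots> = (\<Sum>M\<in>?S N. (\<Sum>L\<in>?S (exp_degree b + exp_degree c). mu b c L * mu a L M) * f M)"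
    by (simp add: mu_assoc)
  also have "\<dots> = (\<Sum>L\<in>?S (exp_degree b + exp_degree c). mu b c L * (\<Sum>M\<in>?S N. mu a L M * f M))"
    by (simp add: sum_distrib_left sum_distrib_right mult.assoc) (rule sum.swap)
  also have "\<dots> = merge b c (\<lambda>L. merge a L f)"
    unfolding merge_def[of b c]
    by (intro sum.cong refl arg_cong2[where f = "(*)"] merge_superset[symmetric]) (auto simp: N_def)
  finally show ?thesis .
qed

text \<open>All faces of the bar differential except the first. Removing the first entry shifts
  positions by one and so changes the sign of the remaining faces; the base case is the last face,
  the augmentation of the last entry.\<close>

fun inner_diff :: "(('m \<Rightarrow>\<^sub>0 nat) list \<Rightarrow> 'r) \<Rightarrow> ('m \<Rightarrow>\<^sub>0 nat) list \<Rightarrow> 'r" where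
  "inner_diff c [] = 0"
| "inner_diff c [a] = - (if a = 0 then c [] else 0)"
| "inner_diff c (a # b # w) = - merge a b (\<lambda>L. c (L # w)) - inner_diff (\<lambda>v. c (a # v)) (b # w)"

fun diff :: "(('m \<Rightarrow>\<^sub>0 nat) list \<Rightarrow> 'r) \<Rightarrow> ('m \<Rightarrow>\<^sub>0 nat) list \<Rightarrow> 'r" where
  "diff c [] = 0"
| "diff c (a # w) = (if a = 0 then c w else 0) + inner_diff c (a # w)"

lemma inner_diff_cong:
  assumes "\<And>v. Suc (length v) = length w \<Longrightarrow> c v = c' v"
  shows "inner_diff c w = inner_diff c' w"
  using assms
proof (induction c w arbitrary: c' rule: inner_diff.induct)
  case (3 c a b w)
  have "inner_diff (\<lambda>v. c (a # v)) (b # w) = inner_diff (\<lambda>v. c' (a # v)) (b # w)"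
    by (rule "3.IH") (simp add: "3.prems")
  then show ?case using "3.prems" by (simp add: merge_def)
qed auto

lemma diff_cong:
  assumes "\<And>v. Suc (length v) = length w \<Longrightarrow> c v = c' v"
  shows "diff c w = diff c' w"
proof (cases w)
  case (Cons a u)
  have "inner_diff c w = inner_diff c' w" by (rule inner_diff_cong) (rule assms)
  then show ?thesis using assms by (simp add: Cons)
qed simp

lemma inner_diff_sum:
  "finite I \<Longrightarrow> inner_diff (\<lambda>v. \<Sum>i\<in>I. f i v) w = (\<Sum>i\<in>I. inner_diff (f i) w)"
proof (induction "\<lambda>v. \<Sum>i\<in>I. f i v" w arbitrary: f rule: inner_diff.induct)
  case (2 a) then show ?case by (auto simp: sum_negf)
next
  case (3 a b w) then show ?case by (simp add: merge_sum sum_subtractf sum_negf)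
qed simp

lemma inner_diff_add: "inner_diff (\<lambda>v. f v + g v) w = inner_diff f w + inner_diff g w"
proof (induction "\<lambda>v. f v + g v" w arbitrary: f g rule: inner_diff.induct)
  case (3 a b w) then show ?case by (simp add: merge_add)
qed auto

lemma inner_diff_scale: "inner_diff (\<lambda>v. r * f v) w = r * inner_diff f w"
proof (induction "\<lambda>v. r * f v" w arbitrary: f rule: inner_diff.induct)
  case (3 a b w) then show ?case by (simp add: merge_scale right_diff_distrib)
qed auto

lemma diff_add: "diff (\<lambda>v. f v + g v) w = diff f w + diff g w"
  by (cases w) (auto simp: inner_diff_add)

lemma diff_scale: "diff (\<lambda>v. r * f v) w = r * diff f w"
  by (cases w) (auto simp: inner_diff_scale distrib_left)

lemma diff_diff_eq: "diff (\<lambda>v. f v - g v) w = diff f w - diff g w"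
  using diff_add[of f "\<lambda>v. -1 * g v" w] diff_scale[of "-1" g w] by simp

lemma inner_diff_zero [simp]: "inner_diff (\<lambda>v. 0) w = 0"
  using inner_diff_scale[of 0 "\<lambda>v. 0" w] by simp

lemma diff_zero [simp]: "diff (\<lambda>v. 0) w = 0"
  using diff_scale[of 0 "\<lambda>v. 0" w] by simp

lemma inner_diff_merge:
  "inner_diff (\<lambda>v. merge a b (\<lambda>L. c (L # v))) w = merge a b (\<lambda>L. inner_diff (\<lambda>v. c (L # v)) w)"
  unfolding merge_def by (simp add: inner_diff_sum inner_diff_scale)

text \<open>The first entry is peeled off. Pairs of faces that both avoid it vanish by induction,
  the two ways of multiplying the first three entries cancel by associativity, and the remaining
  pairs occur twice with opposite signs. For two entries the claim is that the augmentation is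
  multiplicative.\<close>

lemma inner_diff_inner_diff: "2 \<le> length w \<Longrightarrow> inner_diff (inner_diff c) w = 0"
proof (induction w arbitrary: c rule: length_induct)
  case (1 w)
  then obtain a b u where w: "w = a # b # u"
    by (metis Suc_le_length_iff numeral_2_eq_2)
  show ?case
  proof (cases u)
    case Nil
    have "merge a b (\<lambda>L. - (if L = 0 then c [] else 0)) = - (if a = 0 \<and> b = 0 then c [] else 0)"
      using merge_counit[of a b "- c []"] by (simp add: if_distrib[of uminus] cong: if_cong)
    then show ?thesis by (auto simp: w Nil)
  next
    case (Cons d v)
    have IH: "inner_diff (inner_diff (\<lambda>v. c (a # v))) (b # d # v) = 0"
      by (rule 1(1)[rule_format]) (simp_all add: w Cons)
    have "inner_diff (\<lambda>v. inner_diff c (a # v)) (b # u) =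
        inner_diff (\<lambda>v. - merge a (hd v) (\<lambda>L. c (L # tl v)) - inner_diff (\<lambda>v. c (a # v)) v) (b # u)"
      by (rule inner_diff_cong) (auto simp: Cons length_Suc_conv)
    also have "\<dots> = - inner_diff (\<lambda>v. merge a (hd v) (\<lambda>L. c (L # tl v))) (b # u)
        - inner_diff (inner_diff (\<lambda>v. c (a # v))) (b # u)"
      using inner_diff_add[of "\<lambda>v. -1 * merge a (hd v) (\<lambda>L. c (L # tl v))"
            "\<lambda>v. -1 * inner_diff (\<lambda>v. c (a # v)) v" "b # u"]
        inner_diff_scale[of "-1"] by simp
    also have "\<dots> = - inner_diff (\<lambda>v. merge a (hd v) (\<lambda>L. c (L # tl v))) (b # u)"
      by (simp only: Cons IH diff_0_right)
    also have "inner_diff (\<lambda>v. merge a (hd v) (\<lambda>L. c (L # tl v))) (b # u) =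
        - merge b d (\<lambda>L. merge a L (\<lambda>L. c (L # v)))
        - merge a b (\<lambda>L. inner_diff (\<lambda>v. c (L # v)) (d # v))"
      by (simp add: Cons inner_diff_merge)
    finally show ?thesis
      by (simp add: w Cons merge_assoc[of a b d "\<lambda>L. c (L # v)", symmetric] flip: merge_add)
        (simp add: merge_def sum_negf sum.distrib sum_subtractf algebra_simps)
  qed
qed

text \<open>The faces other than the first already form an operator of square zero, so only pairs
  involving the first face remain; these cancel because the augmentation is multiplicative.\<close>

lemma diff_diff: "diff (diff c) w = 0"
proof (cases w)
  case (Cons a u)
  show ?thesis
  proof (cases u)
    case Nil then show ?thesis by (simp add: Cons)
  next
    case u: (Cons b v)
    have "inner_diff (diff c) (a # b # v) =
        inner_diff (\<lambda>v. (if hd v = 0 then c (tl v) else 0) + inner_diff c v) (a # b # v)"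
      by (rule inner_diff_cong) (auto simp: length_Suc_conv)
    also have "\<dots> = inner_diff (\<lambda>v. if hd v = 0 then c (tl v) else 0) (a # b # v)"
      using inner_diff_inner_diff[of "a # b # v" c] by (simp add: inner_diff_add)
    also have "\<dots> = - (if a = 0 \<and> b = 0 then c v else 0) - (if a = 0 then inner_diff c (b # v) else 0)"
      using merge_counit[of a b "c v"] by (cases "a = 0") (simp_all cong: if_cong)
    finally show ?thesis by (auto simp: Cons u)
  qed
qed simp

end

section \<open>An acyclic matching on the bar complex\<close>

text \<open>An arbitrary linear order on the variables. The shift by one keeps \<open>0\<close>
  below every key, for the state in which no variable has been read yet.\<close>

definition var_key :: "'m::finite \<Rightarrow> nat" where
  "var_key j = Suc (to_nat j)"

lemma var_key_pos [simp]: "0 < var_key j"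
  by (simp add: var_key_def)

lemma var_key_eq_iff [simp]: "var_key i = var_key j \<longleftrightarrow> i = j"
  by (simp add: var_key_def)

definition lead :: "('m::finite \<Rightarrow>\<^sub>0 nat) \<Rightarrow> 'm" where
  "lead a = (SOME l. l \<in> keys a \<and> (\<forall>l'\<in>keys a. var_key l' \<le> var_key l))"

lemma lead:
  assumes "a \<noteq> 0"
  shows "lead a \<in> keys a" "l \<in> keys a \<Longrightarrow> var_key l \<le> var_key (lead a)"
proof -
  have "Max (var_key ` keys a) \<in> var_key ` keys a"
    using assms by (intro Max_in) auto
  then have "\<exists>l. l \<in> keys a \<and> var_key l = Max (var_key ` keys a)"
    by force
  then have "\<exists>l. l \<in> keys a \<and> (\<forall>l'\<in>keys a. var_key l' \<le> var_key l)"
    by auto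
  from someI_ex[OF this] show "lead a \<in> keys a"
    and "l \<in> keys a \<Longrightarrow> var_key l \<le> var_key (lead a)"
    unfolding lead_def by blast+
qed

lemma lead_eqI:
  assumes "l \<in> keys a" "\<And>l'. l' \<in> keys a \<Longrightarrow> var_key l' \<le> var_key l"
  shows "lead a = l"
proof -
  have "a \<noteq> 0" using assms(1) by auto
  note lead[OF this]
  then have "var_key (lead a) = var_key l" using assms by (meson order_antisym)
  then show ?thesis by simp
qed

lemma lead_unit [simp]: "lead (single j (Suc 0)) = j"
  by (rule lead_eqI) auto

text \<open>A list is read up to its longest prefix of unit exponents with increasing variables; the
  argument \<open>i\<close> below is the key of the last variable already read, or \<open>0\<close> at the start. If the next
  entry has its leading variable beyond \<open>i\<close>, this variable can be split off; otherwise the entry can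
  be merged with the last variable read. A block of zeros is lengthened or shortened by one according
  to the parity of its length.\<close>

fun even_zeros :: "'a::zero list \<Rightarrow> bool" where
  "even_zeros [] = True"
| "even_zeros (a # w) = (a = 0 \<longrightarrow> \<not> even_zeros w)"

fun collapsible :: "nat \<Rightarrow> ('m::finite \<Rightarrow>\<^sub>0 nat) list \<Rightarrow> bool" where
  "collapsible i [] = False"
| "collapsible i (a # w) = (if a = 0 then \<not> even_zeros w
     else (\<forall>l\<in>keys a. var_key l \<le> i) \<or>
       (exp_degree a = 1 \<and> collapsible (var_key (lead a)) w))"

fun expandable :: "nat \<Rightarrow> ('m::finite \<Rightarrow>\<^sub>0 nat) list \<Rightarrow> bool" where
  "expandable i [] = False"
| "expandable i (a # w) = (if a = 0 then even_zeros w
     else \<not> (\<forall>l\<in>keys a. var_key l \<le> i) \<and>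
       (exp_degree a = 1 \<longrightarrow> expandable (var_key (lead a)) w))"

text \<open>The partner of an expandable list, one entry longer. The variable split off has to be
  the largest one, so that the rest of the entry can be merged back into it. The value at
  \<open>[]\<close>, which is not expandable, is a default.\<close>

fun expand :: "('m::finite \<Rightarrow>\<^sub>0 nat) list \<Rightarrow> ('m \<Rightarrow>\<^sub>0 nat) list" where
  "expand [] = []"
| "expand (a # w) = (if a = 0 then 0 # 0 # w
     else if exp_degree a = 1 then a # expand w
     else unit_exp (lead a) # (a - unit_exp (lead a)) # w)"

text \<open>The sign with which \<open>u\<close> occurs among the faces of \<open>expand u\<close>:
  each unit entry passed over shifts the face by one position, a doubled zero has the sign of the
  first face, and a split that of the face next to it.\<close>

fun expand_sign :: "('m::finite \<Rightarrow>\<^sub>0 nat) list \<Rightarrow> 'r::comm_ring_1" where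
  "expand_sign [] = 1"
| "expand_sign (a # w) = (if a = 0 then 1 else if exp_degree a = 1 then - expand_sign w else -1)"

lemma expand_sign_square [simp]: "expand_sign u * (expand_sign u * x) = x"
proof -
  have "expand_sign u * expand_sign u = (1 :: 'a)"
    by (induction u) auto
  then show ?thesis by (simp flip: mult.assoc)
qed

lemma expandable_not_collapsible: "expandable i w \<Longrightarrow> \<not> collapsible i w"
  by (induction i w rule: expandable.induct) (auto split: if_splits)

lemma expandable_units [simp]: "\<not> expandable i (map unit_exp is)"
  by (induction "is" arbitrary: i) auto

text \<open>A list of unit exponents can collapse only where a variable fails to exceed the one
  before it. For \<open>i = 0\<close> the last condition is automatic, so the unmatched unit lists
  are the increasing ones.\<close>

lemma collapsible_units:
  "\<not> collapsible i (map unit_exp is) \<longleftrightarrow>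
    sorted_wrt (\<lambda>a b. var_key a < var_key b) is \<and> (\<forall>j\<in>set is. i < var_key j)"
proof (induction "is" arbitrary: i)
  case (Cons j "is")
  then show ?case by (auto simp: not_le intro: less_trans)
qed simp

lemma critical_units:
  "\<not> expandable i w \<Longrightarrow> \<not> collapsible i w \<Longrightarrow> \<exists>is. w = map unit_exp is"
proof (induction w arbitrary: i)
  case (Cons a w)
  have a: "a \<noteq> 0" "exp_degree a = 1" "\<not> expandable (var_key (lead a)) w" "\<not> collapsible (var_key (lead a)) w"
    using Cons.prems by (auto split: if_splits)
  obtain "is" where "w = map unit_exp is" using Cons.IH[OF a(3,4)] by blast
  moreover obtain j where "a = unit_exp j" using a(2) by (rule exp_degree_1E)
  ultimately have "a # w = map unit_exp (j # is)" by simp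
  then show ?case by (rule exI)
qed simp

text \<open>After the largest variable has been split off, the keys in the rest of the entry do not
  exceed that of the variable just read, which is the criterion for merging.\<close>

lemma expandable_collapsible_expand: "expandable i u \<Longrightarrow> collapsible i (expand u)"
proof (induction u arbitrary: i)
  case (Cons a w)
  consider "a = 0" | "a \<noteq> 0" "exp_degree a = 1" | "a \<noteq> 0" "exp_degree a \<noteq> 1" by blast
  then show ?case
  proof cases
    case 3
    define l where "l = lead a"
    define w' where "w' = a - unit_exp l"
    have a: "unit_exp l + w' = a" unfolding w'_def l_def using lead(1)[OF 3(1)] by (rule exp_minus_unit)
    then have w': "w' \<noteq> 0" using 3(2) by (metis One_nat_def add.right_neutral exp_degree_single)
    have "\<forall>l'\<in>keys w'. var_key l' \<le> var_key l"
      using lead(2)[OF 3(1)] a unfolding l_def[symmetric] by (metis UnI2 keys_exp_add)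
    then have "collapsible i (unit_exp l # w' # w)" using w' by simp
    then show ?thesis using 3 by (simp add: l_def w'_def)
  qed (use Cons in auto)
qed simp

text \<open>The second alternative belongs to the recursion: the first entry is to be merged with
  the last variable read, which lies outside the list. One level up this variable is the head, and
  merging yields the preimage. At \<open>i = 0\<close> the alternative is void.\<close>

lemma collapsible_eq_expand_aux:
  "collapsible i v \<Longrightarrow> (\<exists>u. expandable i u \<and> expand u = v) \<or>
    (\<exists>a w. v = a # w \<and> a \<noteq> 0 \<and> (\<forall>l\<in>keys a. var_key l \<le> i))"
proof (induction v arbitrary: i)
  case (Cons a w)
  show ?case
  proof (cases "a = 0")
    case True
    then have "\<not> even_zeros w" using Cons.prems by simp
    then obtain w' where "w = 0 # w'" "even_zeros w'" by (cases w) (auto split: if_splits)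
    then have "expandable i w \<and> expand w = a # w" using True by simp
    then show ?thesis by blast
  next
    case a: False
    show ?thesis
    proof (cases "\<forall>l\<in>keys a. var_key l \<le> i")
      case True then show ?thesis using a by blast
    next
      case False
      then have deg: "exp_degree a = 1" and w: "collapsible (var_key (lead a)) w"
        using Cons.prems a by (auto split: if_splits)
      obtain j where j: "a = unit_exp j" using deg by (rule exp_degree_1E)
      have ij: "\<not> var_key j \<le> i" using False j by auto
      have "(\<exists>u. expandable (var_key j) u \<and> expand u = w) \<or>
        (\<exists>b w'. w = b # w' \<and> b \<noteq> 0 \<and> (\<forall>l\<in>keys b. var_key l \<le> var_key j))"
        using Cons.IH[OF w] j by simp
      then show ?thesis
      proof (elim disjE exE conjE)
        fix u assume "expandable (var_key j) u" "expand u = w"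
        then have "expandable i (a # u) \<and> expand (a # u) = a # w" using j ij by simp
        then show ?thesis by blast
      next
        fix b w' assume b: "w = b # w'" "b \<noteq> 0" "\<forall>l\<in>keys b. var_key l \<le> var_key j"
        have lead: "lead (unit_exp j + b) = j"
          using b(3) by (intro lead_eqI) (auto simp: keys_exp_add)
        have deg: "exp_degree (unit_exp j + b) \<noteq> 1" using b(2) by simp
        have nz: "unit_exp j + b \<noteq> 0" by simp
        have "\<not> (\<forall>l\<in>keys (unit_exp j + b). var_key l \<le> i)"
          using ij by (auto simp: keys_exp_add)
        then have "expandable i ((unit_exp j + b) # w')"
          using deg nz by (simp only: expandable.simps if_False) blast
        moreover have "expand ((unit_exp j + b) # w') = a # w"
          using deg nz unfolding expand.simps lead by (simp add: j b(1))
        ultimately show ?thesis by blast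
      qed
    qed
  qed
qed simp

lemma collapsible_eq_expand:
  assumes "collapsible 0 v"
  obtains u where "expandable 0 u" "expand u = v"
proof -
  have "\<not> (\<forall>l\<in>keys a. var_key l \<le> 0)" if "a \<noteq> 0" for a :: "'a \<Rightarrow>\<^sub>0 nat"
    using lead(1)[OF that] by (metis le_zero_eq less_irrefl var_key_pos)
  then show ?thesis using collapsible_eq_expand_aux[OF assms] that by blast
qed

text \<open>Counts, with multiplicity, the ascending pairs with the smaller variable from
  \<open>a\<close> and the larger from \<open>b\<close>. It is additive in both arguments, so that
  merging two neighbours lowers \<open>ascents\<close> exactly by their crossing.\<close>

definition crossing :: "('m::finite \<Rightarrow>\<^sub>0 nat) \<Rightarrow> ('m \<Rightarrow>\<^sub>0 nat) \<Rightarrow> nat" where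
  "crossing a b = (\<Sum>l\<in>UNIV. \<Sum>l' | var_key l < var_key l'. lookup a l * lookup b l')"

lemma crossing_simps [simp]:
  "crossing 0 b = 0" "crossing a 0 = 0"
  by (simp_all add: crossing_def)

lemma crossing_add:
  "crossing (a + a') b = crossing a b + crossing a' b" "crossing a (b + b') = crossing a b + crossing a b'"
  by (simp_all add: crossing_def lookup_add distrib_left distrib_right sum.distrib)

lemma crossing_eq_0:
  assumes "\<And>l l'. l \<in> keys a \<Longrightarrow> l' \<in> keys b \<Longrightarrow> var_key l' \<le> var_key l"
  shows "crossing a b = 0"
proof -
  have "lookup a l * lookup b l' = 0" if "var_key l < var_key l'" for l l'
    using assms[of l l'] that by (auto simp: in_keys_iff)
  then show ?thesis by (simp add: crossing_def)
qed

lemma crossing_pos: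
  assumes "l \<in> keys a" "l' \<in> keys b" "var_key l < var_key l'"
  shows "0 < crossing a b"
proof -
  have "0 < lookup a l * lookup b l'"
    using assms by (simp add: in_keys_iff)
  also have "\<dots> \<le> (\<Sum>l' | var_key l < var_key l'. lookup a l * lookup b l')"
    using assms(3) by (intro member_le_sum) auto
  also have "\<dots> \<le> crossing a b"
    unfolding crossing_def by (rule member_le_sum) auto
  finally show ?thesis .
qed

fun ascents :: "('m::finite \<Rightarrow>\<^sub>0 nat) list \<Rightarrow> nat" where
  "ascents [] = 0"
| "ascents (a # w) = crossing a (sum_list w) + ascents w"

lemma ascents_merge: "ascents (a # b # w) = crossing a b + ascents ((a + b) # w)"
  by (simp add: crossing_add)

text \<open>Ascents are compared only between lists with the same sum. Leading terms of merges have
  this property, and prefixing a common entry then adds the same number of ascents on both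
  sides.\<close>

definition below :: "('m::finite \<Rightarrow>\<^sub>0 nat) list \<Rightarrow> ('m \<Rightarrow>\<^sub>0 nat) list \<Rightarrow> bool" where
  "below v u \<longleftrightarrow> exp_degree (sum_list v) < exp_degree (sum_list u) \<or>
     (sum_list v = sum_list u \<and> ascents v < ascents u)"

lemma wf_below: "wf {(v, u). below v u}"
proof (rule wf_subset)
  show "wf (measures [\<lambda>v :: ('a \<Rightarrow>\<^sub>0 nat) list. exp_degree (sum_list v), ascents])" by simp
qed (auto simp: below_def)

lemma below_Cons: "below v u \<Longrightarrow> below (a # v) (a # u)"
  by (auto simp: below_def)

text \<open>The variable split off is the largest of its entry, so it forms no ascending pair with
  what remains.\<close>

lemma expand_invariants:
  assumes "expandable i u"
  shows "sum_list (expand u) = sum_list u" "ascents (expand u) = ascents u"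
proof -
  have "sum_list (expand u) = sum_list u \<and> ascents (expand u) = ascents u"
    using assms
  proof (induction u arbitrary: i)
    case (Cons a w)
    consider "a = 0" | "a \<noteq> 0" "exp_degree a = 1" | "a \<noteq> 0" "exp_degree a \<noteq> 1" by blast
    then show ?case
    proof cases
      case 2
      then show ?thesis using Cons.IH[of "var_key (lead a)"] Cons.prems by simp
    next
      case 3
      let ?l = "lead a"
      have eq: "unit_exp ?l + (a - unit_exp ?l) = a" using lead(1)[OF 3(1)] by (rule exp_minus_unit)
      have "crossing (unit_exp ?l) (a - unit_exp ?l) = 0"
      proof (rule crossing_eq_0)
        fix l l' assume "l \<in> keys (unit_exp ?l)" "l' \<in> keys (a - unit_exp ?l)"
        then have "l = ?l" "l' \<in> keys a"
          by (auto simp: in_keys_iff lookup_minus)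
        then show "var_key l' \<le> var_key l" using lead(2)[OF 3(1)] by blast
      qed
      then have "ascents (unit_exp ?l # (a - unit_exp ?l) # w) = ascents (a # w)"
        unfolding ascents_merge eq by simp
      moreover have "sum_list (unit_exp ?l # (a - unit_exp ?l) # w) = sum_list (a # w)"
        using eq by (simp flip: add.assoc)
      ultimately show ?thesis using 3 by simp
    qed simp
  qed simp
  then show "sum_list (expand u) = sum_list u" "ascents (expand u) = ascents u" by blast+
qed

text \<open>Serves to see that merging a unit entry with the head of the expanded tail destroys an
  ascending pair, unless this head is zero.\<close>

lemma hd_expand:
  assumes "expandable i w" "hd (expand w) \<noteq> 0"
  shows "\<exists>l\<in>keys (hd (expand w)). i < var_key l"
proof (cases w)
  case (Cons a w')
  have a: "a \<noteq> 0" using assms(2) by (auto simp: Cons)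
  then obtain l where l: "l \<in> keys a" "i < var_key l"
    using assms(1) by (auto simp: Cons not_le)
  show ?thesis
  proof (cases "exp_degree a = 1")
    case True then show ?thesis using a l by (auto simp: Cons)
  next
    case False
    then show ?thesis using a l lead(2)[OF a l(1)] by (auto simp: Cons)
  qed
qed (use assms in simp)

context structure_constants
begin

text \<open>The product of the two zeros cancels against that of the second zero with the next
  entry, or against the last face if there is none. The locale makes the exponent \<open>0\<close> a
  unit only modulo terms of lower degree, on which \<open>h\<close> therefore has to vanish.\<close>

lemma inner_diff_double_zero:
  assumes "\<And>v. exp_degree (sum_list v) < exp_degree (sum_list w) \<Longrightarrow> h v = 0"
  shows "inner_diff h (0 # 0 # w) = inner_diff (\<lambda>v. h (0 # 0 # v)) w"
proof (cases w)
  case Nil then show ?thesis by (simp add: merge_zero)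
next
  case (Cons b w')
  have "merge 0 b (\<lambda>L. h (0 # L # w')) = h (0 # (0 + b) # w')"
    by (rule merge_top) (use assms in \<open>simp add: Cons\<close>)
  then show ?thesis by (simp add: Cons merge_zero)
qed

text \<open>Zeros are removed in pairs. Once the list starts with a nonzero entry, so do all its
  faces up to terms of lower degree, and on such lists \<open>h\<close> is zero.\<close>

lemma inner_diff_even_zeros:
  assumes "even_zeros w" "\<And>v. even_zeros v \<Longrightarrow> h v = 0"
    "\<And>v. exp_degree (sum_list v) < exp_degree (sum_list w) \<Longrightarrow> h v = 0"
  shows "inner_diff h w = 0"
  using assms
proof (induction w arbitrary: h rule: length_induct)
  case (1 w)
  show ?case
  proof (cases w)
    case w: (Cons a w1)
    show ?thesis
    proof (cases w1)
      case Nil then show ?thesis using 1(2) by (simp add: w)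
    next
      case w1: (Cons b w2)
      show ?thesis
      proof (cases "a = 0")
        case False
        have "merge a b (\<lambda>L. h (L # w2)) = 0"
        proof (rule merge_eq_0)
          fix L :: "'m \<Rightarrow>\<^sub>0 nat"
          assume "exp_degree L < exp_degree a + exp_degree b"
          then show "h (L # w2) = 0" by (intro 1(4)) (simp add: w w1)
        next
          show "h ((a + b) # w2) = 0" using False by (intro 1(3)) simp
        qed
        moreover have "h (a # v) = 0" for v using False by (intro 1(3)) simp
        ultimately show ?thesis by (simp add: w w1)
      next
        case True
        then have b: "b = 0" and w2: "even_zeros w2" using 1(2) by (auto simp: w w1)
        have "inner_diff h w = inner_diff (\<lambda>v. h (0 # 0 # v)) w2"
          unfolding w w1 True b by (rule inner_diff_double_zero) (rule 1(4), simp add: w w1 True b)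
        also have "\<dots> = 0"
        proof (rule 1(1)[rule_format])
          show "h (0 # 0 # v) = 0" if "even_zeros v" for v using that by (intro 1(3)) simp
          show "h (0 # 0 # v) = 0" if "exp_degree (sum_list v) < exp_degree (sum_list w2)" for v
            using that by (intro 1(4)) (simp add: w w1 True b)
        qed (simp_all add: w w1 w2)
        finally show ?thesis .
      qed
    qed
  qed simp
qed

text \<open>All faces of \<^term>\<open>expand u\<close> other than \<open>u\<close> are collapsible or below \<open>u\<close>.\<close>

lemma diff_expand:
  assumes "expandable i u" "\<And>v. collapsible i v \<Longrightarrow> c v = 0" "\<And>v. below v u \<Longrightarrow> c v = 0"
  shows "diff c (expand u) = expand_sign u * c u"
  using assms
proof (induction u arbitrary: i c)
  case (Cons a w)
  note coll = Cons.prems(2) and low = Cons.prems(3)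
  have lowdeg: "c v = 0" if "exp_degree (sum_list v) < exp_degree (sum_list (a # w))" for v
    using that low by (simp add: below_def)
  consider "a = 0" | "a \<noteq> 0" "exp_degree a = 1" | "a \<noteq> 0" "exp_degree a \<noteq> 1" by blast
  then show ?case
  proof cases
    case 1
    have "inner_diff c (0 # 0 # w) = inner_diff (\<lambda>v. c (0 # 0 # v)) w"
      by (rule inner_diff_double_zero) (use lowdeg 1 in simp)
    also have "\<dots> = 0"
    proof (rule inner_diff_even_zeros)
      show "even_zeros w" using Cons.prems(1) 1 by simp
      \<comment> \<open>Behind the first zero there is a block of zeros of odd length, which is the
        criterion for collapsing.\<close>
      show "c (0 # 0 # v) = 0" if "even_zeros v" for v using that by (intro coll) simp
      show "c (0 # 0 # v) = 0" if "exp_degree (sum_list v) < exp_degree (sum_list w)" for v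
        using that 1 by (intro lowdeg) simp
    qed
    finally show ?thesis using 1 by simp
  next
    case 2
    obtain j where j: "a = unit_exp j" using 2(2) by (rule exp_degree_1E)
    have ij: "i < var_key j" and w: "expandable (var_key j) w"
      using Cons.prems(1) by (auto simp: j)
    note inv = expand_invariants[OF w]
    have "expand w \<noteq> []" using w by (cases w) auto
    then obtain h t where ht: "expand w = h # t" by (cases "expand w") auto
    have "diff (\<lambda>v. c (a # v)) (expand w) = expand_sign w * c (a # w)"
    proof (rule Cons.IH[OF w])
      show "c (a # v) = 0" if "collapsible (var_key j) v" for v
        using that by (intro coll) (simp add: j)
      show "c (a # v) = 0" if "below v w" for v
        using that by (intro low below_Cons)
    qed
    \<comment> \<open>In the list without its first entry, dropping a zero head is the first face;
      here the same term arises from merging \<open>a\<close> with the zero head. A nonzero head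
      contains a variable beyond \<open>j\<close>, so the leading term of the merge is
      \<open>below\<close> the original list.\<close>
    moreover have merge: "merge a h (\<lambda>L. c (L # t)) = (if h = 0 then c (a # t) else 0)"
    proof -
      have "sum_list (a # w) = (a + h) + sum_list t"
        using inv(1) ht by (simp add: add.assoc)
      then have "merge a h (\<lambda>L. c (L # t)) = c ((a + h) # t)"
        by (intro merge_top lowdeg) simp
      moreover have "c ((a + h) # t) = 0" if "h \<noteq> 0"
      proof (rule low)
        obtain l where "l \<in> keys h" "var_key j < var_key l"
          using hd_expand[OF w] ht \<open>h \<noteq> 0\<close> by auto
        then have "0 < crossing a h" by (intro crossing_pos[of j]) (auto simp: j)
        moreover have "ascents (a # h # t) = ascents (a # w)"
          using inv ht by (metis ascents.simps(2))
        ultimately have "ascents ((a + h) # t) < ascents (a # w)"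
          using ascents_merge[of a h t] by linarith
        then show "below ((a + h) # t) (a # w)"
          using \<open>sum_list (a # w) = (a + h) + sum_list t\<close> by (simp add: below_def)
      qed
      ultimately show ?thesis by simp
    qed
    moreover have "diff c (expand (a # w)) = - merge a h (\<lambda>L. c (L # t)) - inner_diff (\<lambda>v. c (a # v)) (h # t)"
      using 2 by (simp add: ht)
    then have "diff c (expand (a # w)) = - diff (\<lambda>v. c (a # v)) (expand w)"
      by (simp only: merge ht diff.simps minus_add_distrib diff_conv_add_uminus)
    ultimately show ?thesis using 2 by simp
  next
    case 3
    define l where "l = lead a"
    define w' where "w' = a - unit_exp l"
    have a: "unit_exp l + w' = a" unfolding w'_def l_def using lead(1)[OF 3(1)] by (rule exp_minus_unit)
    then have w': "w' \<noteq> 0" using 3(2) by (metis One_nat_def add.right_neutral exp_degree_single)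
    have le: "var_key l' \<le> var_key l" if "l' \<in> keys w'" for l'
      using that lead(2)[OF 3(1), of l'] a unfolding l_def[symmetric] by (metis UnI2 keys_exp_add)
    have "\<not> (\<forall>l\<in>keys a. var_key l \<le> i)"
      using Cons.prems(1) 3 by (auto split: if_splits)
    then have il: "i < var_key l" using lead(2)[OF 3(1)] unfolding l_def by (meson not_le order_trans)
    have split: "ascents (unit_exp l # w' # w) = ascents (a # w)"
      using expand_invariants(2)[OF Cons.prems(1)] 3 by (simp add: l_def w'_def)
    have expand: "expand (a # w) = unit_exp l # w' # w" using 3 by (simp add: l_def w'_def)
    have coll': "c (unit_exp l # b # v) = 0" if "b \<noteq> 0" "\<And>l'. l' \<in> keys b \<Longrightarrow> var_key l' \<le> var_key l" for b v
      using that il by (intro coll) simp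
    have "merge (unit_exp l) w' (\<lambda>L. c (L # w)) = c ((unit_exp l + w') # w)"
    proof (rule merge_top, rule lowdeg)
      fix L :: "'m \<Rightarrow>\<^sub>0 nat"
      assume "exp_degree L < exp_degree (unit_exp l) + exp_degree w'"
      then show "exp_degree (sum_list (L # w)) < exp_degree (sum_list (a # w))"
        unfolding a[symmetric] by simp
    qed
    moreover have "inner_diff (\<lambda>v. c (unit_exp l # v)) (w' # w) = 0"
    proof (cases w)
      case (Cons b ws)
      have "merge w' b (\<lambda>L. c (unit_exp l # L # ws)) = 0"
      proof (rule merge_eq_0)
        fix L :: "'m \<Rightarrow>\<^sub>0 nat"
        assume "exp_degree L < exp_degree w' + exp_degree b"
        then have "exp_degree (sum_list (unit_exp l # L # ws)) < exp_degree (sum_list (a # w))"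
          unfolding a[symmetric] Cons by simp
        then show "c (unit_exp l # L # ws) = 0" by (rule lowdeg)
      next
        \<comment> \<open>If no variable of \<open>b\<close> exceeds \<open>l\<close>, the merged
          entry can still be absorbed by \<open>unit_exp l\<close>, so the list is collapsible;
          otherwise the merge destroys an ascending pair between \<open>w'\<close> and
          \<open>b\<close>.\<close>
        show "c (unit_exp l # (w' + b) # ws) = 0"
        proof (cases "\<forall>l'\<in>keys b. var_key l' \<le> var_key l")
          case True
          show ?thesis
          proof (rule coll')
            show "w' + b \<noteq> 0" using w' by simp
            show "var_key l' \<le> var_key l" if "l' \<in> keys (w' + b)" for l'
              using that True le by (auto simp: keys_exp_add)
          qed
        next
          case False
          then obtain l' where l': "l' \<in> keys b" "var_key l < var_key l'" by (auto simp: not_le)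
          have "0 < crossing w' b"
            using crossing_pos[of "lead w'" w' l' b] lead(1)[OF w'] le[OF lead(1)[OF w']] l' by simp
          moreover have "ascents (unit_exp l # w' # b # ws) =
              crossing w' b + ascents (unit_exp l # (w' + b) # ws)"
            by (simp add: crossing_add)
          ultimately have "ascents (unit_exp l # (w' + b) # ws) < ascents (a # w)"
            using split Cons by simp
          moreover have "sum_list (unit_exp l # (w' + b) # ws) = sum_list (a # w)"
            unfolding a[symmetric] Cons by (simp add: add.assoc)
          ultimately show ?thesis by (intro low) (simp add: below_def)
        qed
      qed
      moreover have "c (unit_exp l # w' # v) = 0" for v using w' le by (rule coll')
      ultimately show ?thesis by (simp add: Cons)
    qed (simp add: w')
    ultimately show ?thesis unfolding expand using 3 by (simp add: a)
  qed
qed simp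

text \<open>The unknowns are the values of \<open>b\<close> on expandable lists, and there is one
  equation for each collapsible list. By \<open>diff_expand\<close> this system is triangular along
  \<open>below\<close> with diagonal entries \<open>1\<close> and \<open>-1\<close>, so well-founded
  recursion solves it.\<close>

lemma ex_diff_eq_on_collapsible:
  obtains b where "\<And>v. \<not> expandable 0 v \<Longrightarrow> b v = 0" "\<And>v. collapsible 0 v \<Longrightarrow> diff b v = c v"
proof -
  \<comment> \<open>The value at \<open>u\<close> is what is missing in the equation at
    \<open>expand u\<close> once the values at the lists below \<open>u\<close> have been accounted
    for.\<close>
  define F where "F f u = (if expandable 0 u then expand_sign u *
      (c (expand u) - diff (\<lambda>v. if below v u \<and> expandable 0 v then f v else 0) (expand u)) else 0)" for f u
  define b where "b = wfrec {(v, u). below v u} F"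
  have b: "b u = F b u" for u
  proof -
    have "b u = F (cut b {(v, u). below v u} u) u"
      unfolding b_def by (rule wfrec[OF wf_below])
    also have "\<dots> = F b u" by (simp add: F_def cut_def cong: if_cong conj_cong)
    finally show ?thesis .
  qed
  have supp: "b v = 0" if "\<not> expandable 0 v" for v using b[of v] that by (simp add: F_def)
  have "diff b v = c v" if v: "collapsible 0 v" for v
  proof -
    obtain u where u: "expandable 0 u" "expand u = v" using v by (rule collapsible_eq_expand)
    let ?cut = "\<lambda>v. if below v u \<and> expandable 0 v then b v else 0"
    \<comment> \<open>\<open>diff_expand\<close> asks for vanishing below \<open>u\<close>, so it is
      applied to \<open>b\<close> without its part there.\<close>
    have "diff (\<lambda>v. b v - ?cut v) (expand u) = expand_sign u * (b u - ?cut u)"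
    proof (rule diff_expand[OF u(1)])
      show "b v - ?cut v = 0" if "collapsible 0 v" for v
        using that expandable_not_collapsible supp by auto
      show "b v - ?cut v = 0" if "below v u" for v using that supp by auto
    qed
    also have "\<dots> = expand_sign u * b u" by (simp add: below_def)
    also have "\<dots> = c (expand u) - diff ?cut (expand u)"
      using b[of u] u(1) by (simp add: F_def)
    finally show ?thesis by (simp add: diff_diff_eq u(2))
  qed
  then show ?thesis using supp that by blast
qed

text \<open>Induction along \<open>below\<close>: if \<open>c\<close> vanishes below
  \<open>u\<close>, the equation at \<open>expand u\<close> reduces to \<open>c u\<close> up to
  sign.\<close>

lemma eq_0_of_diff_eq_0:
  assumes "\<And>v. \<not> expandable 0 v \<Longrightarrow> c v = 0" "\<And>v. collapsible 0 v \<Longrightarrow> diff c v = 0"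
  shows "c u = 0"
proof (induction u rule: wf_induct_rule[OF wf_below])
  case (1 u)
  show ?case
  proof (cases "expandable 0 u")
    case True
    have coll: "c v = 0" if "collapsible 0 v" for v
      using that assms(1) expandable_not_collapsible by blast
    have "expand_sign u * c u = 0"
      using diff_expand[OF True coll] 1 assms(2)[OF expandable_collapsible_expand[OF True]] by simp
    then show ?thesis by (metis expand_sign_square mult_zero_right)
  qed (use assms(1) in blast)
qed

end

section \<open>Antisymmetrization\<close>

text \<open>Alternating sum over the positions of a list, as in the expansion of a determinant along
  a row: \<open>F\<close> receives the entry at that position and the list of the others. The
  recursive form keeps positions out of the inductive proofs.\<close>

primrec removal_sum :: "'a list \<Rightarrow> ('a \<Rightarrow> 'a list \<Rightarrow> 'r) \<Rightarrow> 'r::comm_ring_1" where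
  "removal_sum [] F = 0"
| "removal_sum (a # w) F = F a w - removal_sum w (\<lambda>b r. F b (a # r))"

lemma removal_sum_cong:
  assumes "\<And>a r. mset w = add_mset a (mset r) \<Longrightarrow> F a r = F' a r"
  shows "removal_sum w F = removal_sum w F'"
  using assms
proof (induction w arbitrary: F F')
  case (Cons a w)
  have "removal_sum w (\<lambda>b r. F b (a # r)) = removal_sum w (\<lambda>b r. F' b (a # r))"
    by (rule Cons.IH) (rule Cons.prems, simp)
  then show ?case using Cons.prems[of a w] by simp
qed simp

lemma removal_sum_zero [simp]: "removal_sum w (\<lambda>a r. 0) = 0"
  by (induction w) simp_all

lemma removal_sum_add: "removal_sum w (\<lambda>a r. F a r + F' a r) = removal_sum w F + removal_sum w F'"
  by (induction w arbitrary: F F') simp_all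

lemma removal_sum_scale: "removal_sum w (\<lambda>a r. x * F a r) = x * removal_sum w F"
  by (induction w arbitrary: F) (simp_all add: right_diff_distrib)

lemma removal_sum_minus: "removal_sum w (\<lambda>a r. - F a r) = - removal_sum w F"
  using removal_sum_scale[of w "-1" F] by simp

lemma removal_sum_diff: "removal_sum w (\<lambda>a r. F a r - F' a r) = removal_sum w F - removal_sum w F'"
  using removal_sum_add[of w F "\<lambda>a r. - F' a r"] by (simp add: removal_sum_minus)

lemma removal_sum_sum:
  "finite I \<Longrightarrow> removal_sum w (\<lambda>a r. \<Sum>i\<in>I. F i a r) = (\<Sum>i\<in>I. removal_sum w (F i))"
  by (induction I rule: finite_induct) (simp_all add: removal_sum_add)

text \<open>Two entries are removed one after the other, so that each pair of positions occurs in
  both orders, with opposite signs.\<close>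

definition removal_sum2 :: "'a list \<Rightarrow> ('a \<Rightarrow> 'a \<Rightarrow> 'a list \<Rightarrow> 'r) \<Rightarrow> 'r::comm_ring_1" where
  "removal_sum2 w F = removal_sum w (\<lambda>a r. removal_sum r (F a))"

lemma removal_sum2_simps [simp]:
  "removal_sum2 [] F = 0"
  "removal_sum2 (a # w) F = removal_sum w (F a) - removal_sum w (\<lambda>b. F b a)
     + removal_sum2 w (\<lambda>b b' r. F b b' (a # r))"
  by (simp_all add: removal_sum2_def removal_sum_diff)

lemma removal_sum2_swap: "removal_sum2 w (\<lambda>a b. F b a) = - removal_sum2 w F"
proof (induction w arbitrary: F)
  case (Cons a w)
  show ?case using Cons.IH[of "\<lambda>b b' r. F b b' (a # r)"] by simp
qed simp

text \<open>\<open>removal_sum2_swap\<close> would only give that twice the sum is zero, so a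
  separate induction cancels the terms in pairs.\<close>

lemma removal_sum2_symmetric: "(\<And>a b r. F a b r = F b a r) \<Longrightarrow> removal_sum2 w F = 0"
proof (induction w arbitrary: F)
  case (Cons a w)
  have eq1: "removal_sum2 w (\<lambda>b b' r. F b b' (a # r)) = 0" by (rule Cons.IH) (rule Cons.prems)
  have eq2: "removal_sum w (\<lambda>b. F b a) = removal_sum w (F a)"
    by (rule removal_sum_cong) (rule Cons.prems)
  show ?case unfolding removal_sum2_simps(2) eq1 eq2 by simp
qed simp

lemma removal_sum2_add: "removal_sum2 w (\<lambda>a b r. F a b r + F' a b r) = removal_sum2 w F + removal_sum2 w F'"
  by (simp add: removal_sum2_def removal_sum_add)

lemma removal_sum2_minus: "removal_sum2 w (\<lambda>a b r. - F a b r) = - removal_sum2 w F"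
  by (simp add: removal_sum2_def removal_sum_minus)

lemma removal_sum2_cong:
  assumes "\<And>a b r. mset w = add_mset a (add_mset b (mset r)) \<Longrightarrow> F a b r = F' a b r"
  shows "removal_sum2 w F = removal_sum2 w F'"
  unfolding removal_sum2_def by (intro removal_sum_cong) (simp add: assms)

text \<open>Signed sum of \<open>g\<close> over all rearrangements of the list, developed along the
  entry placed first. The first argument carries the length to make the recursion primitive.\<close>

primrec antisymmetrize_aux :: "nat \<Rightarrow> ('a list \<Rightarrow> 'r) \<Rightarrow> 'a list \<Rightarrow> 'r::comm_ring_1" where
  "antisymmetrize_aux 0 g w = g []"
| "antisymmetrize_aux (Suc n) g w = removal_sum w (\<lambda>a r. antisymmetrize_aux n (\<lambda>v. g (a # v)) r)"

definition antisymmetrize :: "('a list \<Rightarrow> 'r) \<Rightarrow> 'a list \<Rightarrow> 'r::comm_ring_1" where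
  "antisymmetrize g w = antisymmetrize_aux (length w) g w"

lemma antisymmetrize_Nil [simp]: "antisymmetrize g [] = g []"
  by (simp add: antisymmetrize_def)

lemma antisymmetrize_nonempty:
  assumes "w \<noteq> []"
  shows "antisymmetrize g w = removal_sum w (\<lambda>a r. antisymmetrize (\<lambda>v. g (a # v)) r)"
proof -
  obtain n where n: "length w = Suc n" using assms by (cases w) auto
  have "length r = n" if "mset w = add_mset a (mset r)" for a r
    using n arg_cong[OF that, of size] by simp
  then show ?thesis
    unfolding antisymmetrize_def n antisymmetrize_aux.simps by (intro removal_sum_cong) simp
qed

lemma antisymmetrize_Cons:
  "antisymmetrize g (a # w) = antisymmetrize (\<lambda>v. g (a # v)) w - removal_sum w (\<lambda>b r. antisymmetrize (\<lambda>v. g (b # v)) (a # r))"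
  by (subst antisymmetrize_nonempty) simp_all

lemma antisymmetrize_single [simp]: "antisymmetrize g [a] = g [a]"
  by (subst antisymmetrize_Cons) simp

lemma antisymmetrize_cong:
  assumes "\<And>v. mset v = mset w \<Longrightarrow> g v = g' v"
  shows "antisymmetrize g w = antisymmetrize g' w"
  using assms
proof (induction w arbitrary: g g' rule: length_induct)
  case (1 w)
  show ?case
  proof (cases "w = []")
    case False
    have "removal_sum w (\<lambda>a r. antisymmetrize (\<lambda>v. g (a # v)) r) = removal_sum w (\<lambda>a r. antisymmetrize (\<lambda>v. g' (a # v)) r)"
    proof (rule removal_sum_cong)
      fix a r assume w: "mset w = add_mset a (mset r)"
      have "length r < length w" using arg_cong[OF w, of size] by simp
      then show "antisymmetrize (\<lambda>v. g (a # v)) r = antisymmetrize (\<lambda>v. g' (a # v)) r"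
        by (intro 1(1)[rule_format] 1(2)) (simp_all add: w)
    qed
    then show ?thesis using False by (simp add: antisymmetrize_nonempty)
  qed (use 1(2) in simp)
qed

lemma antisymmetrize_add: "antisymmetrize (\<lambda>v. g v + g' v) w = antisymmetrize g w + antisymmetrize g' w"
proof (induction w arbitrary: g g' rule: length_induct)
  case (1 w)
  show ?case
  proof (cases "w = []")
    case False
    have "removal_sum w (\<lambda>a r. antisymmetrize (\<lambda>v. g (a # v) + g' (a # v)) r)
      = removal_sum w (\<lambda>a r. antisymmetrize (\<lambda>v. g (a # v)) r + antisymmetrize (\<lambda>v. g' (a # v)) r)"
    proof (rule removal_sum_cong)
      fix a r assume w: "mset w = add_mset a (mset r)"
      have "length r < length w" using arg_cong[OF w, of size] by simp
      then show "antisymmetrize (\<lambda>v. g (a # v) + g' (a # v)) r = antisymmetrize (\<lambda>v. g (a # v)) r + antisymmetrize (\<lambda>v. g' (a # v)) r"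
        using 1[rule_format, of r "\<lambda>v. g (a # v)" "\<lambda>v. g' (a # v)"] by simp
    qed
    then show ?thesis using False by (simp add: antisymmetrize_nonempty removal_sum_add)
  qed simp
qed

lemma antisymmetrize_scale: "antisymmetrize (\<lambda>v. x * g v) w = x * antisymmetrize g w"
proof (induction w arbitrary: g rule: length_induct)
  case (1 w)
  show ?case
  proof (cases "w = []")
    case False
    have "removal_sum w (\<lambda>a r. antisymmetrize (\<lambda>v. x * g (a # v)) r)
      = removal_sum w (\<lambda>a r. x * antisymmetrize (\<lambda>v. g (a # v)) r)"
    proof (rule removal_sum_cong)
      fix a r assume w: "mset w = add_mset a (mset r)"
      have "length r < length w" using arg_cong[OF w, of size] by simp
      then show "antisymmetrize (\<lambda>v. x * g (a # v)) r = x * antisymmetrize (\<lambda>v. g (a # v)) r"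
        using 1[rule_format, of r "\<lambda>v. g (a # v)"] by simp
    qed
    then show ?thesis using False by (simp add: antisymmetrize_nonempty removal_sum_scale)
  qed simp
qed

lemma antisymmetrize_minus: "antisymmetrize (\<lambda>v. - g v) w = - antisymmetrize g w"
  using antisymmetrize_scale[of "-1" g w] by simp

lemma antisymmetrize_diff: "antisymmetrize (\<lambda>v. g v - g' v) w = antisymmetrize g w - antisymmetrize g' w"
  using antisymmetrize_add[of g "\<lambda>v. - g' v" w] by (simp add: antisymmetrize_minus)

lemma antisymmetrize_zero [simp]: "antisymmetrize (\<lambda>v. 0) w = 0"
  using antisymmetrize_scale[of 0 "\<lambda>v. 0" w] by simp

lemma antisymmetrize_sum: "finite I \<Longrightarrow> antisymmetrize (\<lambda>v. \<Sum>i\<in>I. g i v) w = (\<Sum>i\<in>I. antisymmetrize (g i) w)"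
  by (induction I rule: finite_induct) (simp_all add: antisymmetrize_add)

lemma antisymmetrize_eq_0: "(\<And>v. mset v = mset w \<Longrightarrow> g v = 0) \<Longrightarrow> antisymmetrize g w = 0"
  using antisymmetrize_cong[of w g "\<lambda>_. 0"] by simp

section \<open>Alternating functions on lists\<close>

definition alternating :: "('a list \<Rightarrow> 'r::comm_ring_1) \<Rightarrow> bool" where
  "alternating \<alpha> \<longleftrightarrow> (\<forall>u a b v. \<alpha> (u @ a # b # v) = - \<alpha> (u @ b # a # v)) \<and> (\<forall>u a v. \<alpha> (u @ a # a # v) = 0)"

text \<open>Exchanging two neighbours changes the sign of each term that removes a third entry, by
  alternation of \<open>F x\<close>; the two terms that remove one of the neighbours are
  interchanged, and their positions carry opposite signs.\<close>

lemma removal_sum_alternating: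
  assumes "\<And>x. alternating (F x)"
  shows "removal_sum (u @ a # b # v) F = - removal_sum (u @ b # a # v) F"
    and "removal_sum (u @ a # a # v) F = 0"
proof -
  have F: "F x (u @ a # b # v) = - F x (u @ b # a # v)" "F x (u @ a # a # v) = 0" for x u a b v
    using assms[of x] unfolding alternating_def by blast+
  have "(\<forall>x u v. F x (u @ a # b # v) = - F x (u @ b # a # v)) \<Longrightarrow>
    removal_sum (u @ a # b # v) F = - removal_sum (u @ b # a # v) F" for F
  proof (induction u arbitrary: F)
    case Nil
    have "F x (a # b # r) = - F x (b # a # r)" for x r using Nil[rule_format, of x "[]"] by simp
    then have "removal_sum v (\<lambda>x r. F x (a # b # r)) = - removal_sum v (\<lambda>x r. F x (b # a # r))"
      by (simp add: removal_sum_minus)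
    then show ?case by simp
  next
    case (Cons y u)
    have "removal_sum (u @ a # b # v) (\<lambda>x r. F x (y # r)) = - removal_sum (u @ b # a # v) (\<lambda>x r. F x (y # r))"
      by (rule Cons.IH) (metis Cons.prems append_Cons)
    then show ?case using Cons.prems by simp
  qed
  then show "removal_sum (u @ a # b # v) F = - removal_sum (u @ b # a # v) F" using F(1) by blast
  have "(\<forall>x u v. F x (u @ a # a # v) = 0) \<Longrightarrow> removal_sum (u @ a # a # v) F = 0" for F
  proof (induction u arbitrary: F)
    case Nil
    have "F x (a # a # r) = 0" for x r using Nil[rule_format, of x "[]"] by simp
    then show ?case by simp
  next
    case (Cons y u)
    have "removal_sum (u @ a # a # v) (\<lambda>x r. F x (y # r)) = 0"
      by (rule Cons.IH) (metis Cons.prems append_Cons)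
    then show ?case using Cons.prems by simp
  qed
  then show "removal_sum (u @ a # a # v) F = 0" using F(2) by blast
qed

lemma antisymmetrize_alternating: "alternating (antisymmetrize g)"
proof -
  have "antisymmetrize g (u @ a # b # v) = - antisymmetrize g (u @ b # a # v) \<and> antisymmetrize g (u @ a # a # v) = 0"
    if "length u + length v = n" for u a b v n and g :: "'a list \<Rightarrow> 'b"
    using that
  proof (induction n arbitrary: g u v a b)
    case 0
    then show ?case by (simp add: antisymmetrize_Cons[of g])
  next
    case (Suc n)
    \<comment> \<open>\<open>alternating\<close> speaks of lists of all lengths, the induction
      hypothesis of a single one; cutting \<open>F\<close> off at the other lengths bridges
      this.\<close>
    define F where "F x r = (if length r = Suc (Suc n) then antisymmetrize (\<lambda>v. g (x # v)) r else 0)" for x r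
    have F: "alternating (F x)" for x
    proof (unfold alternating_def, intro conjI allI)
      fix u v :: "'a list" and a b
      show "F x (u @ a # b # v) = - F x (u @ b # a # v)" "F x (u @ a # a # v) = 0"
        using Suc.IH[of u v "\<lambda>v. g (x # v)" a b] by (simp_all add: F_def)
    qed
    have eq: "antisymmetrize g w = removal_sum w F" if "length w = Suc (Suc (Suc n))" for w
    proof -
      have "w \<noteq> []" using that by auto
      then show ?thesis unfolding antisymmetrize_nonempty[OF \<open>w \<noteq> []\<close>]
      proof (intro removal_sum_cong)
        fix a r assume "mset w = add_mset a (mset r)"
        from arg_cong[OF this, of size] that show "antisymmetrize (\<lambda>v. g (a # v)) r = F a r" by (simp add: F_def)
      qed
    qed
    have "antisymmetrize g (u @ a # b # v) = removal_sum (u @ a # b # v) F"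
      "antisymmetrize g (u @ b # a # v) = removal_sum (u @ b # a # v) F"
      "antisymmetrize g (u @ a # a # v) = removal_sum (u @ a # a # v) F"
      by (rule eq, use Suc.prems in simp)+
    then show ?case
      using removal_sum_alternating(1)[of F u a b v, OF F] removal_sum_alternating(2)[of F u a v, OF F]
      by metis
  qed
  then show ?thesis unfolding alternating_def by blast
qed

abbreviation increasing :: "'m::finite list \<Rightarrow> bool" where
  "increasing \<equiv> sorted_wrt (\<lambda>a b. var_key a < var_key b)"

text \<open>Insertion sort by the keys uses only exchanges of neighbours, and a sorted list is
  strictly increasing or has two equal neighbours.\<close>

lemma alternating_eq_0:
  assumes alt: "alternating \<alpha>" and inc: "\<And>w. increasing w \<Longrightarrow> \<alpha> w = 0"
  shows "\<alpha> w = 0"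
proof -
  have insort: "\<alpha> (u @ insort_key var_key a v) = 0 \<Longrightarrow> \<alpha> (u @ a # v) = 0" for u a v
  proof (induction v arbitrary: u)
    case (Cons b v)
    show ?case
    proof (cases "var_key a \<le> var_key b")
      case False
      then have "\<alpha> ((u @ [b]) @ insort_key var_key a v) = 0" using Cons.prems by simp
      then have "\<alpha> (u @ b # a # v) = 0" using Cons.IH[of "u @ [b]"] by simp
      then show ?thesis using alt unfolding alternating_def by (metis neg_equal_0_iff_equal)
    qed (use Cons.prems in simp)
  qed simp
  have sort: "\<alpha> (u @ sort_key var_key w) = 0 \<Longrightarrow> \<alpha> (u @ w) = 0" for u w
  proof (induction w arbitrary: u)
    case (Cons a w)
    have "\<alpha> (u @ a # sort_key var_key w) = 0" using Cons.prems by (intro insort) simp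
    then show ?case using Cons.IH[of "u @ [a]"] by simp
  qed simp
  have rep: "increasing l \<or> (\<exists>u a v. l = u @ a # a # v)" if "sorted (map var_key l)" for l :: "'a list"
    using that
  proof (induction l)
    case (Cons a l)
    then consider "increasing l" | u b v where "l = u @ b # b # v" by auto
    then show ?case
    proof cases
      case 1
      show ?thesis
      proof (cases l)
        case l: (Cons b l')
        show ?thesis
        proof (cases "a = b")
          case True then show ?thesis using l by (metis append_Nil)
        next
          case False
          then have "var_key a < var_key b" using Cons.prems l by (simp add: order_less_le)
          then show ?thesis using 1 l by auto
        qed
      qed simp
    next
      case 2 then show ?thesis by (metis append_Cons)
    qed
  qed simp
  have "\<alpha> (sort_key var_key w) = 0"
  proof (cases "increasing (sort_key var_key w)")
    case False
    then obtain u a v where "sort_key var_key w = u @ a # a # v" using rep[of "sort_key var_key w"] by auto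
    then show ?thesis using alt unfolding alternating_def by metis
  qed (rule inc)
  then show ?thesis using sort[of "[]" w] by simp
qed

lemma alternating_diff:
  assumes "alternating \<alpha>" "alternating \<beta>"
  shows "alternating (\<lambda>w. \<alpha> w - \<beta> w)"
proof -
  have "\<alpha> (u @ a # b # v) - \<beta> (u @ a # b # v) = - (\<alpha> (u @ b # a # v) - \<beta> (u @ b # a # v))"
    "\<alpha> (u @ a # a # v) - \<beta> (u @ a # a # v) = 0" for u a b v
    using assms unfolding alternating_def by (metis minus_diff_eq minus_diff_minus, metis diff_self)
  then show ?thesis unfolding alternating_def by blast
qed

text \<open>Of all rearrangements of an increasing list only the list itself is increasing, and it
  occurs with sign \<open>1\<close>.\<close>

lemma antisymmetrize_increasing:
  assumes "\<And>v. \<not> increasing v \<Longrightarrow> g v = 0" "increasing w"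
  shows "antisymmetrize g w = g w"
  using assms
proof (induction w arbitrary: g)
  case (Cons a w)
  have "antisymmetrize (\<lambda>v. g (a # v)) w = g (a # w)"
    by (rule Cons.IH) (use Cons.prems in auto)
  moreover have "removal_sum w (\<lambda>b r. antisymmetrize (\<lambda>v. g (b # v)) (a # r)) = removal_sum w (\<lambda>b r. 0)"
  proof (rule removal_sum_cong, rule antisymmetrize_eq_0, rule Cons.prems(1), rule notI)
    fix b r v
    assume w: "mset w = add_mset b (mset r)" and v: "mset v = mset (a # r)" and inc: "increasing (b # v)"
    have "b \<in> set w" using w by (metis set_mset_mset union_single_eq_member)
    moreover have "a \<in> set v" using v by (metis list.set_intros(1) set_mset_mset)
    ultimately show False using Cons.prems(2) inc by fastforce
  qed
  ultimately show ?case by (simp add: antisymmetrize_Cons[of g a w])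
qed simp

lemma antisymmetrize_restrict_increasing:
  assumes "alternating \<alpha>"
  shows "antisymmetrize (\<lambda>w. if increasing w then \<alpha> w else 0) = \<alpha>"
proof
  fix w
  let ?g = "\<lambda>w. if increasing w then \<alpha> w else 0"
  have "antisymmetrize ?g w - \<alpha> w = 0"
  proof (rule alternating_eq_0[of "\<lambda>w. antisymmetrize ?g w - \<alpha> w"])
    show "alternating (\<lambda>w. antisymmetrize ?g w - \<alpha> w)"
      by (intro alternating_diff antisymmetrize_alternating assms)
    show "antisymmetrize ?g w - \<alpha> w = 0" if "increasing w" for w
      using antisymmetrize_increasing[of ?g w] that by simp
  qed
  then show "antisymmetrize ?g w = \<alpha> w" by simp
qed

text \<open>The Chevalley-Eilenberg differential in coordinates. Since \<open>removal_sum2\<close>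
  runs over ordered pairs with opposite signs, the plain coefficients \<open>\<gamma>\<close>
  suffice: their antisymmetrization, the Lie bracket, arises by itself.\<close>

definition ce_diff :: "('a::finite \<Rightarrow> 'a \<Rightarrow> 'a \<Rightarrow> 'r) \<Rightarrow> ('a list \<Rightarrow> 'r) \<Rightarrow> 'a list \<Rightarrow> 'r::comm_ring_1" where
  "ce_diff \<gamma> \<eta> w = - removal_sum2 w (\<lambda>a b r. \<Sum>j\<in>UNIV. \<gamma> j a b * \<eta> (j # r))"

section \<open>Comparison of the bar complex with the Chevalley-Eilenberg complex\<close>

context structure_constants
begin

abbreviation gamma :: "'m \<Rightarrow> 'm \<Rightarrow> 'm \<Rightarrow> 'r" where
  "gamma j a b \<equiv> mu (unit_exp a) (unit_exp b) (unit_exp j)"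

abbreviation tangent :: "(('m \<Rightarrow>\<^sub>0 nat) list \<Rightarrow> 'r) \<Rightarrow> 'm list \<Rightarrow> 'r" where
  "tangent c \<equiv> antisymmetrize (\<lambda>is. c (map unit_exp is))"

text \<open>The product of two basis elements of degree one has leading term
  \<open>unit_exp a + unit_exp b\<close> and no constant term, by \<open>mu_zero\<close>; only
  linear terms are left over.\<close>

lemma merge_units:
  "merge (unit_exp a) (unit_exp b) f = f (unit_exp a + unit_exp b) + (\<Sum>j\<in>UNIV. gamma j a b * f (unit_exp j))"
proof -
  let ?S = "{L :: 'm \<Rightarrow>\<^sub>0 nat. exp_degree L \<le> 2}"
  have "mu (unit_exp a) (unit_exp b) L * f L = (if L = unit_exp a + unit_exp b then f L else 0) +
    (\<Sum>j\<in>UNIV. if L = unit_exp j then gamma j a b * f (unit_exp j) else 0)" if L: "L \<in> ?S" for L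
  proof -
    consider "L = 0" | "exp_degree L = 1" | "exp_degree L = 2"
      using L by (metis exp_degree_eq_0_iff le_SucE le_zero_eq mem_Collect_eq numeral_2_eq_2 One_nat_def)
    then show ?thesis
    proof cases
      case 1
      then have "L \<noteq> unit_exp a + unit_exp b" "\<And>j. L \<noteq> unit_exp j"
        by (metis exp_add_eq_0_iff unit_exp_neq_0(1)) (simp add: 1)
      then show ?thesis using 1 mu_zero[of "unit_exp a" "unit_exp b"] by simp
    next
      case 2
      then obtain l where l: "L = unit_exp l" by (rule exp_degree_1E)
      have "L \<noteq> unit_exp a + unit_exp b"
        using 2 by auto
      then show ?thesis by (simp add: l)
    next
      case 3
      then have "L \<noteq> unit_exp j" for j by auto
      moreover have "mu (unit_exp a) (unit_exp b) L = (if L = unit_exp a + unit_exp b then 1 else 0)"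
        using 3 by (intro mu_top) simp
      ultimately show ?thesis by simp
    qed
  qed
  then have "merge (unit_exp a) (unit_exp b) f = (\<Sum>L\<in>?S. (if L = unit_exp a + unit_exp b then f L else 0) +
    (\<Sum>j\<in>UNIV. if L = unit_exp j then gamma j a b * f (unit_exp j) else 0))"
    unfolding merge_def by (intro sum.cong) auto
  also have "\<dots> = f (unit_exp a + unit_exp b) +
     (\<Sum>L\<in>?S. \<Sum>j\<in>UNIV. if L = unit_exp j then gamma j a b * f (unit_exp j) else 0)"
    by (simp add: sum.distrib sum.delta)
  also have "(\<Sum>L\<in>?S. \<Sum>j\<in>UNIV. if L = unit_exp j then gamma j a b * f (unit_exp j) else 0) =
     (\<Sum>j\<in>UNIV. gamma j a b * f (unit_exp j))"
    by (subst sum.swap) (simp add: sum.delta)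
  finally show ?thesis .
qed

text \<open>Merging two unit exponents yields a quadratic leading term, which is symmetric in the
  two entries and cancels in the signed sum, and linear terms, which make up the bracket. The first
  and last faces vanish since unit exponents are nonzero.\<close>

lemma tangent_diff: "tangent (diff c) w = ce_diff gamma (tangent c) w"
proof -
  have "antisymmetrize (\<lambda>is. diff c (map unit_exp is)) w = ce_diff gamma (antisymmetrize (\<lambda>is. c (map unit_exp is))) w"
    if "length w \<le> n" for n w c
    using that
  proof (induction n arbitrary: c w)
    case 0 then show ?case by (simp add: ce_diff_def)
  next
    case (Suc n)
    consider "w = []" | a where "w = [a]" | "2 \<le> length w"
      by (cases w; cases "tl w") auto
    then show ?case
    proof cases
      case 1 then show ?thesis by (simp add: ce_diff_def)
    next
      case 2 then show ?thesis by (simp add: ce_diff_def)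
    next
      case 3
      \<comment> \<open>\<open>T\<close> will collect the linear terms from merging the first two
        entries, \<open>H a\<close> those from merging later entries while \<open>a\<close> stays in
        front.\<close>
      define H where "H a b b' r = (\<Sum>j\<in>UNIV. gamma j b b' * antisymmetrize (\<lambda>is. c (unit_exp a # map unit_exp is)) (j # r))" for a b b' r
      define T where "T a b r = (\<Sum>j\<in>UNIV. gamma j a b * antisymmetrize (\<lambda>is. c (unit_exp j # map unit_exp is)) r)" for a b r
      have split: "antisymmetrize (\<lambda>is. diff c (unit_exp a # map unit_exp is)) r =
        - removal_sum r (\<lambda>b r'. antisymmetrize (\<lambda>is. c ((unit_exp a + unit_exp b) # map unit_exp is)) r' + T a b r')
        + removal_sum2 r (H a)"
        if w: "mset w = add_mset a (mset r)" for a r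
      proof -
        have r: "r \<noteq> []" "length r \<le> n" using 3 Suc.prems arg_cong[OF w, of size] by auto
        have "antisymmetrize (\<lambda>is. diff c (unit_exp a # map unit_exp is)) r =
          antisymmetrize (\<lambda>is. - merge (unit_exp a) (unit_exp (hd is)) (\<lambda>L. c (L # map unit_exp (tl is)))
             - diff (\<lambda>v. c (unit_exp a # v)) (map unit_exp is)) r"
        proof (rule antisymmetrize_cong)
          fix v assume "mset v = mset r"
          then have "v \<noteq> []" using r by auto
          then show "diff c (unit_exp a # map unit_exp v) =
            - merge (unit_exp a) (unit_exp (hd v)) (\<lambda>L. c (L # map unit_exp (tl v)))
             - diff (\<lambda>v. c (unit_exp a # v)) (map unit_exp v)"
            by (cases v) auto
        qed
        also have "\<dots> = - antisymmetrize (\<lambda>is. merge (unit_exp a) (unit_exp (hd is)) (\<lambda>L. c (L # map unit_exp (tl is)))) r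
             - antisymmetrize (\<lambda>is. diff (\<lambda>v. c (unit_exp a # v)) (map unit_exp is)) r"
          by (simp add: antisymmetrize_diff antisymmetrize_minus)
        also have "antisymmetrize (\<lambda>is. merge (unit_exp a) (unit_exp (hd is)) (\<lambda>L. c (L # map unit_exp (tl is)))) r =
          removal_sum r (\<lambda>b r'. antisymmetrize (\<lambda>is. c ((unit_exp a + unit_exp b) # map unit_exp is)) r' + T a b r')"
          unfolding antisymmetrize_nonempty[OF r(1)] list.sel merge_units T_def
          by (intro removal_sum_cong) (simp add: antisymmetrize_add antisymmetrize_sum antisymmetrize_scale)
        also have "antisymmetrize (\<lambda>is. diff (\<lambda>v. c (unit_exp a # v)) (map unit_exp is)) r = - removal_sum2 r (H a)"
          using Suc.IH[OF r(2), of "\<lambda>v. c (unit_exp a # v)"] by (simp add: ce_diff_def H_def[abs_def])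
        finally show ?thesis by simp
      qed
      have "w \<noteq> []" using 3 by auto
      then have "antisymmetrize (\<lambda>is. diff c (map unit_exp is)) w =
        removal_sum w (\<lambda>a r. antisymmetrize (\<lambda>is. diff c (unit_exp a # map unit_exp is)) r)"
        by (simp add: antisymmetrize_nonempty)
      also have "\<dots> = removal_sum w (\<lambda>a r.
         - removal_sum r (\<lambda>b r'. antisymmetrize (\<lambda>is. c ((unit_exp a + unit_exp b) # map unit_exp is)) r' + T a b r')
          + removal_sum2 r (H a))"
        by (rule removal_sum_cong) (rule split)
      also have "\<dots> = - removal_sum2 w (\<lambda>a b r'. antisymmetrize (\<lambda>is. c ((unit_exp a + unit_exp b) # map unit_exp is)) r')
         - removal_sum2 w T + removal_sum w (\<lambda>a r. removal_sum2 r (H a))"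
        by (simp add: removal_sum_add removal_sum_diff removal_sum_minus removal_sum2_def)
      also have "removal_sum2 w (\<lambda>a b r'. antisymmetrize (\<lambda>is. c ((unit_exp a + unit_exp b) # map unit_exp is)) r') = 0"
        by (rule removal_sum2_symmetric) (simp add: add.commute)
      \<comment> \<open>Removing \<open>a\<close> after \<open>b\<close> and \<open>b'\<close>
        instead of before them amounts to two transpositions, hence no sign.\<close>
      also have "removal_sum w (\<lambda>a r. removal_sum2 r (H a)) =
          removal_sum2 w (\<lambda>b b' r. removal_sum r (\<lambda>a. H a b b'))"
      proof -
        have "removal_sum w (\<lambda>a r. removal_sum2 r (H a)) = removal_sum2 w (\<lambda>a b r. removal_sum r (H a b))"
          by (simp add: removal_sum2_def)
        also have "\<dots> = - removal_sum2 w (\<lambda>b a r. removal_sum r (H a b))"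
          by (simp flip: removal_sum2_swap)
        also have "\<dots> = - removal_sum w (\<lambda>b r. removal_sum2 r (\<lambda>a. H a b))"
          by (simp add: removal_sum2_def)
        also have "\<dots> = removal_sum w (\<lambda>b r. removal_sum2 r (\<lambda>b' a. H a b b'))"
        proof -
          have "removal_sum2 r (\<lambda>b' a. H a b b') = - removal_sum2 r (\<lambda>a. H a b)" for b r
            by (rule removal_sum2_swap)
          then show ?thesis by (simp add: removal_sum_minus)
        qed
        finally show ?thesis by (simp add: removal_sum2_def)
      qed
      also have "- 0 - removal_sum2 w T + removal_sum2 w (\<lambda>b b' r. removal_sum r (\<lambda>a. H a b b')) =
          - removal_sum2 w (\<lambda>b b' r. T b b' r + - removal_sum r (\<lambda>a. H a b b'))"
        unfolding removal_sum2_add removal_sum2_minus by simp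
      \<comment> \<open>By \<open>antisymmetrize_Cons\<close> for \<open>j # r\<close>:
        \<open>T\<close> is the part in which \<open>j\<close> stays in front, and the sum over
        \<open>a\<close> the part in which another entry comes first.\<close>
      also have "\<dots> = ce_diff gamma (antisymmetrize (\<lambda>is. c (map unit_exp is))) w"
        unfolding ce_diff_def T_def H_def antisymmetrize_Cons[of "\<lambda>is. c (map unit_exp is)"]
        by (simp add: removal_sum_sum removal_sum_scale right_diff_distrib sum_subtractf)
      finally show ?thesis .
    qed
  qed
  then show ?thesis by blast
qed

text \<open>At an increasing list the tangent is the value of \<open>c\<close> at the corresponding
  unit exponents, because all other arrangements are collapsible. So \<open>c\<close> vanishes on
  the unmatched lists too, and \<open>eq_0_of_diff_eq_0\<close> applies.\<close>

lemma eq_0_of_tangent_eq_0: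
  assumes "\<And>v. collapsible 0 v \<Longrightarrow> c v = 0" "\<And>w. tangent c w = 0" "\<And>v. diff c v = 0"
  shows "c v = 0"
proof (rule eq_0_of_diff_eq_0)
  fix v :: "('m \<Rightarrow>\<^sub>0 nat) list"
  assume v: "\<not> expandable 0 v"
  show "c v = 0"
  proof (cases "collapsible 0 v")
    case False
    then obtain "is" where "is": "v = map unit_exp is" using critical_units[OF v] by blast
    have "tangent c is = c (map unit_exp is)"
      using False 
    proof (intro antisymmetrize_increasing)
      show "c (map unit_exp v) = 0" if "\<not> increasing v" for v
        using that collapsible_units[of 0 v] by (intro assms(1)) blast
      show "increasing is" using False collapsible_units[of 0 "is"] by (simp add: "is")
    qed
    then show ?thesis using assms(2) "is" by simp
  qed (rule assms(1))
qed (rule assms(3))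

lemma tangent_eq_0_of_expandable: "(\<And>v. \<not> expandable 0 v \<Longrightarrow> b v = 0) \<Longrightarrow> tangent b w = 0"
  by (rule antisymmetrize_eq_0) simp

text \<open>Extension by zero from the unmatched lists; \<open>map lead\<close> recovers the
  variables of a list of unit exponents.\<close>

definition critical_extension :: "('m list \<Rightarrow> 'r) \<Rightarrow> ('m \<Rightarrow>\<^sub>0 nat) list \<Rightarrow> 'r" where
  "critical_extension \<eta> v = (if \<exists>is. increasing is \<and> v = map unit_exp is then \<eta> (map lead v) else 0)"

lemma tangent_critical_extension:
  assumes "alternating \<eta>"
  shows "tangent (critical_extension \<eta>) = \<eta>"
proof -
  have inj: "is = js" if "map unit_exp is = map unit_exp js" for "is" js :: "'m list"
    using that by (metis inj_map_eq_map inj_def unit_exp_eq_iff)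
  have lead: "map (lead \<circ> unit_exp) is = is" for "is" :: "'m list" by (simp add: comp_def)
  then have "critical_extension \<eta> (map unit_exp is) = (if increasing is then \<eta> is else 0)" for "is"
    unfolding critical_extension_def using inj by (auto simp: lead)
  then show ?thesis using antisymmetrize_restrict_increasing[OF assms] by simp
qed

text \<open>Injectivity on cohomology. The extension \<open>g\<close> of \<open>\<eta>\<close>
  accounts for the tangent; a cochain \<open>b\<close> supported on expandable lists, whose tangent
  is zero, accounts for the collapsible lists. The remaining cocycle vanishes by
  \<open>eq_0_of_tangent_eq_0\<close>.\<close>

lemma ex_diff_of_tangent:
  assumes "\<And>w. diff c w = 0" "alternating \<eta>" "\<And>w. tangent c w = ce_diff gamma \<eta> w"
  obtains b where "\<And>w. c w = diff b w"
proof -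
  define g where "g = critical_extension \<eta>"
  define c' where "c' = (\<lambda>v. c v - diff g v)"
  obtain b where b: "\<And>v. \<not> expandable 0 v \<Longrightarrow> b v = 0" "\<And>v. collapsible 0 v \<Longrightarrow> diff b v = c' v"
    using ex_diff_eq_on_collapsible by blast
  have "c' v - diff b v = 0" for v
  proof (rule eq_0_of_tangent_eq_0[of "\<lambda>v. c' v - diff b v"])
    have "tangent (\<lambda>v. c' v - diff b v) w = tangent c w - tangent (diff g) w - tangent (diff b) w" for w
      by (simp add: c'_def antisymmetrize_diff)
    moreover have "tangent b w = 0" for w using b(1) by (rule tangent_eq_0_of_expandable)
    ultimately show "tangent (\<lambda>v. c' v - diff b v) w = 0" for w
      using assms(3) tangent_critical_extension[OF assms(2)]
      by (simp add: tangent_diff g_def ce_diff_def removal_sum2_def)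
    show "diff (\<lambda>v. c' v - diff b v) v = 0" for v
      by (simp add: c'_def diff_diff_eq diff_diff assms(1))
  qed (use b in simp)
  then have "c w = diff (\<lambda>v. g v + b v) w" for w by (simp add: c'_def diff_add algebra_simps)
  then show ?thesis by (rule that)
qed

text \<open>Surjectivity on cohomology. Correcting the extension of \<open>\<eta>\<close> on
  expandable lists makes \<open>diff c\<close> vanish on collapsible lists and leaves the tangent
  alone. As \<open>diff c\<close> is a cocycle with tangent \<open>ce_diff gamma \<eta>\<close>, it
  is zero altogether.\<close>

lemma ex_cocycle_of_tangent:
  assumes "alternating \<eta>" "\<And>w. ce_diff gamma \<eta> w = 0"
  obtains c where "\<And>w. diff c w = 0" "tangent c = \<eta>"
proof -
  define g where "g = critical_extension \<eta>"
  obtain b where b: "\<And>v. \<not> expandable 0 v \<Longrightarrow> b v = 0" "\<And>v. collapsible 0 v \<Longrightarrow> diff b v = diff g v"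
    using ex_diff_eq_on_collapsible[of "diff g"] by blast
  define c where "c = (\<lambda>v. g v - b v)"
  have tc: "tangent c = \<eta>"
  proof
    fix w
    have "tangent b w = 0" using b(1) by (rule tangent_eq_0_of_expandable)
    then show "tangent c w = \<eta> w"
      using tangent_critical_extension[OF assms(1)] by (simp add: c_def antisymmetrize_diff g_def)
  qed
  have "diff c w = 0" for w
  proof (rule eq_0_of_tangent_eq_0)
    show "diff c v = 0" if "collapsible 0 v" for v using b(2)[OF that] by (simp add: c_def diff_diff_eq)
    show "tangent (diff c) w = 0" for w using tangent_diff[of c w] tc assms(2) by simp
  qed (rule diff_diff)
  then show ?thesis using tc by (rule that)
qed

end

section \<open>Coefficients of power series\<close>

lemma mfps_coeff_simps [simp]:
  "mfps_coeff 0 e = 0" "mfps_coeff (f + g) e = mfps_coeff f e + mfps_coeff g e"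
  "mfps_coeff (f - g) e = mfps_coeff f e - mfps_coeff g e" "mfps_coeff (- f) e = - mfps_coeff f e"
  for f g :: "('v, 'a::comm_ring_1) mfps"
  by (simp_all add: zero_mfps_def plus_mfps_def minus_mfps_def uminus_mfps_def)

lemma mfps_coeff_one: "mfps_coeff (1 :: ('v, 'a::comm_ring_1) mfps) e = (if e = 0 then 1 else 0)"
  by (simp add: one_mfps_def)

lemma mfps_coeff_mult:
  "mfps_coeff (f * g) e = (\<Sum>(a, b)\<in>exp_splits e. mfps_coeff f a * mfps_coeff g b)"
  for f g :: "('v, 'a::comm_ring_1) mfps"
  by (simp add: times_mfps_def)

lemma mfps_coeff_sum: "mfps_coeff (\<Sum>i\<in>I. f i) e = (\<Sum>i\<in>I. mfps_coeff (f i) e)"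
  for f :: "_ \<Rightarrow> ('v, 'a::comm_ring_1) mfps"
  by (induction I rule: infinite_finite_induct) auto

lemma mfps_coeff_const_mult [simp]:
  "mfps_coeff (mfps_const c * f) e = c * mfps_coeff f e" for f :: "('v, 'a::comm_ring_1) mfps"
proof -
  have "mfps_coeff (mfps_const c * f) e = (\<Sum>(a, b)\<in>{(0 :: 'v \<Rightarrow>\<^sub>0 nat, e)}. mfps_coeff (mfps_const c) a * mfps_coeff f b)"
    unfolding mfps_coeff_mult
    by (intro sum.mono_neutral_right finite_exp_splits) (auto simp: exp_splits_def mfps_const_def split: if_splits)
  then show ?thesis by (simp add: mfps_const_def)
qed

lemma mfps_coeff_of_nat_mult [simp]:
  "mfps_coeff (of_nat n * f) e = of_nat n * mfps_coeff f e" for f :: "('v, 'a::comm_ring_1) mfps"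
  by (induction n) (simp_all add: distrib_right)

lemma mfps_coeff_neg_one_power_mult [simp]:
  "mfps_coeff ((-1) ^ n * f) e = (-1) ^ n * mfps_coeff f e" for f :: "('v, 'a::comm_ring_1) mfps"
  by (induction n) (simp_all add: mult.assoc)

definition mfps_monom :: "('v \<Rightarrow>\<^sub>0 nat) \<Rightarrow> ('v, 'a::comm_ring_1) mfps" where
  "mfps_monom d = Abs_mfps (\<lambda>e. if e = d then 1 else 0)"

lemma mfps_coeff_monom [simp]: "mfps_coeff (mfps_monom d) e = (if e = d then 1 else 0)"
  by (simp add: mfps_monom_def)

lemma mfps_monom_mult: "(mfps_monom a :: ('v, 'b::comm_ring_1) mfps) * mfps_monom b = mfps_monom (a + b)"
proof (rule mfps_eqI)
  fix e :: "'v \<Rightarrow>\<^sub>0 nat"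
  have "mfps_coeff ((mfps_monom a :: ('v, 'b) mfps) * mfps_monom b) e =
    (\<Sum>p\<in>exp_splits e. if p = (a, b) then 1 else 0 :: 'b)"
    unfolding mfps_coeff_mult by (rule sum.cong) (auto split: if_splits)
  also have "\<dots> = (if (a, b) \<in> exp_splits e then 1 else 0)"
    using finite_exp_splits by (rule sum.delta)
  also have "\<dots> = mfps_coeff (mfps_monom (a + b) :: ('v, 'b) mfps) e" by (auto simp: exp_splits_def)
  finally show "mfps_coeff ((mfps_monom a :: ('v, 'b) mfps) * mfps_monom b) e = mfps_coeff (mfps_monom (a + b) :: ('v, 'b) mfps) e" .
qed

lemma mfps_monom_0: "mfps_monom 0 = 1"
  by (rule mfps_eqI) (simp add: mfps_coeff_one)

lemma mfps_X_eq_monom: "mfps_X v = mfps_monom (unit_exp v)"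
  by (rule mfps_eqI) (simp add: mfps_X_def)

lemma mfps_X_power: "mfps_X v ^ k = mfps_monom (single v k)"
proof (induction k)
  case (Suc k)
  then show ?case by (simp add: mfps_X_eq_monom mfps_monom_mult flip: single_add)
qed (simp add: mfps_monom_0)

lemma mfps_monom_sum: "(\<Prod>w\<in>S. mfps_monom (d w)) = mfps_monom (\<Sum>w\<in>S. d w)"
  by (induction S rule: infinite_finite_induct) (auto simp: mfps_monom_0 mfps_monom_mult)

section \<open>Renaming of variables, supports and orders of vanishing\<close>

definition exp_push :: "('w \<Rightarrow> 'v) \<Rightarrow> ('w \<Rightarrow>\<^sub>0 nat) \<Rightarrow> ('v \<Rightarrow>\<^sub>0 nat)" where
  "exp_push \<rho> d = (\<Sum>w\<in>keys d. single (\<rho> w) (lookup d w))"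

lemma lookup_exp_push:
  "inj \<rho> \<Longrightarrow> lookup (exp_push \<rho> d) v = (if v \<in> range \<rho> then lookup d (the_inv \<rho> v) else 0)"
proof -
  assume inj: "inj \<rho>"
  have "lookup (exp_push \<rho> d) v =
    (\<Sum>w\<in>keys d. if \<rho> w = v then lookup d w else 0)"
    by (simp add: exp_push_def lookup_sum lookup_single when_def)
  also have "\<dots> = (if v \<in> range \<rho> then lookup d (the_inv \<rho> v) else 0)"
  proof (cases "v \<in> range \<rho>")
    case True
    then obtain u where u: "v = \<rho> u" by blast
    then have "(\<Sum>w\<in>keys d. if \<rho> w = v then lookup d w else 0)
      = (\<Sum>w\<in>keys d. if w = u then lookup d w else 0)"
      using inj by (simp add: inj_eq)
    then show ?thesis using inj by (auto simp: u in_keys_iff the_inv_f_f)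
  qed (auto intro!: sum.neutral)
  finally show ?thesis .
qed

lemma lookup_exp_push_image [simp]:
  "inj \<rho> \<Longrightarrow> lookup (exp_push \<rho> d) (\<rho> w) = lookup d w"
  by (simp add: lookup_exp_push the_inv_f_f)

lemma keys_exp_push: "inj \<rho> \<Longrightarrow> keys (exp_push \<rho> d) = \<rho> ` keys d"
  by (auto simp: in_keys_iff lookup_exp_push the_inv_f_f split: if_splits)

lemma exp_push_inject [simp]: "inj \<rho> \<Longrightarrow> exp_push \<rho> d = exp_push \<rho> d' \<longleftrightarrow> d = d'"
  by (metis lookup_exp_push_image poly_mapping_eqI)

lemma exp_push_zero [simp]: "exp_push \<rho> 0 = 0"
  by (simp add: exp_push_def)

lemma exp_push_single [simp]: "exp_push \<rho> (single v k) = single (\<rho> v) k"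
  by (simp add: exp_push_def)

lemma exp_degree_sum: "exp_degree (\<Sum>i\<in>I. f i) = (\<Sum>i\<in>I. exp_degree (f i))"
  by (induction I rule: infinite_finite_induct) auto

lemma exp_degree_push [simp]: "exp_degree (exp_push \<rho> d) = exp_degree d"
  by (simp add: exp_push_def exp_degree_sum) (simp add: exp_degree_def)

lemma prod_mfps_X_power:
  "(\<Prod>w\<in>keys d. mfps_X (\<rho> w) ^ lookup d w) = mfps_monom (exp_push \<rho> d)"
  by (simp add: exp_push_def mfps_X_power mfps_monom_sum)

text \<open>Distinct exponents go to distinct monomials, so at most one term of the
  \<open>Sum_any\<close> is nonzero, however many variables \<open>f\<close> involves.\<close>

lemma mfps_coeff_subst_rename:
  assumes "inj \<rho>"
  shows "mfps_coeff (mfps_subst (\<lambda>w. mfps_X (\<rho> w)) f) (exp_push \<rho> d) = mfps_coeff f d"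
    and "e \<notin> range (exp_push \<rho>) \<Longrightarrow> mfps_coeff (mfps_subst (\<lambda>w. mfps_X (\<rho> w)) f) e = 0"
proof -
  have "mfps_coeff (mfps_subst (\<lambda>w. mfps_X (\<rho> w)) f) (exp_push \<rho> d) =
    Sum_any (\<lambda>d'. mfps_coeff f d' when d' = d)"
    unfolding mfps_subst_def prod_mfps_X_power mfps_coeff_Abs
    by (rule Sum_any.cong) (use assms in auto)
  then show "mfps_coeff (mfps_subst (\<lambda>w. mfps_X (\<rho> w)) f) (exp_push \<rho> d) = mfps_coeff f d" by simp
  show "mfps_coeff (mfps_subst (\<lambda>w. mfps_X (\<rho> w)) f) e = 0" if "e \<notin> range (exp_push \<rho>)"
  proof -
    have "e \<noteq> exp_push \<rho> d" for d using that by blast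
    then show ?thesis unfolding mfps_subst_def prod_mfps_X_power by simp
  qed
qed

definition mfps_supported :: "'v set \<Rightarrow> ('v, 'a::comm_ring_1) mfps \<Rightarrow> bool" where
  "mfps_supported S f \<longleftrightarrow> (\<forall>e. mfps_coeff f e \<noteq> 0 \<longrightarrow> keys e \<subseteq> S)"

lemma mfps_supported_one [simp]: "mfps_supported S 1"
  by (simp add: mfps_supported_def mfps_coeff_one)

lemma mfps_supported_mult:
  assumes "mfps_supported S f" "mfps_supported S g"
  shows "mfps_supported S (f * g)"
  unfolding mfps_supported_def
proof (intro allI impI)
  fix e assume "mfps_coeff (f * g) e \<noteq> 0"
  then obtain p where "p \<in> exp_splits e" "(case p of (a, b) \<Rightarrow> mfps_coeff f a * mfps_coeff g b) \<noteq> 0"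
    unfolding mfps_coeff_mult by (rule sum.not_neutral_contains_not_neutral)
  then obtain a b where "a + b = e" "mfps_coeff f a * mfps_coeff g b \<noteq> 0"
    by (auto simp: exp_splits_def)
  then show "keys e \<subseteq> S"
    using assms unfolding mfps_supported_def by (metis Un_least keys_exp_add mult_zero_left mult_zero_right)
qed

lemma mfps_supported_prod: "(\<And>i. i \<in> I \<Longrightarrow> mfps_supported S (f i)) \<Longrightarrow> mfps_supported S (\<Prod>i\<in>I. f i)"
  by (induction I rule: infinite_finite_induct) (auto intro: mfps_supported_mult)

lemma mfps_supported_monom: "keys d \<subseteq> S \<Longrightarrow> mfps_supported S (mfps_monom d)"
  by (simp add: mfps_supported_def)

lemma mfps_supported_mono: "mfps_supported S f \<Longrightarrow> S \<subseteq> T \<Longrightarrow> mfps_supported T f"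
  unfolding mfps_supported_def by blast

lemma mfps_supported_subst_rename:
  assumes "inj \<rho>" "range \<rho> \<subseteq> S"
  shows "mfps_supported S (mfps_subst (\<lambda>w. mfps_X (\<rho> w)) f)"
  unfolding mfps_supported_def
proof (intro allI impI)
  fix e assume "mfps_coeff (mfps_subst (\<lambda>w. mfps_X (\<rho> w)) f) e \<noteq> 0"
  then have "e \<in> range (exp_push \<rho>)" using mfps_coeff_subst_rename(2)[OF assms(1)] by blast
  then show "keys e \<subseteq> S" using assms by (auto simp: keys_exp_push image_subset_iff)
qed

definition exp_restrict :: "'v set \<Rightarrow> ('v \<Rightarrow>\<^sub>0 nat) \<Rightarrow> ('v \<Rightarrow>\<^sub>0 nat)" where
  "exp_restrict S e = Abs_poly_mapping (\<lambda>v. lookup e v when v \<in> S)"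

lemma lookup_exp_restrict [simp]:
  "lookup (exp_restrict S e) v = (if v \<in> S then lookup e v else 0)"
proof -
  have "finite {v. (lookup e v when v \<in> S) \<noteq> 0}"
    by (rule finite_subset[of _ "keys e"]) (auto simp: in_keys_iff when_def)
  then show ?thesis by (simp add: exp_restrict_def when_def)
qed

lemma keys_exp_restrict [simp]: "keys (exp_restrict S e) = keys e \<inter> S"
  by (auto simp: in_keys_iff split: if_splits)

text \<open>When the factors involve disjoint sets of variables, the only splitting of the exponent
  that contributes is the one into its restrictions.\<close>

lemma mfps_coeff_mult_disjoint:
  assumes "mfps_supported S f" "mfps_supported T g" "S \<inter> T = {}" "keys e \<subseteq> S \<union> T"
  shows "mfps_coeff (f * g) e = mfps_coeff f (exp_restrict S e) * mfps_coeff g (exp_restrict T e)"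
proof -
  have "mfps_coeff (f * g) e =
    (\<Sum>(a, b)\<in>{(exp_restrict S e, exp_restrict T e)}. mfps_coeff f a * mfps_coeff g b)"
    unfolding mfps_coeff_mult
  proof (intro sum.mono_neutral_right finite_exp_splits ballI)
    have "lookup e v = 0" if "v \<notin> S" "v \<notin> T" for v
      using assms(4) that by (auto simp: in_keys_iff subset_iff)
    then have "exp_restrict S e + exp_restrict T e = e"
      using assms(3) by (intro poly_mapping_eqI) (auto simp: lookup_add)
    then show "{(exp_restrict S e, exp_restrict T e)} \<subseteq> exp_splits e" by (simp add: exp_splits_def)
  next
    fix p assume p: "p \<in> exp_splits e - {(exp_restrict S e, exp_restrict T e)}"
    obtain a b where ab: "p = (a, b)" by (cases p)
    show "(case p of (a, b) \<Rightarrow> mfps_coeff f a * mfps_coeff g b) = 0"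
    proof (rule ccontr)
      assume "\<not> ?thesis"
      then have "mfps_coeff f a \<noteq> 0" "mfps_coeff g b \<noteq> 0" by (auto simp: ab)
      then have a: "keys a \<subseteq> S" and b: "keys b \<subseteq> T"
        using assms(1,2) by (auto simp: mfps_supported_def)
      have e: "e = a + b" using p by (auto simp: ab exp_splits_def)
      have a0: "lookup a v = 0" if "v \<notin> S" for v using a that by (auto simp: in_keys_iff)
      have b0: "lookup b v = 0" if "v \<notin> T" for v using b that by (auto simp: in_keys_iff)
      have "a = exp_restrict S e"
        using assms(3) by (intro poly_mapping_eqI) (auto simp: e lookup_add a0 intro!: b0)
      moreover have "b = exp_restrict T e"
        using assms(3) by (intro poly_mapping_eqI) (auto simp: e lookup_add b0 intro!: a0)
      ultimately show False using p by (simp add: ab)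
    qed
  qed
  then show ?thesis by simp
qed

lemma mfps_coeff_eq_0_of_supported:
  "mfps_supported S f \<Longrightarrow> \<not> keys e \<subseteq> S \<Longrightarrow> mfps_coeff f e = 0"
  unfolding mfps_supported_def by blast

lemma mfps_coeff_prod_disjoint:
  assumes "finite I" "\<And>i. i \<in> I \<Longrightarrow> mfps_supported (S i) (f i)" "disjoint_family_on S I"
    "keys e \<subseteq> (\<Union>i\<in>I. S i)"
  shows "mfps_coeff (\<Prod>i\<in>I. f i) e = (\<Prod>i\<in>I. mfps_coeff (f i) (exp_restrict (S i) e))"
  using assms
proof (induction I arbitrary: e rule: finite_induct)
  case empty
  then show ?case by (simp add: mfps_coeff_one)
next
  case (insert i I)
  let ?T = "\<Union>j\<in>I. S j"
  have disj: "S i \<inter> ?T = {}" using insert.prems(2) insert.hyps by (auto simp: disjoint_family_on_def)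
  have "mfps_supported ?T (\<Prod>j\<in>I. f j)"
    using insert.prems(1) by (intro mfps_supported_prod) (auto intro: mfps_supported_mono)
  then have "mfps_coeff (\<Prod>j\<in>insert i I. f j) e =
    mfps_coeff (f i) (exp_restrict (S i) e) * mfps_coeff (\<Prod>j\<in>I. f j) (exp_restrict ?T e)"
    using insert.hyps insert.prems disj by (simp add: mfps_coeff_mult_disjoint)
  also have "mfps_coeff (\<Prod>j\<in>I. f j) (exp_restrict ?T e) =
    (\<Prod>j\<in>I. mfps_coeff (f j) (exp_restrict (S j) (exp_restrict ?T e)))"
    using insert.prems by (intro insert.IH) (auto simp: disjoint_family_on_def)
  also have "\<dots> = (\<Prod>j\<in>I. mfps_coeff (f j) (exp_restrict (S j) e))"
    by (intro prod.cong refl arg_cong2[where f = mfps_coeff] poly_mapping_eqI) auto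
  finally show ?case using insert.hyps by simp
qed

definition mfps_order_ge :: "nat \<Rightarrow> ('v, 'a::comm_ring_1) mfps \<Rightarrow> bool" where
  "mfps_order_ge k f \<longleftrightarrow> (\<forall>e. exp_degree e < k \<longrightarrow> mfps_coeff f e = 0)"

lemma mfps_order_ge_0 [simp]: "mfps_order_ge 0 f"
  by (simp add: mfps_order_ge_def)

lemma mfps_order_ge_1_iff: "mfps_order_ge (Suc 0) f \<longleftrightarrow> mfps_coeff f 0 = 0"
  by (auto simp: mfps_order_ge_def)

lemma mfps_order_ge_add: "mfps_order_ge k f \<Longrightarrow> mfps_order_ge k g \<Longrightarrow> mfps_order_ge k (f + g)"
  by (simp add: mfps_order_ge_def)

lemma mfps_order_ge_mult:
  assumes "mfps_order_ge k f" "mfps_order_ge l g"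
  shows "mfps_order_ge (k + l) (f * g)"
  unfolding mfps_order_ge_def
proof (intro allI impI)
  fix e :: "'a \<Rightarrow>\<^sub>0 nat" assume e: "exp_degree e < k + l"
  show "mfps_coeff (f * g) e = 0"
    unfolding mfps_coeff_mult
  proof (rule sum.neutral, rule ballI)
    fix p assume "p \<in> exp_splits e"
    then obtain a b where p: "p = (a, b)" "a + b = e" by (auto simp: exp_splits_def)
    then have "exp_degree a + exp_degree b < k + l" using e by auto
    then have "exp_degree a < k \<or> exp_degree b < l" by linarith
    then show "(case p of (a, b) \<Rightarrow> mfps_coeff f a * mfps_coeff g b) = 0"
      using assms by (auto simp: p mfps_order_ge_def)
  qed
qed

lemma mfps_order_ge_power: "mfps_order_ge (Suc 0) f \<Longrightarrow> mfps_order_ge n (f ^ n)"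
  using mfps_order_ge_mult[of "Suc 0" f] by (induction n) auto

lemma mfps_order_ge_prod:
  "(\<And>i. i \<in> I \<Longrightarrow> mfps_order_ge (k i) (f i)) \<Longrightarrow> mfps_order_ge (\<Sum>i\<in>I. k i) (\<Prod>i\<in>I. f i)"
  by (induction I rule: infinite_finite_induct) (auto intro: mfps_order_ge_mult)

section \<open>Substitution\<close>

definition mfps_eval_monom :: "('w::finite \<Rightarrow> ('v, 'a::comm_ring_1) mfps) \<Rightarrow> ('w \<Rightarrow>\<^sub>0 nat) \<Rightarrow> ('v, 'a) mfps" where
  "mfps_eval_monom s d = (\<Prod>w\<in>UNIV. s w ^ lookup d w)"

lemma mfps_eval_monom_keys:
  "(\<Prod>w\<in>keys d. s w ^ lookup d w) = mfps_eval_monom s d"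
  unfolding mfps_eval_monom_def by (rule prod.mono_neutral_left) (auto simp: in_keys_iff)

lemma mfps_eval_monom_add: "mfps_eval_monom s (a + b) = mfps_eval_monom s a * mfps_eval_monom s b"
  by (simp add: mfps_eval_monom_def lookup_add power_add prod.distrib)

lemma mfps_eval_monom_0 [simp]: "mfps_eval_monom s 0 = 1"
  by (simp add: mfps_eval_monom_def)

lemma mfps_eval_monom_order:
  assumes "\<And>w. mfps_coeff (s w) 0 = 0" "exp_degree e < exp_degree d"
  shows "mfps_coeff (mfps_eval_monom s d) e = 0"
proof -
  have "mfps_order_ge (\<Sum>w\<in>UNIV. lookup d w) (mfps_eval_monom s d)"
    unfolding mfps_eval_monom_def using assms(1)
    by (intro mfps_order_ge_prod mfps_order_ge_power) (simp add: mfps_order_ge_1_iff)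
  then show ?thesis using assms(2) by (simp add: mfps_order_ge_def exp_degree_UNIV)
qed

text \<open>The image of a monomial of degree \<open>k\<close> has order at least \<open>k\<close>,
  so monomials of degree above \<open>N\<close> do not reach \<open>e\<close>. The bound is kept
  free in order to share it between several exponents.\<close>

lemma mfps_coeff_subst:
  fixes s :: "'w::finite \<Rightarrow> ('v, 'a::comm_ring_1) mfps"
  assumes "\<And>w. mfps_coeff (s w) 0 = 0" "exp_degree e \<le> N"
  shows "mfps_coeff (mfps_subst s f) e =
    (\<Sum>d | exp_degree d \<le> N. mfps_coeff f d * mfps_coeff (mfps_eval_monom s d) e)"
  unfolding mfps_subst_def mfps_coeff_Abs mfps_eval_monom_keys
proof (rule Sum_any.expand_superset)
  show "{d. mfps_coeff f d * mfps_coeff (mfps_eval_monom s d) e \<noteq> 0} \<subseteq> {d. exp_degree d \<le> N}"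
  proof safe
    fix d assume "mfps_coeff f d * mfps_coeff (mfps_eval_monom s d) e \<noteq> 0"
    then have "\<not> exp_degree e < exp_degree d" using mfps_eval_monom_order[of s, OF assms(1)] by auto
    then show "exp_degree d \<le> N" using assms(2) by simp
  qed
qed simp

lemma mfps_subst_one:
  fixes s :: "'w::finite \<Rightarrow> ('v, 'a::comm_ring_1) mfps"
  assumes "\<And>w. mfps_coeff (s w) 0 = 0"
  shows "mfps_subst s 1 = 1"
proof (rule mfps_eqI)
  fix e :: "'v \<Rightarrow>\<^sub>0 nat"
  have "mfps_coeff (mfps_subst s 1) e =
    (\<Sum>d :: 'w \<Rightarrow>\<^sub>0 nat | exp_degree d \<le> exp_degree e. if d = 0 then mfps_coeff (mfps_eval_monom s 0) e else 0)"
    unfolding mfps_coeff_subst[OF assms order_refl] by (intro sum.cong) (auto simp: mfps_coeff_one)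
  also have "\<dots> = mfps_coeff 1 e" by (subst sum.delta) auto
  finally show "mfps_coeff (mfps_subst s 1) e = mfps_coeff 1 e" .
qed

lemma mfps_subst_mult:
  fixes s :: "'w::finite \<Rightarrow> ('v, 'a::comm_ring_1) mfps"
  assumes s: "\<And>w. mfps_coeff (s w) 0 = 0"
  shows "mfps_subst s (f * g) = mfps_subst s f * mfps_subst s g"
proof (rule mfps_eqI)
  fix e :: "'v \<Rightarrow>\<^sub>0 nat"
  define N where "N = exp_degree e"
  let ?D = "{d :: 'w \<Rightarrow>\<^sub>0 nat. exp_degree d \<le> N}"
  let ?h = "\<lambda>(a, b). mfps_coeff f a * mfps_coeff g b * mfps_coeff (mfps_eval_monom s (a + b)) e"
  have "mfps_coeff (mfps_subst s (f * g)) e = (\<Sum>d\<in>?D. \<Sum>p\<in>exp_splits d. ?h p)"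
    unfolding mfps_coeff_subst[OF s, of e N, unfolded N_def, OF order_refl, folded N_def] mfps_coeff_mult
      sum_distrib_right
    by (intro sum.cong refl) (auto simp: exp_splits_def)
  also have "\<dots> = (\<Sum>p\<in>(\<Union>d\<in>?D. exp_splits d). ?h p)"
    by (subst sum.UNION_disjoint) (auto simp: finite_exp_splits, auto simp: exp_splits_def)
  \<comment> \<open>The pairs added here have total degree above that of \<open>e\<close>, so the
    substituted monomial has no coefficient at \<open>e\<close>.\<close>
  also have "\<dots> = (\<Sum>p\<in>?D \<times> ?D. ?h p)"
  proof (rule sum.mono_neutral_left)
    show "(\<Union>d\<in>?D. exp_splits d) \<subseteq> ?D \<times> ?D" by (auto simp: exp_splits_def)
    show "\<forall>p\<in>?D \<times> ?D - (\<Union>d\<in>?D. exp_splits d). ?h p = 0"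
    proof safe
      fix a b :: "'w \<Rightarrow>\<^sub>0 nat"
      assume "(a, b) \<notin> (\<Union>d\<in>?D. exp_splits d)"
      then have "exp_degree e < exp_degree (a + b)" by (auto simp: exp_splits_def N_def)
      from mfps_eval_monom_order[of s, OF s this]
      show "mfps_coeff f a * mfps_coeff g b * mfps_coeff (mfps_eval_monom s (a + b)) e = 0" by simp
    qed
  qed simp
  also have "\<dots> = (\<Sum>a\<in>?D. \<Sum>b\<in>?D. \<Sum>(p, q)\<in>exp_splits e. (mfps_coeff f a * mfps_coeff (mfps_eval_monom s a) p) *
      (mfps_coeff g b * mfps_coeff (mfps_eval_monom s b) q))"
    unfolding sum.cartesian_product[symmetric]
    by (intro sum.cong refl)
      (simp add: mfps_eval_monom_add mfps_coeff_mult sum_distrib_left case_prod_unfold mult_ac)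
  also have "\<dots> = (\<Sum>(p, q)\<in>exp_splits e. (\<Sum>a\<in>?D. mfps_coeff f a * mfps_coeff (mfps_eval_monom s a) p) *
      (\<Sum>b\<in>?D. mfps_coeff g b * mfps_coeff (mfps_eval_monom s b) q))"
    unfolding case_prod_unfold sum_product
    by (subst (2) sum.swap) (subst sum.swap, simp)
  also have "\<dots> = (\<Sum>(p, q)\<in>exp_splits e. mfps_coeff (mfps_subst s f) p * mfps_coeff (mfps_subst s g) q)"
  proof (intro sum.cong refl, clarify)
    fix p q :: "'v \<Rightarrow>\<^sub>0 nat" assume "(p, q) \<in> exp_splits e"
    then have "exp_degree p \<le> N" "exp_degree q \<le> N" by (auto simp: exp_splits_def N_def)
    then show "(\<Sum>a\<in>?D. mfps_coeff f a * mfps_coeff (mfps_eval_monom s a) p) *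
      (\<Sum>b\<in>?D. mfps_coeff g b * mfps_coeff (mfps_eval_monom s b) q) =
      mfps_coeff (mfps_subst s f) p * mfps_coeff (mfps_subst s g) q"
      by (simp add: mfps_coeff_subst[OF s])
  qed
  finally show "mfps_coeff (mfps_subst s (f * g)) e = mfps_coeff (mfps_subst s f * mfps_subst s g) e"
    by (simp add: mfps_coeff_mult)
qed

lemma mfps_subst_power:
  fixes s :: "'w::finite \<Rightarrow> ('v, 'a::comm_ring_1) mfps"
  assumes "\<And>w. mfps_coeff (s w) 0 = 0"
  shows "mfps_subst s (f ^ n) = mfps_subst s f ^ n"
  by (induction n) (simp_all add: mfps_subst_one mfps_subst_mult assms)

lemma mfps_subst_eval_monom:
  fixes s :: "'w::finite \<Rightarrow> ('v, 'a::comm_ring_1) mfps" and G :: "'u::finite \<Rightarrow> ('w, 'a) mfps"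
  assumes s: "\<And>w. mfps_coeff (s w) 0 = 0"
  shows "mfps_eval_monom (\<lambda>u. mfps_subst s (G u)) L = mfps_subst s (mfps_eval_monom G L)"
proof -
  have "mfps_subst s (\<Prod>u\<in>I. f u) = (\<Prod>u\<in>I. mfps_subst s (f u))" for I and f :: "'u \<Rightarrow> ('w, 'a) mfps"
    by (induction I rule: infinite_finite_induct) (simp_all add: mfps_subst_one[of s, OF s] mfps_subst_mult[of s, OF s])
  then show ?thesis by (simp add: mfps_eval_monom_def mfps_subst_power[of s, OF s])
qed

lemma mfps_coeff_subst_0:
  fixes s :: "'w::finite \<Rightarrow> ('v, 'a::comm_ring_1) mfps"
  assumes "\<And>w. mfps_coeff (s w) 0 = 0"
  shows "mfps_coeff (mfps_subst s f) 0 = mfps_coeff f 0"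
  using mfps_coeff_subst[OF assms, of 0 0] by (simp add: mfps_coeff_one)

lemma mfps_coeff_X_0 [simp]: "mfps_coeff (mfps_X v) 0 = 0"
  by (simp add: mfps_X_def)

lemma mfps_coeff_mult_disjoint_add:
  assumes "mfps_supported S f" "mfps_supported T g" "S \<inter> T = {}"
    "keys a \<subseteq> S" "keys b \<subseteq> T"
  shows "mfps_coeff (f * g) (a + b) = mfps_coeff f a * mfps_coeff g b"
proof -
  have a0: "lookup a v = 0" if "v \<notin> S" for v using assms(4) that by (auto simp: in_keys_iff)
  have b0: "lookup b v = 0" if "v \<notin> T" for v using assms(5) that by (auto simp: in_keys_iff)
  have "exp_restrict S (a + b) = a"
    using assms(3) by (intro poly_mapping_eqI) (auto simp: lookup_add a0 intro!: b0)
  moreover have "exp_restrict T (a + b) = b"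
    using assms(3) by (intro poly_mapping_eqI) (auto simp: lookup_add b0 intro!: a0)
  moreover have "keys (a + b) \<subseteq> S \<union> T" using assms(4,5) by (auto simp: keys_exp_add)
  ultimately show ?thesis using mfps_coeff_mult_disjoint[OF assms(1-3), of "a + b"] by simp
qed

lemma exp_push_add: "inj \<rho> \<Longrightarrow> exp_push \<rho> (a + b) = exp_push \<rho> a + exp_push \<rho> b"
  by (intro poly_mapping_eqI) (simp add: lookup_exp_push lookup_add)

lemma exp_push_push: "inj \<sigma> \<Longrightarrow> inj \<rho> \<Longrightarrow> exp_push \<sigma> (exp_push \<rho> a) = exp_push (\<lambda>w. \<sigma> (\<rho> w)) a"
proof (intro poly_mapping_eqI)
  fix v assume inj: "inj \<sigma>" "inj \<rho>"
  have inj': "inj (\<lambda>w. \<sigma> (\<rho> w))" using inj by (simp add: inj_def)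
  show "lookup (exp_push \<sigma> (exp_push \<rho> a)) v = lookup (exp_push (\<lambda>w. \<sigma> (\<rho> w)) a) v"
  proof (cases "v \<in> range (\<lambda>w. \<sigma> (\<rho> w))")
    case True
    then obtain w where "v = \<sigma> (\<rho> w)" by blast
    then show ?thesis using lookup_exp_push_image[OF inj', of a w] inj by simp
  next
    case False
    then have "v \<notin> keys (exp_push \<sigma> (exp_push \<rho> a))" "v \<notin> keys (exp_push (\<lambda>w. \<sigma> (\<rho> w)) a)"
      using inj inj' by (auto simp: keys_exp_push)
    then show ?thesis by (simp add: in_keys_iff)
  qed
qed

definition exp_pair :: "('v \<Rightarrow>\<^sub>0 nat) \<Rightarrow> ('v \<Rightarrow>\<^sub>0 nat) \<Rightarrow> ('v + 'v \<Rightarrow>\<^sub>0 nat)" where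
  "exp_pair a b = exp_push Inl a + exp_push Inr b"

lemma lookup_exp_pair [simp]:
  "lookup (exp_pair a b) (Inl l) = lookup a l"
  "lookup (exp_pair a b) (Inr l) = lookup b l"
proof -
  have "Inl l \<notin> keys (exp_push Inr b)" "Inr l \<notin> keys (exp_push Inl a)"
    by (auto simp: keys_exp_push)
  then show "lookup (exp_pair a b) (Inl l) = lookup a l"
    "lookup (exp_pair a b) (Inr l) = lookup b l"
    by (simp_all add: exp_pair_def lookup_add in_keys_iff)
qed

lemma exp_pair_eq_iff [simp]: "exp_pair a b = exp_pair a' b' \<longleftrightarrow> a = a' \<and> b = b'"
  by (metis lookup_exp_pair poly_mapping_eqI)

lemma exp_pair_eq_0_iff [simp]: "exp_pair a b = 0 \<longleftrightarrow> a = 0 \<and> b = 0"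
proof -
  have "exp_pair 0 0 = (0 :: 'a + 'a \<Rightarrow>\<^sub>0 nat)" by (simp add: exp_pair_def)
  then show ?thesis by (metis exp_pair_eq_iff)
qed

lemma exp_degree_pair [simp]: "exp_degree (exp_pair a b) = exp_degree a + exp_degree b"
  by (simp add: exp_pair_def)

lemma exp_pairE:
  fixes d :: "'m::finite + 'm \<Rightarrow>\<^sub>0 nat"
  obtains a b where "d = exp_pair a b"
proof
  define a where "a = Abs_poly_mapping (\<lambda>l. lookup d (Inl l))"
  define b where "b = Abs_poly_mapping (\<lambda>l. lookup d (Inr l))"
  have "lookup d w = lookup (exp_pair a b) w" for w
    by (cases w) (simp_all add: a_def b_def)
  then show "d = exp_pair a b" by (rule poly_mapping_eqI)
qed

lemma exp_push_pair:
  assumes "inj \<rho>"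
  shows "exp_push \<rho> (exp_pair a b) = exp_push (\<lambda>l. \<rho> (Inl l)) a + exp_push (\<lambda>l. \<rho> (Inr l)) b"
  using assms by (simp add: exp_pair_def exp_push_add exp_push_push)

lemma prod_UNIV_sum: "(\<Prod>w\<in>(UNIV :: ('a::finite + 'b::finite) set). f w) = (\<Prod>l\<in>UNIV. f (Inl l)) * (\<Prod>l\<in>UNIV. f (Inr l))"
  for f :: "_ \<Rightarrow> 'c::comm_monoid_mult"
  unfolding UNIV_sum by (subst prod.union_disjoint) (auto simp: prod.reindex)

lemma mfps_eval_monom_pair:
  "mfps_eval_monom (case_sum A B) (exp_pair a b) = mfps_eval_monom A a * mfps_eval_monom B b"
  by (simp add: mfps_eval_monom_def prod_UNIV_sum)

lemma mfps_eval_monom_X: "mfps_eval_monom (\<lambda>l. mfps_X (\<rho> l)) a = mfps_monom (exp_push \<rho> a)"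
  unfolding mfps_eval_monom_keys[symmetric] by (rule prod_mfps_X_power)

section \<open>Factorials of exponents and divided powers\<close>

lemma exp_fact_superset:
  assumes "finite S" "keys e \<subseteq> S"
  shows "exp_fact e = (\<Prod>v\<in>S. fact (lookup e v))"
  unfolding exp_fact_def using assms by (intro prod.mono_neutral_left) (auto simp: in_keys_iff)

lemma exp_fact_0 [simp]: "exp_fact 0 = 1"
  by (simp add: exp_fact_def)

lemma exp_fact_pos [simp]: "0 < exp_fact e"
  unfolding exp_fact_def by (intro prod_pos) simp

lemma exp_fact_neq_0 [simp]: "exp_fact e \<noteq> 0"
  using exp_fact_pos[of e] by simp

lemma exp_fact_push [simp]: "inj \<rho> \<Longrightarrow> exp_fact (exp_push \<rho> a) = exp_fact a"
  unfolding exp_fact_def keys_exp_push by (subst prod.reindex) (auto intro: inj_on_subset)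

lemma exp_fact_add_disjoint:
  assumes "keys a \<inter> keys b = {}"
  shows "exp_fact (a + b) = exp_fact a * exp_fact b"
proof -
  have "exp_fact (a + b) = (\<Prod>v\<in>keys a. fact (lookup (a + b) v)) *
     (\<Prod>v\<in>keys b. fact (lookup (a + b) v))"
    unfolding exp_fact_def keys_exp_add using assms by (intro prod.union_disjoint) auto
  also have "(\<Prod>v\<in>keys a. fact (lookup (a + b) v)) = exp_fact a"
    unfolding exp_fact_def using assms by (intro prod.cong) (auto simp: lookup_add in_keys_iff disjoint_iff)
  also have "(\<Prod>v\<in>keys b. fact (lookup (a + b) v)) = exp_fact b"
    unfolding exp_fact_def
  proof (rule prod.cong[OF refl])
    fix v assume "v \<in> keys b"
    then have "v \<notin> keys a" using assms by blast
    then show "fact (lookup (a + b) v) = fact (lookup b v)"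
      by (simp add: lookup_add in_keys_iff)
  qed
  finally show ?thesis .
qed

lemma exp_fact_pair [simp]: "exp_fact (exp_pair a b) = exp_fact a * exp_fact b"
  unfolding exp_pair_def by (subst exp_fact_add_disjoint) (auto simp: keys_exp_push)

text \<open>The quotient is a product of binomial coefficients, one for each variable.\<close>

lemma exp_fact_mult_dvd: "exp_fact a * exp_fact b dvd exp_fact (a + b)"
proof -
  let ?S = "keys a \<union> keys b"
  have "exp_fact a * exp_fact b = (\<Prod>v\<in>?S. fact (lookup a v) * fact (lookup b v))"
    by (simp add: exp_fact_superset[of ?S] prod.distrib)
  also have "\<dots> dvd (\<Prod>v\<in>?S. fact (lookup (a + b) v))"
    by (intro prod_dvd_prod) (simp add: lookup_add fact_fact_dvd_fact)
  also have "\<dots> = exp_fact (a + b)"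
    by (subst exp_fact_superset[of ?S]) (auto simp: keys_exp_add)
  finally show ?thesis .
qed

lemma exp_fact_add_unit: "exp_fact (e + unit_exp v) = Suc (lookup e v) * exp_fact e"
proof -
  let ?S = "insert v (keys e)"
  have "exp_fact (e + unit_exp v) = (\<Prod>w\<in>?S. fact (lookup (e + unit_exp v) w))"
    by (rule exp_fact_superset) (auto simp: keys_exp_add)
  also have "\<dots> = fact (Suc (lookup e v)) *
      (\<Prod>w\<in>?S - {v}. fact (lookup (e + unit_exp v) w))"
    by (subst prod.remove[of ?S v]) (auto simp: lookup_add)
  also have "(\<Prod>w\<in>?S - {v}. fact (lookup (e + unit_exp v) w)) =
      (\<Prod>w\<in>?S - {v}. fact (lookup e w))"
    by (intro prod.cong) (auto simp: lookup_add lookup_single when_def)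
  also have "fact (Suc (lookup e v)) * \<dots> = Suc (lookup e v) * (\<Prod>w\<in>?S. fact (lookup e w))"
    by (subst prod.remove[of ?S v]) (auto simp: algebra_simps)
  also have "(\<Prod>w\<in>?S. fact (lookup e w)) = exp_fact e"
    by (rule exp_fact_superset[symmetric]) auto
  finally show ?thesis by simp
qed

lemma mfps_coeff_deriv:
  "mfps_coeff (mfps_deriv v f) e = of_nat (Suc (lookup e v)) * mfps_coeff f (e + unit_exp v)"
  by (simp add: mfps_deriv_def)

text \<open>The factor \<open>Suc (lookup e v)\<close> is the exponent of \<open>v\<close> in
  \<open>e + unit_exp v\<close>, and it is distributed over the exponents of \<open>v\<close> in the
  two factors.\<close>

lemma mfps_deriv_mult: "mfps_deriv v (f * g) = mfps_deriv v f * g + f * mfps_deriv v g"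
  for f g :: "('v, 'a::comm_ring_1) mfps"
proof (rule mfps_eqI)
  fix e :: "'v \<Rightarrow>\<^sub>0 nat"
  have shift: "(\<Sum>(a, b)\<in>exp_splits (e + unit_exp v). of_nat (lookup a v) * (mfps_coeff f a * mfps_coeff g b)) =
     mfps_coeff (mfps_deriv v f * g) e" for f g :: "('v, 'a) mfps"
  proof -
    have "mfps_coeff (mfps_deriv v f * g) e =
      (\<Sum>(a, b)\<in>(\<lambda>(a, b). (a + unit_exp v, b)) ` exp_splits e. of_nat (lookup a v) * (mfps_coeff f a * mfps_coeff g b))"
      unfolding mfps_coeff_mult mfps_coeff_deriv
      by (subst sum.reindex) (auto simp: inj_on_def lookup_add mult.assoc case_prod_unfold)
    also have "\<dots> = (\<Sum>(a, b)\<in>exp_splits (e + unit_exp v). of_nat (lookup a v) * (mfps_coeff f a * mfps_coeff g b))"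
    proof (rule sum.mono_neutral_left[OF finite_exp_splits])
      show "(\<lambda>(a, b). (a + unit_exp v, b)) ` exp_splits e \<subseteq> exp_splits (e + unit_exp v)"
        by (auto simp: exp_splits_def ac_simps)
      show "\<forall>p\<in>exp_splits (e + unit_exp v) - (\<lambda>(a, b). (a + unit_exp v, b)) ` exp_splits e.
        (case p of (a, b) \<Rightarrow> of_nat (lookup a v) * (mfps_coeff f a * mfps_coeff g b)) = 0"
      proof clarify
        fix a b assume ab: "(a, b) \<in> exp_splits (e + unit_exp v)"
          "(a, b) \<notin> (\<lambda>(a, b). (a + unit_exp v, b)) ` exp_splits e"
        have "lookup a v = 0"
        proof (rule ccontr)
          assume "lookup a v \<noteq> 0"
          then have a: "(a - unit_exp v) + unit_exp v = a"
            using exp_minus_unit[of v a] by (simp add: in_keys_iff add.commute)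
          then have "((a - unit_exp v) + b) + unit_exp v = e + unit_exp v"
            using ab(1) by (simp add: exp_splits_def ac_simps)
          then have "(a - unit_exp v, b) \<in> exp_splits e" by (simp add: exp_splits_def)
          then show False using ab(2) a by force
        qed
        then show "of_nat (lookup a v) * (mfps_coeff f a * mfps_coeff g b) = 0" by simp
      qed
    qed
    finally show ?thesis by simp
  qed
  have swap: "(\<Sum>(a, b)\<in>exp_splits (e + unit_exp v). of_nat (lookup b v) * (mfps_coeff f a * mfps_coeff g b)) =
     mfps_coeff (f * mfps_deriv v g) e"
    unfolding mult.commute[of f] shift[symmetric]
    by (rule sum.reindex_bij_witness[where i = prod.swap and j = prod.swap])
      (auto simp: exp_splits_def add.commute mult.commute)
  have "mfps_coeff (mfps_deriv v (f * g)) e = (\<Sum>(a, b)\<in>exp_splits (e + unit_exp v).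
      of_nat (lookup a v) * (mfps_coeff f a * mfps_coeff g b) +
      of_nat (lookup b v) * (mfps_coeff f a * mfps_coeff g b))"
    unfolding mfps_coeff_deriv mfps_coeff_mult sum_distrib_left
  proof (rule sum.cong[OF refl], clarify)
    fix a b assume "(a, b) \<in> exp_splits (e + unit_exp v)"
    then have "lookup (a + b) v = lookup (e + unit_exp v) v" by (simp add: exp_splits_def)
    then have "Suc (lookup e v) = lookup a v + lookup b v"
      by (simp add: lookup_add)
    then show "of_nat (Suc (lookup e v)) * (mfps_coeff f a * mfps_coeff g b) =
      of_nat (lookup a v) * (mfps_coeff f a * mfps_coeff g b) +
      of_nat (lookup b v) * (mfps_coeff f a * mfps_coeff g b)"
      by (simp add: distrib_right del: of_nat_Suc)
  qed
  then show "mfps_coeff (mfps_deriv v (f * g)) e = mfps_coeff (mfps_deriv v f * g + f * mfps_deriv v g) e"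
    by (simp add: sum.distrib case_prod_unfold shift[unfolded case_prod_unfold] swap[unfolded case_prod_unfold])
qed

lemma mfps_deriv_power: "mfps_deriv v (f ^ Suc n) = of_nat (Suc n) * (f ^ n * mfps_deriv v f)"
proof (induction n)
  case (Suc n)
  have "mfps_deriv v (f ^ Suc (Suc n)) = mfps_deriv v f * f ^ Suc n + f * mfps_deriv v (f ^ Suc n)"
    by (subst power_Suc) (rule mfps_deriv_mult)
  then show ?case unfolding Suc.IH by (simp add: algebra_simps)
qed simp

text \<open>Expresses without division that \<open>f / k\<close> has divided power
  coefficients.\<close>

definition coeffs_divisible :: "nat \<Rightarrow> ('v, 'a::comm_ring_1) mfps \<Rightarrow> bool" where
  "coeffs_divisible k f \<longleftrightarrow> (\<forall>e. of_nat k dvd of_nat (exp_fact e) * mfps_coeff f e)"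

lemma coeffs_divisible_1 [simp]: "coeffs_divisible (Suc 0) f"
  by (simp add: coeffs_divisible_def)

lemma coeffs_divisible_mult:
  assumes "coeffs_divisible k f" "coeffs_divisible l g"
  shows "coeffs_divisible (k * l) (f * g)"
  unfolding coeffs_divisible_def mfps_coeff_mult sum_distrib_left
proof (intro allI dvd_sum, clarify)
  fix e a b :: "'a \<Rightarrow>\<^sub>0 nat"
  assume "(a, b) \<in> exp_splits e"
  then have "exp_fact a * exp_fact b dvd exp_fact e" using exp_fact_mult_dvd by (auto simp: exp_splits_def)
  then obtain m where m: "exp_fact e = exp_fact a * exp_fact b * m" by (elim dvdE)
  have "of_nat k * of_nat l dvd (of_nat (exp_fact a) * mfps_coeff f a) * (of_nat (exp_fact b) * mfps_coeff g b)"
    using assms unfolding coeffs_divisible_def by (intro mult_dvd_mono) auto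
  then have "of_nat k * of_nat l dvd (of_nat (exp_fact a) * mfps_coeff f a) * (of_nat (exp_fact b) * mfps_coeff g b) * of_nat m"
    by (rule dvd_mult2)
  then show "of_nat (k * l) dvd of_nat (exp_fact e) * (mfps_coeff f a * mfps_coeff g b)"
    by (simp add: m mult_ac)
qed

lemma coeffs_divisible_prod:
  "(\<And>i. i \<in> I \<Longrightarrow> coeffs_divisible (k i) (f i)) \<Longrightarrow> coeffs_divisible (\<Prod>i\<in>I. k i) (\<Prod>i\<in>I. f i)"
  by (induction I rule: infinite_finite_induct) (auto intro: coeffs_divisible_mult)

text \<open>Divided powers of a series without constant term have divided power coefficients, because
  the derivative of \<open>f\<^sup>n / n!\<close> is \<open>f\<^sup>n\<^sup>-\<^sup>1 / (n - 1)!\<close> times that of \<open>f\<close>.\<close>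

lemma coeffs_divisible_power:
  assumes "mfps_coeff f 0 = 0"
  shows "coeffs_divisible (fact n) (f ^ n)"
proof (induction n)
  case (Suc n)
  show ?case
    unfolding coeffs_divisible_def
  proof
    fix e
    show "of_nat (fact (Suc n)) dvd of_nat (exp_fact e) * mfps_coeff (f ^ Suc n) e"
    proof (cases "e = 0")
      case True
      have "mfps_order_ge (Suc n) (f ^ Suc n)"
        using assms by (intro mfps_order_ge_power) (simp add: mfps_order_ge_1_iff)
      then have "mfps_coeff (f ^ Suc n) 0 = 0" by (simp add: mfps_order_ge_def del: power_Suc)
      then show ?thesis by (simp add: True del: power_Suc)
    next
      case False
      then obtain v where "v \<in> keys e" by (meson ex_in_conv keys_eq_empty)
      define e' where "e' = e - unit_exp v"
      have e: "e = e' + unit_exp v"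
        using exp_minus_unit[OF \<open>v \<in> keys e\<close>] by (simp add: e'_def add.commute)
      \<comment> \<open>In the normalization by factorials a derivative merely shifts coefficients,
        so the claim at \<open>e\<close> becomes one at \<open>e'\<close> about the
        derivative.\<close>
      have "of_nat (exp_fact e) * mfps_coeff (f ^ Suc n) e =
          of_nat (exp_fact e') * mfps_coeff (mfps_deriv v (f ^ Suc n)) e'"
        unfolding e exp_fact_add_unit mfps_coeff_deriv by (simp add: algebra_simps del: power_Suc)
      also have "\<dots> = of_nat (Suc n) * (of_nat (exp_fact e') * mfps_coeff (f ^ n * mfps_deriv v f) e')"
        by (simp only: mfps_deriv_power mfps_coeff_of_nat_mult mult.left_commute)
      finally have eq: "of_nat (exp_fact e) * mfps_coeff (f ^ Suc n) e =
         of_nat (Suc n) * (of_nat (exp_fact e') * mfps_coeff (f ^ n * mfps_deriv v f) e')" .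
      have "coeffs_divisible (fact n * Suc 0) (f ^ n * mfps_deriv v f)"
        by (intro coeffs_divisible_mult Suc.IH) simp
      then show ?thesis unfolding eq coeffs_divisible_def fact_Suc of_nat_mult of_nat_id
        by (intro mult_dvd_mono) auto
    qed
  qed
qed (simp add: coeffs_divisible_def)

text \<open>The coefficients of the comultiplication on power series, in the basis of monomials.
  They are the structure constants of the dual algebra before the normalization by
  factorials.\<close>

definition fgl_nu :: "('m::finite \<Rightarrow> ('m + 'm, 'a::comm_ring_1) mfps) \<Rightarrow> ('m \<Rightarrow>\<^sub>0 nat) \<Rightarrow> ('m \<Rightarrow>\<^sub>0 nat) \<Rightarrow> ('m \<Rightarrow>\<^sub>0 nat) \<Rightarrow> 'a" where
  "fgl_nu G a b L = mfps_coeff (mfps_eval_monom G L) (exp_pair a b)"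

lemma exp_fact_UNIV: "exp_fact e = (\<Prod>v\<in>UNIV. fact (lookup e v))" for e :: "'m::finite \<Rightarrow>\<^sub>0 nat"
  by (rule exp_fact_superset) auto

lemma exp_fact_dvd_fgl_nu:
  assumes "\<And>j. mfps_coeff (G j) 0 = 0"
  shows "of_nat (exp_fact L) dvd of_nat (exp_fact a * exp_fact b) * fgl_nu G a b L"
proof -
  have "coeffs_divisible (exp_fact L) (mfps_eval_monom G L)"
    unfolding mfps_eval_monom_def exp_fact_UNIV
    by (intro coeffs_divisible_prod coeffs_divisible_power assms)
  then show ?thesis unfolding coeffs_divisible_def fgl_nu_def by (metis exp_fact_pair)
qed

lemma fgl_nu_degree:
  assumes "\<And>j. mfps_coeff (G j) 0 = 0" "exp_degree a + exp_degree b < exp_degree L"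
  shows "fgl_nu G a b L = 0"
  unfolding fgl_nu_def using assms by (intro mfps_eval_monom_order) auto

text \<open>The two series have order at least \<open>k\<close> and the same homogeneous part of
  degree \<open>k\<close>. The bounds on the orders are included because they make the notion
  multiplicative.\<close>

definition mfps_same_initial :: "nat \<Rightarrow> ('v, 'a::comm_ring_1) mfps \<Rightarrow> ('v, 'a) mfps \<Rightarrow> bool" where
  "mfps_same_initial k f g \<longleftrightarrow> mfps_order_ge k f \<and> mfps_order_ge k g \<and> mfps_order_ge (Suc k) (f - g)"

lemma mfps_same_initial_mult:
  assumes "mfps_same_initial k f f'" "mfps_same_initial l g g'"
  shows "mfps_same_initial (k + l) (f * g) (f' * g')"
proof -
  have "f * g - f' * g' = (f - f') * g + f' * (g - g')" by (simp add: algebra_simps)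
  moreover have "mfps_order_ge (Suc k + l) ((f - f') * g)" "mfps_order_ge (k + Suc l) (f' * (g - g'))"
    using assms unfolding mfps_same_initial_def by (blast intro: mfps_order_ge_mult)+
  ultimately have "mfps_order_ge (Suc (k + l)) (f * g - f' * g')"
    by (metis add_Suc add_Suc_right mfps_order_ge_add)
  then show ?thesis using assms unfolding mfps_same_initial_def by (blast intro: mfps_order_ge_mult)
qed

lemma mfps_same_initial_one: "mfps_same_initial 0 1 1"
  by (simp add: mfps_same_initial_def mfps_order_ge_def)

lemma mfps_same_initial_eval_monom:
  assumes "\<And>w. mfps_same_initial (Suc 0) (G w) (H w)"
  shows "mfps_same_initial (exp_degree L) (mfps_eval_monom G L) (mfps_eval_monom H L)"
proof -
  have pow: "mfps_same_initial n (G w ^ n) (H w ^ n)" for n w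
  proof (induction n)
    case (Suc n)
    then show ?case using mfps_same_initial_mult[OF assms[of w] Suc.IH] by simp
  qed (simp add: mfps_same_initial_one)
  have prod: "mfps_same_initial (\<Sum>w\<in>I. k w) (\<Prod>w\<in>I. f w) (\<Prod>w\<in>I. f' w)"
    if "\<And>w. mfps_same_initial (k w) (f w) (f' w)" for I k and f f' :: "'a \<Rightarrow> ('b, 'c) mfps"
    using that by (induction I rule: infinite_finite_induct) (auto simp: mfps_same_initial_one intro: mfps_same_initial_mult)
  then show ?thesis unfolding mfps_eval_monom_def exp_degree_UNIV by (intro prod pow)
qed

lemma mfps_coeff_binomial:
  fixes l k :: 'v
  assumes "l \<noteq> k"
  shows "mfps_coeff ((mfps_X l + mfps_X k) ^ n :: ('v, 'a::comm_ring_1) mfps)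
      (single l a + single k b) = (if a + b = n then of_nat (n choose a) else 0)"
proof -
  have inj: "single l a + single k b = single l a' + single k b'
    \<longleftrightarrow> a = a' \<and> b = b'" for a b a' b' :: nat
  proof
    assume eq: "single l a + single k b = single l a' + single k b'"
    show "a = a' \<and> b = b'"
      using arg_cong[OF eq, of "\<lambda>e. lookup e l"] arg_cong[OF eq, of "\<lambda>e. lookup e k"] assms
      by (simp add: lookup_add lookup_single when_def)
  qed simp
  have "mfps_coeff ((mfps_X l + mfps_X k) ^ n :: ('v, 'a) mfps) (single l a + single k b) =
    (\<Sum>i\<le>n. of_nat (n choose i) * (if a = i \<and> b = n - i then 1 else 0))"
    unfolding binomial_ring mfps_coeff_sum
    by (intro sum.cong refl) (simp add: mfps_X_power mfps_monom_mult mult.assoc inj)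
  also have "\<dots> = (\<Sum>i\<le>n. if i = a then (if a + b = n then of_nat (n choose a) else 0) else 0)"
    by (intro sum.cong refl) auto
  also have "\<dots> = (if a + b = n then of_nat (n choose a) else 0)"
    by (subst sum.delta) auto
  finally show ?thesis .
qed

text \<open>For the additive group each index contributes a power of a sum of two variables of its
  own, so the coefficient is a product of binomial coefficients.\<close>

lemma fgl_nu_additive:
  "fgl_nu (\<lambda>l. mfps_X (Inl l) + mfps_X (Inr l)) a b L =
    (\<Prod>l\<in>UNIV. if lookup a l + lookup b l = lookup L l
      then of_nat (lookup L l choose lookup a l) else 0)"
proof -
  let ?S = "\<lambda>l. {Inl l, Inr l}"
  have "mfps_supported (?S l) (mfps_X (Inl l) + mfps_X (Inr l) :: ('b + 'b, 'a) mfps)" for l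
    by (auto simp: mfps_supported_def mfps_X_def split: if_splits)
  then have supp: "mfps_supported (?S l) ((mfps_X (Inl l) + mfps_X (Inr l) :: ('b + 'b, 'a) mfps) ^ n)" for l n
    by (induction n) (auto intro: mfps_supported_mult)
  have res: "exp_restrict (?S l) (exp_pair a b) =
      single (Inl l) (lookup a l) + single (Inr l) (lookup b l)" for l
  proof (rule poly_mapping_eqI)
    fix v show "lookup (exp_restrict (?S l) (exp_pair a b)) v =
      lookup (single (Inl l) (lookup a l) + single (Inr l) (lookup b l)) v"
      by (cases v) (auto simp: lookup_add lookup_single when_def)
  qed
  have UN: "(\<Union>l\<in>UNIV. ?S l) = UNIV"
  proof (rule UNIV_eq_I[symmetric])
    show "v \<in> (\<Union>l\<in>UNIV. ?S l)" for v by (cases v) auto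
  qed
  show ?thesis
    unfolding fgl_nu_def mfps_eval_monom_def
    by (subst mfps_coeff_prod_disjoint[where S = ?S])
      (auto simp: supp UN disjoint_family_on_def res mfps_coeff_binomial)
qed

lemma fgl_coeff_le_1:
  assumes "formal_group_law G"
  shows "mfps_coeff (G j) 0 = 0"
    and "mfps_same_initial (Suc 0) (G j) (mfps_X (Inl j) + mfps_X (Inr j))"
proof -
  have coeff: "mfps_coeff (G j) e = mfps_coeff (mfps_X (Inl j) + mfps_X (Inr j)) e" if "exp_degree e \<le> 1" for e
  proof -
    have "e \<noteq> unit_exp (Inl l) + unit_exp (Inr k)" for l k :: 'a
      using that by auto
    then show ?thesis
      using assms that unfolding formal_group_law_def
      by (simp add: mfps_coeff_sum mult.assoc mfps_X_eq_monom mfps_monom_mult)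
  qed
  then show 0: "mfps_coeff (G j) 0 = 0" by simp
  show "mfps_same_initial (Suc 0) (G j) (mfps_X (Inl j) + mfps_X (Inr j))"
    unfolding mfps_same_initial_def
    using coeff 0 by (auto simp: mfps_order_ge_1_iff mfps_order_ge_def)
qed

section \<open>Structure constants of a formal group law\<close>

lemma inj_Pair [simp]: "inj (Pair k)"
  by (simp add: inj_def)

lemma fgl_apply_X:
  "fgl_apply G (\<lambda>l. mfps_X (p, l)) (\<lambda>l. mfps_X (q, l)) =
    (\<lambda>j. mfps_subst (\<lambda>w. mfps_X (case_sum (Pair p) (Pair q) w)) (G j))"
proof -
  have *: "case_sum (\<lambda>l. mfps_X (p, l)) (\<lambda>l. mfps_X (q, l)) = (\<lambda>w. mfps_X (case_sum (Pair p) (Pair q) w))"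
    by (auto split: sum.split)
  show ?thesis by (rule ext) (simp only: fgl_apply_def *)
qed

lemma inj_case_sum_Pair: "p \<noteq> q \<Longrightarrow> inj (case_sum (Pair p) (Pair q))"
  by (auto simp: inj_def split: sum.splits)

lemma mfps_eval_monom_fgl_apply_X:
  "mfps_eval_monom (fgl_apply G (\<lambda>l. mfps_X (p, l)) (\<lambda>l. mfps_X (q, l))) L =
    mfps_subst (\<lambda>w. mfps_X (case_sum (Pair p) (Pair q) w)) (mfps_eval_monom G L)"
  unfolding fgl_apply_X by (rule mfps_subst_eval_monom) simp

lemma mfps_coeff_fgl_apply_X:
  assumes "p \<noteq> q"
  shows "mfps_coeff (mfps_eval_monom (fgl_apply G (\<lambda>l. mfps_X (p, l)) (\<lambda>l. mfps_X (q, l))) L)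
    (exp_push (Pair p) a + exp_push (Pair q) b) = fgl_nu G a b L"
proof -
  have "exp_push (Pair p) a + exp_push (Pair q) b = exp_push (case_sum (Pair p) (Pair q)) (exp_pair a b)"
    by (simp add: exp_push_pair inj_case_sum_Pair[OF assms])
  then show ?thesis
    unfolding mfps_eval_monom_fgl_apply_X fgl_nu_def
    by (simp add: mfps_coeff_subst_rename(1) inj_case_sum_Pair[OF assms])
qed

lemma mfps_supported_fgl_apply_X:
  assumes "p \<noteq> q"
  shows "mfps_supported ({p, q} \<times> UNIV) (mfps_eval_monom (fgl_apply G (\<lambda>l. mfps_X (p, l)) (\<lambda>l. mfps_X (q, l))) L)"
  unfolding mfps_eval_monom_fgl_apply_X
  by (rule mfps_supported_subst_rename[OF inj_case_sum_Pair[OF assms]]) (auto split: sum.splits)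

lemma keys_exp_push_Pair: "keys (exp_push (Pair k) a) \<subseteq> {k} \<times> UNIV"
  by (auto simp: keys_exp_push)

lemma mfps_coeff_fgl_apply_0:
  fixes A B :: "'m::finite \<Rightarrow> ('v, 'a::comm_ring_1) mfps"
  assumes "mfps_coeff (G j) 0 = 0" "\<And>l. mfps_coeff (A l) 0 = 0" "\<And>l. mfps_coeff (B l) 0 = 0"
  shows "mfps_coeff (fgl_apply G A B j) 0 = 0"
proof -
  have *: "mfps_coeff (case_sum A B w) 0 = 0" for w using assms by (cases w) auto
  show ?thesis unfolding fgl_apply_def mfps_coeff_subst_0[of "case_sum A B", OF *] by (rule assms(1))
qed

lemma mfps_coeff_fgl_apply_mono:
  fixes A B :: "'m::finite \<Rightarrow> ('v, 'a::comm_ring_1) mfps"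
  assumes "\<And>l. mfps_coeff (A l) 0 = 0" "\<And>l. mfps_coeff (B l) 0 = 0"
  shows "mfps_coeff (mfps_eval_monom (fgl_apply G A B) M) e =
    (\<Sum>d | exp_degree d \<le> exp_degree e. mfps_coeff (mfps_eval_monom G M) d *
      mfps_coeff (mfps_eval_monom (case_sum A B) d) e)"
proof -
  have *: "mfps_coeff (case_sum A B w) 0 = 0" for w using assms by (cases w) auto
  have "mfps_eval_monom (fgl_apply G A B) M = mfps_subst (case_sum A B) (mfps_eval_monom G M)"
    using mfps_subst_eval_monom[of "case_sum A B" G M, OF *] by (simp add: fgl_apply_def[abs_def])
  then show ?thesis using mfps_coeff_subst[of "case_sum A B" e "exp_degree e", OF *] by simp
qed

text \<open>Up to the order of the factors in each term, both sides are the coefficient at the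
  exponents \<open>a\<close>, \<open>b\<close>, \<open>c\<close> of three points in the monomial
  \<open>M\<close> of the threefold group law, computed with its two bracketings.\<close>

lemma fgl_nu_assoc:
  fixes G :: "'m::finite \<Rightarrow> ('m + 'm, 'a::comm_ring_1) mfps"
  assumes G: "formal_group_law G"
  shows "(\<Sum>L | exp_degree L \<le> exp_degree a + exp_degree b. fgl_nu G a b L * fgl_nu G L c M) =
    (\<Sum>L | exp_degree L \<le> exp_degree b + exp_degree c. fgl_nu G b c L * fgl_nu G a L M)"
proof -
  define X where "X p = (\<lambda>l. mfps_X (p, l) :: (nat \<times> 'm, 'a) mfps)" for p
  define P where "P p a = exp_push (Pair p) a" for p :: nat and a :: "'m \<Rightarrow>\<^sub>0 nat"
  note G0 = fgl_coeff_le_1(1)[OF G]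
  have P_inject: "P p a = P p b \<longleftrightarrow> a = b" for p a b by (simp add: P_def)
  have X0: "mfps_coeff (X p l) 0 = 0" for p l by (simp add: X_def)
  have GX0: "mfps_coeff (fgl_apply G (X p) (X q) j) 0 = 0" for p q j
    by (intro mfps_coeff_fgl_apply_0 G0 X0)
  have XM: "mfps_eval_monom (X p) a = mfps_monom (P p a)" for p a
    unfolding X_def P_def by (rule mfps_eval_monom_X)
  have suppX: "mfps_supported ({p} \<times> UNIV) (mfps_monom (P p a) :: (nat \<times> 'm, 'a) mfps)" for p a
    unfolding P_def by (intro mfps_supported_monom keys_exp_push_Pair)
  have keysP: "keys (P p a) \<subseteq> {p} \<times> UNIV" for p a
    unfolding P_def by (rule keys_exp_push_Pair)
  have keysPP: "keys (P p a + P q b) \<subseteq> {p, q} \<times> UNIV" for p q a b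
    using keysP[of p a] keysP[of q b] by (auto simp: keys_exp_add)
  have suppG: "mfps_supported ({p, q} \<times> UNIV) (mfps_eval_monom (fgl_apply G (X p) (X q)) L)" if "p \<noteq> q" for p q L
    unfolding X_def by (rule mfps_supported_fgl_apply_X[OF that])
  have coeffG: "mfps_coeff (mfps_eval_monom (fgl_apply G (X p) (X q)) L) (P p a + P q b) = fgl_nu G a b L"
    if "p \<noteq> q" for p q L a b
    unfolding X_def P_def by (rule mfps_coeff_fgl_apply_X[OF that])
  define E where "E = (P 0 a + P 1 b) + P 2 c"
  have degE: "exp_degree E = exp_degree a + exp_degree b + exp_degree c" by (simp add: E_def P_def)
  have "mfps_coeff (mfps_eval_monom (fgl_apply G (fgl_apply G (X 0) (X 1)) (X 2)) M) E =
    (\<Sum>d | exp_degree d \<le> exp_degree E. mfps_coeff (mfps_eval_monom G M) d *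
      mfps_coeff (mfps_eval_monom (case_sum (fgl_apply G (X 0) (X 1)) (X 2)) d) E)"
    by (rule mfps_coeff_fgl_apply_mono) (rule GX0 X0)+
  \<comment> \<open>The third point enters only through the second argument of the outer law, so the
    exponent there has to be \<open>c\<close>; the exponent \<open>L\<close> of the inner law is
    then bounded by degree.\<close>
  also have "\<dots> = (\<Sum>d\<in>(\<lambda>L. exp_pair L c) ` {L. exp_degree L \<le> exp_degree a + exp_degree b}. mfps_coeff (mfps_eval_monom G M) d *
      mfps_coeff (mfps_eval_monom (case_sum (fgl_apply G (X 0) (X 1)) (X 2)) d) E)"
  proof (rule sum.mono_neutral_right)
    show "\<forall>d\<in>{d. exp_degree d \<le> exp_degree E} - (\<lambda>L. exp_pair L c) ` {L. exp_degree L \<le> exp_degree a + exp_degree b}.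
      mfps_coeff (mfps_eval_monom G M) d * mfps_coeff (mfps_eval_monom (case_sum (fgl_apply G (X 0) (X 1)) (X 2)) d) E = 0"
    proof
      fix d assume d: "d \<in> {d. exp_degree d \<le> exp_degree E} - (\<lambda>L. exp_pair L c) ` {L. exp_degree L \<le> exp_degree a + exp_degree b}"
      obtain L R where LR: "d = exp_pair L R" by (rule exp_pairE)
      have "mfps_coeff (mfps_eval_monom (case_sum (fgl_apply G (X 0) (X 1)) (X 2)) d) E =
          fgl_nu G a b L * mfps_coeff (mfps_monom (P 2 R) :: (nat \<times> 'm, 'a) mfps) (P 2 c)"
        unfolding LR mfps_eval_monom_pair XM E_def coeffG[of 0 1, OF zero_neq_one, symmetric]
        by (rule mfps_coeff_mult_disjoint_add[OF suppG suppX _ keysPP keysP]) auto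
      moreover have "fgl_nu G a b L = 0 \<or> P 2 c \<noteq> P 2 R"
      proof (cases "R = c")
        case True
        then have "exp_degree a + exp_degree b < exp_degree L" using d LR by (auto simp: not_le[symmetric])
        then show ?thesis using fgl_nu_degree[of G, OF G0] by blast
      next
        case False then show ?thesis unfolding P_inject by auto
      qed
      ultimately show "mfps_coeff (mfps_eval_monom G M) d *
          mfps_coeff (mfps_eval_monom (case_sum (fgl_apply G (X 0) (X 1)) (X 2)) d) E = 0" by auto
    qed
  qed (auto simp: degE)
  also have "\<dots> = (\<Sum>L | exp_degree L \<le> exp_degree a + exp_degree b. fgl_nu G L c M * fgl_nu G a b L)"
  proof (subst sum.reindex)
    show "inj_on (\<lambda>L. exp_pair L c) {L. exp_degree L \<le> exp_degree a + exp_degree b}" by (simp add: inj_on_def)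
    have "mfps_coeff (mfps_eval_monom (case_sum (fgl_apply G (X 0) (X 1)) (X 2)) (exp_pair L c)) E =
          fgl_nu G a b L * mfps_coeff (mfps_monom (P 2 c) :: (nat \<times> 'm, 'a) mfps) (P 2 c)" for L
        unfolding mfps_eval_monom_pair XM E_def coeffG[of 0 1, OF zero_neq_one, symmetric]
        by (rule mfps_coeff_mult_disjoint_add[OF suppG suppX _ keysPP keysP]) auto
    then show "sum ((\<lambda>d. mfps_coeff (mfps_eval_monom G M) d *
          mfps_coeff (mfps_eval_monom (case_sum (fgl_apply G (X 0) (X 1)) (X 2)) d) E) \<circ> (\<lambda>L. exp_pair L c))
          {L. exp_degree L \<le> exp_degree a + exp_degree b} =
        (\<Sum>L | exp_degree L \<le> exp_degree a + exp_degree b. fgl_nu G L c M * fgl_nu G a b L)"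
      by (simp add: fgl_nu_def)
  qed
  finally have left: "mfps_coeff (mfps_eval_monom (fgl_apply G (fgl_apply G (X 0) (X 1)) (X 2)) M) E =
    (\<Sum>L | exp_degree L \<le> exp_degree a + exp_degree b. fgl_nu G L c M * fgl_nu G a b L)" .
  have E': "E = P 0 a + (P 1 b + P 2 c)" by (simp add: E_def add.assoc)
  have coeffR: "mfps_coeff (mfps_eval_monom (case_sum (X 0) (fgl_apply G (X 1) (X 2))) (exp_pair L R)) E =
          mfps_coeff (mfps_monom (P 0 L) :: (nat \<times> 'm, 'a) mfps) (P 0 a) * fgl_nu G b c R" for L R
  proof -
    have "(1 :: nat) \<noteq> 2" by simp
    then show ?thesis
      unfolding mfps_eval_monom_pair XM E' coeffG[of 1 2, OF \<open>1 \<noteq> 2\<close>, symmetric]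
      by (intro mfps_coeff_mult_disjoint_add[OF suppX suppG _ keysP keysPP]) auto
  qed
  have "mfps_coeff (mfps_eval_monom (fgl_apply G (X 0) (fgl_apply G (X 1) (X 2))) M) E =
    (\<Sum>d | exp_degree d \<le> exp_degree E. mfps_coeff (mfps_eval_monom G M) d *
      mfps_coeff (mfps_eval_monom (case_sum (X 0) (fgl_apply G (X 1) (X 2))) d) E)"
    by (rule mfps_coeff_fgl_apply_mono) (rule GX0 X0)+
  also have "\<dots> = (\<Sum>d\<in>(\<lambda>R. exp_pair a R) ` {R. exp_degree R \<le> exp_degree b + exp_degree c}. mfps_coeff (mfps_eval_monom G M) d *
      mfps_coeff (mfps_eval_monom (case_sum (X 0) (fgl_apply G (X 1) (X 2))) d) E)"
  proof (rule sum.mono_neutral_right)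
    show "\<forall>d\<in>{d. exp_degree d \<le> exp_degree E} - (\<lambda>R. exp_pair a R) ` {R. exp_degree R \<le> exp_degree b + exp_degree c}.
      mfps_coeff (mfps_eval_monom G M) d * mfps_coeff (mfps_eval_monom (case_sum (X 0) (fgl_apply G (X 1) (X 2))) d) E = 0"
    proof
      fix d assume d: "d \<in> {d. exp_degree d \<le> exp_degree E} - (\<lambda>R. exp_pair a R) ` {R. exp_degree R \<le> exp_degree b + exp_degree c}"
      obtain L R where LR: "d = exp_pair L R" by (rule exp_pairE)
      have "fgl_nu G b c R = 0 \<or> P 0 a \<noteq> P 0 L"
      proof (cases "L = a")
        case True
        then have "exp_degree b + exp_degree c < exp_degree R" using d LR by (auto simp: not_le[symmetric])
        then show ?thesis using fgl_nu_degree[of G, OF G0] by blast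
      next
        case False then show ?thesis unfolding P_inject by auto
      qed
      then show "mfps_coeff (mfps_eval_monom G M) d *
          mfps_coeff (mfps_eval_monom (case_sum (X 0) (fgl_apply G (X 1) (X 2))) d) E = 0"
        unfolding LR coeffR by auto
    qed
  qed (auto simp: degE)
  also have "\<dots> = (\<Sum>R | exp_degree R \<le> exp_degree b + exp_degree c. fgl_nu G a R M * fgl_nu G b c R)"
    by (subst sum.reindex) (simp_all add: inj_on_def coeffR fgl_nu_def[of G a _ M] del: One_nat_def)
  finally have right: "mfps_coeff (mfps_eval_monom (fgl_apply G (X 0) (fgl_apply G (X 1) (X 2))) M) E =
    (\<Sum>R | exp_degree R \<le> exp_degree b + exp_degree c. fgl_nu G a R M * fgl_nu G b c R)" .
  have "fgl_apply G (fgl_apply G (X 0) (X 1)) (X 2) = fgl_apply G (X 0) (fgl_apply G (X 1) (X 2))"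
    using G unfolding formal_group_law_def Let_def X_def by simp
  then show ?thesis using left right by (simp add: mult.commute)
qed

text \<open>The basis of exponents is dual to the divided powers \<open>t\<^sup>L / L!\<close>, whence the factorials. The
  division is possible in the base ring by \<open>exp_fact_dvd_fgl_nu\<close>.\<close>

definition fgl_mu :: "('m::finite \<Rightarrow> ('m + 'm, 'a::comm_ring_1) mfps) \<Rightarrow> ('m \<Rightarrow>\<^sub>0 nat) \<Rightarrow> ('m \<Rightarrow>\<^sub>0 nat) \<Rightarrow> ('m \<Rightarrow>\<^sub>0 nat) \<Rightarrow> 'a" where
  "fgl_mu G a b L = (SOME r. of_nat (exp_fact L) * r = of_nat (exp_fact a * exp_fact b) * fgl_nu G a b L)"

lemma fgl_mu:
  assumes "formal_group_law G"
  shows "of_nat (exp_fact L) * fgl_mu G a b L = of_nat (exp_fact a * exp_fact b) * fgl_nu G a b L"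
proof -
  have "\<exists>r. of_nat (exp_fact L) * r = of_nat (exp_fact a * exp_fact b) * fgl_nu G a b L"
    using exp_fact_dvd_fgl_nu[of G L a b, OF fgl_coeff_le_1(1)[OF assms]] by (metis dvdE)
  then show ?thesis unfolding fgl_mu_def by (rule someI_ex)
qed

lemma fgl_mu_eqI:
  fixes G :: "'m::finite \<Rightarrow> ('m + 'm, 'r::{idom, ring_char_0}) mfps"
  assumes "formal_group_law G" "of_nat (exp_fact L) * r = of_nat (exp_fact a * exp_fact b) * fgl_nu G a b L"
  shows "fgl_mu G a b L = r"
proof -
  have "of_nat (exp_fact L) * fgl_mu G a b L = of_nat (exp_fact L) * r"
    using fgl_mu[OF assms(1)] assms(2) by simp
  then show ?thesis by simp
qed

text \<open>Each law is the corresponding property of \<open>fgl_nu\<close> multiplied by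
  factorials, which can be cancelled in characteristic zero.\<close>

lemma structure_constants_fgl_mu:
  fixes G :: "'m::finite \<Rightarrow> ('m + 'm, 'r::{idom, ring_char_0}) mfps"
  assumes G: "formal_group_law G"
  shows "structure_constants (fgl_mu G)"
proof
  note G0 = fgl_coeff_le_1(1)[OF G]
  fix a b L :: "'m \<Rightarrow>\<^sub>0 nat"
  show "fgl_mu G a b L = 0" if "exp_degree a + exp_degree b < exp_degree L"
    by (rule fgl_mu_eqI[OF G]) (simp add: fgl_nu_degree[of G, OF G0 that])
  show "fgl_mu G a b 0 = (if a = 0 \<and> b = 0 then 1 else 0)"
    by (rule fgl_mu_eqI[OF G]) (auto simp: fgl_nu_def mfps_coeff_one)
  show "fgl_mu G a b L = (if L = a + b then 1 else 0)" if deg: "exp_degree L = exp_degree a + exp_degree b"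
  proof (rule fgl_mu_eqI[OF G])
    \<comment> \<open>\<open>G\<close> has the linear part of the additive law, so in the top degree
      its constants are those of the additive group, given by binomial coefficients.\<close>
    have "mfps_same_initial (exp_degree L) (mfps_eval_monom G L) (mfps_eval_monom (\<lambda>l. mfps_X (Inl l) + mfps_X (Inr l)) L)"
      by (intro mfps_same_initial_eval_monom fgl_coeff_le_1(2)[OF G])
    then have nu: "fgl_nu G a b L = fgl_nu (\<lambda>l. mfps_X (Inl l) + mfps_X (Inr l)) a b L"
      using deg unfolding mfps_same_initial_def mfps_order_ge_def fgl_nu_def by simp
    show "of_nat (exp_fact L) * (if L = a + b then 1 else 0) = of_nat (exp_fact a * exp_fact b) * fgl_nu G a b L"
    proof (cases "L = a + b")
      case True
      have "exp_fact a * exp_fact b * (\<Prod>l\<in>UNIV. lookup L l choose lookup a l) = exp_fact L"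
        unfolding exp_fact_UNIV prod.distrib[symmetric]
      proof (rule prod.cong[OF refl])
        fix l
        show "fact (lookup a l) * fact (lookup b l) *
            (lookup L l choose lookup a l) = fact (lookup L l)"
          using binomial_fact_lemma[of "lookup a l" "lookup L l"]
          by (simp add: True lookup_add)
      qed
      then have "of_nat (exp_fact L) = (of_nat (exp_fact a * exp_fact b) *
          (\<Prod>l\<in>UNIV. of_nat (lookup L l choose lookup a l)) :: 'r)"
        by (metis of_nat_mult of_nat_prod)
      then show ?thesis unfolding nu fgl_nu_additive by (simp add: True lookup_add)
    next
      case False
      then obtain l where "lookup L l \<noteq> lookup a l + lookup b l"
        by (metis lookup_add poly_mapping_eqI)
      then have "fgl_nu G a b L = 0" unfolding nu fgl_nu_additive by (intro prod_zero bexI[of _ l]) auto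
      then show ?thesis using False by simp
    qed
  qed
next
  fix a b c M :: "'m \<Rightarrow>\<^sub>0 nat"
  note mu = fgl_mu[OF G]
  let ?f = "of_nat (exp_fact a) * of_nat (exp_fact b) * of_nat (exp_fact c) :: 'r"
  \<comment> \<open>The factorial of the intermediate exponent \<open>L\<close> cancels between the
    two constants, which leaves a factor independent of \<open>L\<close>.\<close>
  have "of_nat (exp_fact M) * (fgl_mu G a b L * fgl_mu G L c M) = ?f * (fgl_nu G a b L * fgl_nu G L c M)" for L
  proof -
    have "of_nat (exp_fact M) * (fgl_mu G a b L * fgl_mu G L c M) =
      (of_nat (exp_fact L) * fgl_mu G a b L) * of_nat (exp_fact c) * fgl_nu G L c M"
      using mu[of M L c] by (simp add: mult_ac)
    then show ?thesis unfolding mu by (simp add: mult_ac)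
  qed
  moreover have "of_nat (exp_fact M) * (fgl_mu G b c L * fgl_mu G a L M) = ?f * (fgl_nu G b c L * fgl_nu G a L M)" for L
  proof -
    have "of_nat (exp_fact M) * (fgl_mu G b c L * fgl_mu G a L M) =
      (of_nat (exp_fact L) * fgl_mu G b c L) * of_nat (exp_fact a) * fgl_nu G a L M"
      using mu[of M a L] by (simp add: mult_ac)
    then show ?thesis unfolding mu by (simp add: mult_ac)
  qed
  ultimately have "of_nat (exp_fact M) * (\<Sum>L | exp_degree L \<le> exp_degree a + exp_degree b. fgl_mu G a b L * fgl_mu G L c M) =
    of_nat (exp_fact M) * (\<Sum>L | exp_degree L \<le> exp_degree b + exp_degree c. fgl_mu G b c L * fgl_mu G a L M)"
    unfolding sum_distrib_left using fgl_nu_assoc[OF G, of a b c M] by (simp flip: sum_distrib_left)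
  then show "(\<Sum>L | exp_degree L \<le> exp_degree a + exp_degree b. fgl_mu G a b L * fgl_mu G L c M) =
    (\<Sum>L | exp_degree L \<le> exp_degree b + exp_degree c. fgl_mu G b c L * fgl_mu G a L M)" by simp
qed

lemma fgl_mu_unit:
  fixes G :: "'m::finite \<Rightarrow> ('m + 'm, 'r::{idom, ring_char_0}) mfps"
  assumes "formal_group_law G"
  shows "fgl_mu G (unit_exp l) (unit_exp k) (unit_exp j) = fgl_gamma G j l k"
proof (rule fgl_mu_eqI[OF assms])
  have "mfps_eval_monom G (unit_exp j) = (\<Prod>i\<in>UNIV. if i = j then G i else 1)"
    unfolding mfps_eval_monom_def by (rule prod.cong) (auto simp: lookup_single when_def)
  also have "\<dots> = G j" by (subst prod.delta) auto
  finally show "of_nat (exp_fact (unit_exp j)) * fgl_gamma G j l k =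
      of_nat (exp_fact (unit_exp l) * exp_fact (unit_exp k)) * fgl_nu G (unit_exp l) (unit_exp k) (unit_exp j)"
    by (simp add: fgl_nu_def fgl_gamma_def exp_pair_def exp_fact_def)
qed

section \<open>Group cochains as functions on lists of exponents\<close>

text \<open>Zero entries at the end leave no trace, so \<open>encode\<close> is injective only on
  lists of a fixed length, namely the degree of the cochain.\<close>

definition encode :: "('m::finite \<Rightarrow>\<^sub>0 nat) list \<Rightarrow> (nat \<times> 'm \<Rightarrow>\<^sub>0 nat)" where
  "encode w = (\<Sum>k<length w. exp_push (Pair k) (w ! k))"

lemma lookup_exp_push_Pair [simp]:
  "lookup (exp_push (Pair i) a) (k, l) = (if i = k then lookup a l else 0)"
proof (cases "i = k")
  case True
  then show ?thesis using lookup_exp_push_image[of "Pair k" a l] by simp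
next
  case False
  then have "(k, l) \<notin> keys (exp_push (Pair i) a)" by (auto simp: keys_exp_push)
  then show ?thesis using False by (simp add: in_keys_iff)
qed

lemma lookup_encode [simp]:
  "lookup (encode w) (k, l) = (if k < length w then lookup (w ! k) l else 0)"
  by (simp add: encode_def lookup_sum)

lemma keys_encode: "keys (encode w) \<subseteq> {..<length w} \<times> UNIV"
  by (auto simp: in_keys_iff split: if_splits)

lemma encode_inject:
  assumes "length v = length w"
  shows "encode v = encode w \<longleftrightarrow> v = w"
proof
  assume eq: "encode v = encode w"
  show "v = w"
  proof (rule nth_equalityI[OF assms])
    fix k assume "k < length v"
    show "v ! k = w ! k"
    proof (rule poly_mapping_eqI)
      fix l show "lookup (v ! k) l = lookup (w ! k) l"
        using arg_cong[OF eq, of "\<lambda>e. lookup e (k, l)"] \<open>k < length v\<close> assms by simp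
    qed
  qed
qed simp

lemma encodeE:
  assumes "keys e \<subseteq> {..<n} \<times> UNIV"
  obtains w where "length w = n" "encode w = (e :: nat \<times> 'm::finite \<Rightarrow>\<^sub>0 nat)"
proof
  define w where "w = map (\<lambda>k. Abs_poly_mapping (\<lambda>l. lookup e (k, l))) [0..<n]"
  show len: "length w = n" by (simp add: w_def)
  show "encode w = e"
  proof (rule poly_mapping_eqI)
    fix v :: "nat \<times> 'm"
    obtain k l where v: "v = (k, l)" by (cases v)
    show "lookup (encode w) v = lookup e v"
    proof (cases "k < n")
      case False
      then have "(k, l) \<notin> keys e" using assms by auto
      then show ?thesis using False by (simp add: v w_def in_keys_iff)
    qed (simp add: v w_def)
  qed
qed

lemma encode_snoc: "encode (w @ [a]) = encode w + exp_push (Pair (length w)) a"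
  unfolding encode_def by (simp add: nth_append)

lemma exp_fact_encode: "exp_fact (encode w) = prod_list (map exp_fact w)"
proof (induction w rule: rev_induct)
  case (snoc a w)
  have "keys (encode w) \<inter> keys (exp_push (Pair (length w)) a) = {}"
    using keys_encode[of w] by (auto simp: keys_exp_push)
  then show ?case using snoc by (simp add: encode_snoc exp_fact_add_disjoint)
qed (simp add: encode_def)

text \<open>The factorial turns the integrality condition on modified cochains into membership in
  the image of \<open>R\<close>.\<close>

definition list_coeff :: "(nat \<times> 'm::finite, 'a::comm_ring_1) mfps \<Rightarrow> ('m \<Rightarrow>\<^sub>0 nat) list \<Rightarrow> 'a" where
  "list_coeff f w = of_nat (exp_fact (encode w)) * mfps_coeff f (encode w)"

lemma list_coeff_simps [simp]:
  "list_coeff (f + g) w = list_coeff f w + list_coeff g w"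
  "list_coeff (f - g) w = list_coeff f w - list_coeff g w"
  "list_coeff 0 w = 0"
  "list_coeff ((-1) ^ n * f) w = (-1) ^ n * list_coeff f w"
  "list_coeff (mfps_const c * f) w = c * list_coeff f w"
  by (simp_all add: list_coeff_def distrib_left right_diff_distrib mult.left_commute)

lemma list_coeff_sum: "list_coeff (\<Sum>i\<in>I. f i) w = (\<Sum>i\<in>I. list_coeff (f i) w)"
  by (simp add: list_coeff_def mfps_coeff_sum sum_distrib_left)

abbreviation involves_points :: "nat \<Rightarrow> (nat \<times> 'm::finite, 'a::comm_ring_1) mfps \<Rightarrow> bool" where
  "involves_points n \<equiv> mfps_supported ({..<n} \<times> UNIV)"

lemma list_coeff_drop_first:
  fixes f :: "(nat \<times> 'm::finite, 'a::comm_ring_1) mfps"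
  shows "list_coeff (mfps_subst (\<lambda>(k, l). mfps_X (Suc k, l)) f) (a # w) = (if a = 0 then list_coeff f w else 0)"
proof -
  let ?\<rho> = "\<lambda>(k, l). (Suc k, l) :: nat \<times> 'm"
  have inj: "inj ?\<rho>" by (auto simp: inj_def)
  have eq: "(\<lambda>(k, l). mfps_X (Suc k, l)) = (\<lambda>p. mfps_X (?\<rho> p))" by (auto simp: fun_eq_iff)
  show ?thesis
  proof (cases "a = 0")
    case True
    have "encode (a # w) = exp_push ?\<rho> (encode w)"
    proof (rule poly_mapping_eqI)
      fix v :: "nat \<times> 'm"
      obtain k l where v: "v = (k, l)" by (cases v)
      show "lookup (encode (a # w)) v = lookup (exp_push ?\<rho> (encode w)) v"
      proof (cases k)
        case 0
        have "(0, l) \<notin> range ?\<rho>" by auto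
        then show ?thesis using lookup_exp_push[OF inj, of "encode w" "(0, l)"] by (simp add: v 0 True)
      next
        case (Suc i)
        then show ?thesis using lookup_exp_push_image[OF inj, of "encode w" "(i, l)"] by (simp add: v)
      qed
    qed
    then show ?thesis using True
      unfolding list_coeff_def eq by (simp add: mfps_coeff_subst_rename(1)[OF inj] exp_fact_push[OF inj])
  next
    case False
    then obtain l where l: "lookup a l \<noteq> 0" by (metis lookup_zero poly_mapping_eqI)
    have "encode (a # w) \<notin> range (exp_push ?\<rho>)"
    proof
      assume "encode (a # w) \<in> range (exp_push ?\<rho>)"
      then obtain d where d: "encode (a # w) = exp_push ?\<rho> d" by blast
      have "(0, l) \<notin> range ?\<rho>" by auto
      then show False
        using lookup_exp_push[OF inj, of d "(0, l)"] l unfolding d[symmetric] by simp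
    qed
    then show ?thesis using False unfolding list_coeff_def eq by (simp add: mfps_coeff_subst_rename(2)[OF inj])
  qed
qed

lemma list_coeff_drop_last:
  assumes "involves_points (length w) f"
  shows "list_coeff f (w @ [a]) = (if a = 0 then list_coeff f w else 0)"
proof (cases "a = 0")
  case True
  then show ?thesis by (simp add: list_coeff_def encode_snoc)
next
  case False
  then obtain l where "lookup a l \<noteq> 0" by (metis lookup_zero poly_mapping_eqI)
  then have "(length w, l) \<in> keys (encode (w @ [a]))" by (simp add: in_keys_iff nth_append)
  then have "\<not> keys (encode (w @ [a])) \<subseteq> {..<length w} \<times> UNIV" by auto
  then show ?thesis using False assms unfolding list_coeff_def by (simp add: mfps_coeff_eq_0_of_supported)
qed

abbreviation merge_points :: "('m::finite \<Rightarrow> ('m + 'm, 'a::comm_ring_1) mfps) \<Rightarrow> nat \<Rightarrow> nat \<times> 'm \<Rightarrow> (nat \<times> 'm, 'a) mfps" where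
  "merge_points G i \<equiv> (\<lambda>(k, l).
          if k < i then mfps_X (k, l)
          else if k = i then fgl_apply G (\<lambda>j. mfps_X (i, j)) (\<lambda>j. mfps_X (Suc i, j)) l
          else mfps_X (Suc k, l))"

text \<open>Separates the merged point \<open>i\<close> from the others, which are merely
  renumbered. The entry \<open>0\<close> in \<open>x @ 0 # y\<close> holds the place of the merged
  point, so that the entries of \<open>y\<close> keep their positions.\<close>

lemma prod_merge_points:
  fixes G :: "'m::finite \<Rightarrow> ('m + 'm, 'a::comm_ring_1) mfps"
  assumes "length x = i"
  shows "(\<Prod>p\<in>keys (encode (x @ L # y)). merge_points G i p ^ lookup (encode (x @ L # y)) p) =
    mfps_monom (exp_push (\<lambda>(k, l). (if k < i then k else Suc k, l)) (encode (x @ 0 # y))) *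
    mfps_eval_monom (fgl_apply G (\<lambda>j. mfps_X (i, j)) (\<lambda>j. mfps_X (Suc i, j))) L"
proof -
  let ?n = "length (x @ L # y)" and ?\<rho> = "\<lambda>(k, l). (if k < i then k else Suc k, l) :: nat \<times> 'm"
  let ?S = "({..<?n} - {i}) \<times> (UNIV :: 'm set)" and ?T = "{i} \<times> (UNIV :: 'm set)"
  let ?G = "fgl_apply G (\<lambda>j. mfps_X (i, j)) (\<lambda>j. mfps_X (Suc i, j))"
  have i: "i < ?n" using assms by simp
  have "(\<Prod>p\<in>keys (encode (x @ L # y)). merge_points G i p ^ lookup (encode (x @ L # y)) p) =
    (\<Prod>p\<in>?S \<union> ?T. merge_points G i p ^ lookup (encode (x @ L # y)) p)"
    using keys_encode[of "x @ L # y"] i by (intro prod.mono_neutral_left) (auto simp: in_keys_iff)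
  also have "\<dots> = (\<Prod>p\<in>?S. merge_points G i p ^ lookup (encode (x @ L # y)) p) *
     (\<Prod>p\<in>?T. merge_points G i p ^ lookup (encode (x @ L # y)) p)"
    by (intro prod.union_disjoint) auto
  also have "(\<Prod>p\<in>?T. merge_points G i p ^ lookup (encode (x @ L # y)) p) = mfps_eval_monom ?G L"
  proof -
    have T: "?T = Pair i ` UNIV" by auto
    show ?thesis unfolding T mfps_eval_monom_def using assms
      by (subst prod.reindex) (auto simp: inj_on_def nth_append)
  qed
  also have "(\<Prod>p\<in>?S. merge_points G i p ^ lookup (encode (x @ L # y)) p) =
     (\<Prod>p\<in>?S. mfps_X (?\<rho> p) ^ lookup (encode (x @ 0 # y)) p)"
    using assms by (intro prod.cong) (auto simp: nth_append nth_Cons' split: if_splits)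
  also have "\<dots> = (\<Prod>p\<in>keys (encode (x @ 0 # y)). mfps_X (?\<rho> p) ^ lookup (encode (x @ 0 # y)) p)"
  proof (intro prod.mono_neutral_right)
    show "keys (encode (x @ 0 # y)) \<subseteq> ?S"
      using assms by (auto simp: in_keys_iff nth_append split: if_splits)
  qed (auto simp: in_keys_iff)
  also have "\<dots> = mfps_monom (exp_push ?\<rho> (encode (x @ 0 # y)))" by (rule prod_mfps_X_power)
  finally show ?thesis .
qed

lemma encode_split:
  assumes "length x = i"
  shows "encode (x @ a # b # y) = exp_push (\<lambda>(k, l). (if k < i then k else Suc k, l)) (encode (x @ 0 # y)) +
    (exp_push (Pair i) a + exp_push (Pair (Suc i)) b)"
proof (rule poly_mapping_eqI)
  let ?\<rho> = "\<lambda>(k, l). (if k < i then k else Suc k, l) :: nat \<times> 'a"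
  have inj: "inj ?\<rho>" by (auto simp: inj_def split: if_splits)
  fix v :: "nat \<times> 'a"
  obtain k l where v: "v = (k, l)" by (cases v)
  consider "k < i" | "k = i" | "k = Suc i" | j where "k = Suc j" "i < j"
  proof (cases k)
    case (Suc j)
    then show ?thesis using that by (cases "k < i \<or> k = i \<or> k = Suc i") auto
  qed (use that in auto)
  then show "lookup (encode (x @ a # b # y)) v =
    lookup (exp_push ?\<rho> (encode (x @ 0 # y)) + (exp_push (Pair i) a + exp_push (Pair (Suc i)) b)) v"
  proof cases
    case 1
    then show ?thesis using lookup_exp_push_image[OF inj, of "encode (x @ 0 # y)" "(k, l)"] assms
      by (simp add: v lookup_add nth_append)
  next
    case 2
    have "(i, l) \<notin> range ?\<rho>" by (auto split: if_splits)
    then show ?thesis using lookup_exp_push[OF inj, of "encode (x @ 0 # y)" "(i, l)"] assms 2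
      by (simp add: v lookup_add nth_append)
  next
    case 3
    then show ?thesis using lookup_exp_push_image[OF inj, of "encode (x @ 0 # y)" "(i, l)"] assms
      by (simp add: v lookup_add nth_append)
  next
    case 4
    then obtain j' where j': "j - i = Suc j'" by (metis Suc_diff_Suc)
    then show ?thesis using lookup_exp_push_image[OF inj, of "encode (x @ 0 # y)" "(j, l)"] assms 4
      by (simp add: v lookup_add nth_append Suc_diff_le)
  qed
qed

text \<open>The type of variables is infinite here, so \<open>mfps_coeff_subst\<close> does not
  apply; the sum is made finite by the support of \<open>f\<close>. Exponents that differ from
  \<open>x\<close> and \<open>y\<close> away from the merged point do not contribute.\<close>

lemma list_coeff_merge_points:
  fixes f :: "(nat \<times> 'm::finite, 'a::comm_ring_1) mfps"
  assumes f: "involves_points (Suc (length (x @ y))) f" and G: "\<And>j. mfps_coeff (G j) 0 = 0"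
  shows "mfps_coeff (mfps_subst (merge_points G (length x)) f) (encode (x @ a # b # y)) =
    (\<Sum>L | exp_degree L \<le> exp_degree a + exp_degree b. fgl_nu G a b L * mfps_coeff f (encode (x @ L # y)))"
proof -
  let ?i = "length x"
  let ?\<rho> = "\<lambda>(k, l). (if k < ?i then k else Suc k, l) :: nat \<times> 'm"
  let ?A = "{L :: 'm \<Rightarrow>\<^sub>0 nat. exp_degree L \<le> exp_degree a + exp_degree b}"
  let ?P = "\<lambda>d. \<Prod>p\<in>keys d. merge_points G ?i p ^ lookup d p"
  let ?e = "encode (x @ a # b # y)"
  have inj: "inj ?\<rho>" by (auto simp: inj_def split: if_splits)
  have coeff: "mfps_coeff (?P (encode (x' @ L # y'))) ?e =
      (if x' = x \<and> y' = y then fgl_nu G a b L else 0)"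
    if len: "length x' = length x" "length y' = length y" for x' y' L
  proof -
    have "mfps_coeff (?P (encode (x' @ L # y'))) ?e =
       mfps_coeff (mfps_monom (exp_push ?\<rho> (encode (x' @ 0 # y')))) (exp_push ?\<rho> (encode (x @ 0 # y))) *
       mfps_coeff (mfps_eval_monom (fgl_apply G (\<lambda>j. mfps_X (?i, j)) (\<lambda>j. mfps_X (Suc ?i, j))) L)
         (exp_push (Pair ?i) a + exp_push (Pair (Suc ?i)) b)"
      unfolding prod_merge_points[OF len(1)] encode_split[OF refl, of x]
    proof (rule mfps_coeff_mult_disjoint_add[where S = "- ({?i, Suc ?i} \<times> UNIV)" and T = "{?i, Suc ?i} \<times> UNIV"])
      have sub: "keys (exp_push ?\<rho> (encode (z @ 0 # u))) \<subseteq> - ({?i, Suc ?i} \<times> UNIV)"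
        if "length z = length x" for z u :: "('m \<Rightarrow>\<^sub>0 nat) list"
      proof -
        have "lookup (encode (z @ 0 # u)) (?i, l) = 0" for l using that by (auto simp: nth_append)
        then have "(?i, l) \<notin> keys (encode (z @ 0 # u))" for l by (simp add: in_keys_iff)
        then show ?thesis unfolding keys_exp_push[OF inj] by (auto split: if_splits)
      qed
      show "mfps_supported (- ({?i, Suc ?i} \<times> UNIV)) (mfps_monom (exp_push ?\<rho> (encode (x' @ 0 # y'))) :: (nat \<times> 'm, 'a) mfps)"
        using sub[OF len(1)] by (rule mfps_supported_monom)
      show "keys (exp_push ?\<rho> (encode (x @ 0 # y))) \<subseteq> - ({?i, Suc ?i} \<times> UNIV)"
        using sub[OF refl] .
      show "mfps_supported ({?i, Suc ?i} \<times> UNIV)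
        (mfps_eval_monom (fgl_apply G (\<lambda>j. mfps_X (?i, j)) (\<lambda>j. mfps_X (Suc ?i, j))) L)"
        by (rule mfps_supported_fgl_apply_X) simp
      show "keys (exp_push (Pair ?i) a + exp_push (Pair (Suc ?i)) b) \<subseteq> {?i, Suc ?i} \<times> UNIV"
        using keys_exp_push_Pair[of ?i a] keys_exp_push_Pair[of "Suc ?i" b] by (auto simp: keys_exp_add)
    qed auto
    also have "mfps_coeff (mfps_eval_monom (fgl_apply G (\<lambda>j. mfps_X (?i, j)) (\<lambda>j. mfps_X (Suc ?i, j))) L)
         (exp_push (Pair ?i) a + exp_push (Pair (Suc ?i)) b) = fgl_nu G a b L"
      by (rule mfps_coeff_fgl_apply_X) simp
    finally show ?thesis using len by (auto simp: exp_push_inject[OF inj] encode_inject)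
  qed
  have "mfps_coeff (mfps_subst (merge_points G ?i) f) ?e = Sum_any (\<lambda>d. mfps_coeff f d * mfps_coeff (?P d) ?e)"
    by (simp add: mfps_subst_def)
  also have "\<dots> = (\<Sum>d\<in>(\<lambda>L. encode (x @ L # y)) ` ?A. mfps_coeff f d * mfps_coeff (?P d) ?e)"
  proof (rule Sum_any.expand_superset)
    show "{d. mfps_coeff f d * mfps_coeff (?P d) ?e \<noteq> 0} \<subseteq> (\<lambda>L. encode (x @ L # y)) ` ?A"
    proof
      fix d assume "d \<in> {d. mfps_coeff f d * mfps_coeff (?P d) ?e \<noteq> 0}"
      then have d: "mfps_coeff f d \<noteq> 0" "mfps_coeff (?P d) ?e \<noteq> 0" by auto
      then have "keys d \<subseteq> {..<Suc (length (x @ y))} \<times> UNIV"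
        using f by (simp add: mfps_supported_def)
      then obtain v where v: "length v = Suc (length (x @ y))" "encode v = d" by (rule encodeE)
      define x' y' L where "x' = take ?i v" and "y' = drop (Suc ?i) v" and "L = v ! ?i"
      have len: "length x' = length x" "length y' = length y" by (simp_all add: v x'_def y'_def)
      have "v = x' @ L # y'" using v by (simp add: x'_def y'_def L_def id_take_nth_drop[symmetric])
      then have "d = encode (x' @ L # y')" using v by simp
      moreover from this have "x' = x \<and> y' = y" "fgl_nu G a b L \<noteq> 0"
        using coeff[OF len, of L] d(2) by (auto split: if_splits)
      moreover from this have "L \<in> ?A" using fgl_nu_degree[of G, OF G] by (auto simp: not_less[symmetric])
      ultimately show "d \<in> (\<lambda>L. encode (x @ L # y)) ` ?A" by blast
    qed
  qed simp
  also have "\<dots> = (\<Sum>L\<in>?A. fgl_nu G a b L * mfps_coeff f (encode (x @ L # y)))"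
    by (subst sum.reindex) (auto simp: inj_on_def encode_inject coeff mult.commute intro!: sum.cong)
  finally show ?thesis .
qed

text \<open>Brings the recursion into the shape of \<open>group_diff\<close>, whose summands are
  indexed by positions.\<close>

lemma (in structure_constants) inner_diff_explicit:
  "length w = Suc n \<Longrightarrow> inner_diff c w =
    (\<Sum>i<n. (-1) ^ Suc i * merge (w ! i) (w ! Suc i) (\<lambda>L. c (take i w @ L # drop (Suc (Suc i)) w))) +
    (-1) ^ Suc n * (if last w = 0 then c (butlast w) else 0)"
proof (induction c w arbitrary: n rule: inner_diff.induct)
  case (3 c a b w)
  then obtain m where n: "n = Suc m" by (cases n) auto
  have "inner_diff (\<lambda>v. c (a # v)) (b # w) =
    (\<Sum>i<m. (-1) ^ Suc i * merge ((b # w) ! i) ((b # w) ! Suc i) (\<lambda>L. c (a # take i (b # w) @ L # drop (Suc (Suc i)) (b # w)))) +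
    (-1) ^ Suc m * (if last (b # w) = 0 then c (a # butlast (b # w)) else 0)"
    using "3.prems" by (intro "3.IH") (simp add: n)
  then show ?case by (simp add: n sum.lessThan_Suc_shift sum_negf del: sum.lessThan_Suc)
qed auto

lemma to_fract_of_nat [simp]: "to_fract (of_nat n) = of_nat n"
  by (induction n) simp_all

lemma of_nat_fract_eq_0_iff [simp]: "(of_nat n :: 'r::{idom, ring_char_0} fract) = 0 \<longleftrightarrow> n = 0"
  by (metis of_nat_eq_0_iff to_fract_eq_0_iff to_fract_of_nat)

lemma to_fract_neg_one_power [simp]: "to_fract ((-1) ^ n) = (-1) ^ n"
  by (induction n) simp_all

lemma mfps_coeff_map [simp]: "mfps_coeff (mfps_map h f) e = h (mfps_coeff f e)"
  by (simp add: mfps_map_def)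

lemma mfps_eval_monom_map_to_fract:
  fixes G :: "'w::finite \<Rightarrow> ('v, 'a::idom) mfps"
  shows "mfps_eval_monom (\<lambda>j. mfps_map to_fract (G j)) L = mfps_map to_fract (mfps_eval_monom G L)"
proof -
  have one: "mfps_map to_fract (1 :: ('v, 'a) mfps) = 1"
    by (rule mfps_eqI) (simp add: mfps_coeff_one)
  have mult: "mfps_map to_fract (f * g) = mfps_map to_fract f * mfps_map to_fract g" for f g :: "('v, 'a) mfps"
    by (rule mfps_eqI) (simp add: mfps_coeff_mult case_prod_unfold)
  have pow: "mfps_map to_fract (f ^ n) = mfps_map to_fract f ^ n" for f :: "('v, 'a) mfps" and n
    by (induction n) (simp_all add: one mult)
  have "mfps_map to_fract (\<Prod>i\<in>I. f i) = (\<Prod>i\<in>I. mfps_map to_fract (f i))" for I and f :: "'w \<Rightarrow> ('v, 'a) mfps"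
    by (induction I rule: infinite_finite_induct) (simp_all add: one mult)
  then show ?thesis by (simp add: mfps_eval_monom_def pow)
qed

lemma fgl_nu_map_to_fract: "fgl_nu (\<lambda>j. mfps_map to_fract (G j)) a b L = to_fract (fgl_nu G a b L)"
  by (simp add: fgl_nu_def mfps_eval_monom_map_to_fract)

text \<open>The factorials of the untouched entries pass through, and those of \<open>a\<close> and
  \<open>b\<close> are traded for that of \<open>L\<close> by the equation defining
  \<open>fgl_mu\<close>; this is how the rescaled constants enter.\<close>

lemma list_coeff_merge:
  fixes G :: "'m::finite \<Rightarrow> ('m + 'm, 'r::{idom, ring_char_0}) mfps"
  assumes G: "formal_group_law G" and f: "involves_points (Suc (length (x @ y))) f"
  shows "list_coeff (mfps_subst (merge_points (\<lambda>j. mfps_map to_fract (G j)) (length x)) f) (x @ a # b # y) =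
    (\<Sum>L | exp_degree L \<le> exp_degree a + exp_degree b. to_fract (fgl_mu G a b L) * list_coeff f (x @ L # y))"
proof -
  have G0: "mfps_coeff (mfps_map to_fract (G j)) 0 = 0" for j
    by (simp add: fgl_coeff_le_1(1)[OF G])
  let ?R = "of_nat (prod_list (map exp_fact (x @ y))) :: 'r fract"
  have mu: "of_nat (exp_fact a) * of_nat (exp_fact b) * to_fract (fgl_nu G a b L) =
      of_nat (exp_fact L) * to_fract (fgl_mu G a b L)" for L
    using arg_cong[OF fgl_mu[OF G, of L a b], of to_fract] by simp
  have "list_coeff (mfps_subst (merge_points (\<lambda>j. mfps_map to_fract (G j)) (length x)) f) (x @ a # b # y) =
    (\<Sum>L | exp_degree L \<le> exp_degree a + exp_degree b.
      ?R * (of_nat (exp_fact a) * of_nat (exp_fact b) * to_fract (fgl_nu G a b L)) * mfps_coeff f (encode (x @ L # y)))"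
    unfolding list_coeff_def list_coeff_merge_points[of x y f, OF f G0] fgl_nu_map_to_fract sum_distrib_left
    by (intro sum.cong refl) (simp add: exp_fact_encode mult_ac)
  also have "\<dots> = (\<Sum>L | exp_degree L \<le> exp_degree a + exp_degree b. to_fract (fgl_mu G a b L) * list_coeff f (x @ L # y))"
    unfolding mu list_coeff_def by (intro sum.cong refl) (simp add: exp_fact_encode mult_ac)
  finally show ?thesis .
qed

lemma mfps_supported_subst:
  assumes f: "mfps_supported V f" and s: "\<And>p. p \<in> V \<Longrightarrow> mfps_supported S (s p)"
  shows "mfps_supported S (mfps_subst s f)"
  unfolding mfps_supported_def
proof (intro allI impI)
  fix e assume nz: "mfps_coeff (mfps_subst s f) e \<noteq> 0"
  have "\<exists>d. mfps_coeff f d * mfps_coeff (\<Prod>p\<in>keys d. s p ^ lookup d p) e \<noteq> 0"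
  proof (rule ccontr)
    assume "\<not> ?thesis"
    then have "mfps_coeff f d * mfps_coeff (\<Prod>p\<in>keys d. s p ^ lookup d p) e = 0" for d
      by blast
    then show False using nz unfolding mfps_subst_def mfps_coeff_Abs by simp
  qed
  then obtain d where d: "mfps_coeff f d \<noteq> 0" "mfps_coeff (\<Prod>p\<in>keys d. s p ^ lookup d p) e \<noteq> 0"
    by (metis mult_zero_left mult_zero_right)
  then have "keys d \<subseteq> V" using f by (simp add: mfps_supported_def)
  moreover have "mfps_supported S (s p ^ n)" if "p \<in> V" for p n
    using s[OF that] by (induction n) (auto intro: mfps_supported_mult)
  ultimately have "mfps_supported S (\<Prod>p\<in>keys d. s p ^ lookup d p)"
    by (intro mfps_supported_prod) auto
  then show "keys e \<subseteq> S" using d(2) by (simp add: mfps_supported_def)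
qed

lemma mfps_supported_add: "mfps_supported S f \<Longrightarrow> mfps_supported S g \<Longrightarrow> mfps_supported S (f + g)"
  unfolding mfps_supported_def by (metis add_0 mfps_coeff_simps(2))

lemma mfps_supported_zero [simp]: "mfps_supported S 0"
  by (simp add: mfps_supported_def)

lemma mfps_supported_sum: "(\<And>i. i \<in> I \<Longrightarrow> mfps_supported S (f i)) \<Longrightarrow> mfps_supported S (\<Sum>i\<in>I. f i)"
  by (induction I rule: infinite_finite_induct) (auto intro: mfps_supported_add)

lemma mfps_supported_sign: "mfps_supported S f \<Longrightarrow> mfps_supported S ((-1) ^ n * f)"
  unfolding mfps_supported_def mfps_coeff_neg_one_power_mult by (metis mult_zero_right)

lemma involves_points_group_diff:
  assumes f: "involves_points n f"
  shows "involves_points (Suc n) (group_diff G n f)"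
  unfolding group_diff_def
proof (intro mfps_supported_add mfps_supported_sum mfps_supported_sign)
  show "involves_points (Suc n) f" by (rule mfps_supported_mono[OF f]) auto
  have X: "involves_points (Suc n) (mfps_X (k, l))" if "k \<le> n" for k l
    using that unfolding mfps_X_eq_monom by (intro mfps_supported_monom) auto
  show "involves_points (Suc n) (mfps_subst (\<lambda>(k, l). mfps_X (Suc k, l)) f)"
    using f by (rule mfps_supported_subst) (auto intro!: X)
  fix i assume i: "i \<in> {..<n}"
  have GX: "involves_points (Suc n) (fgl_apply H (\<lambda>j. mfps_X (i, j)) (\<lambda>j. mfps_X (Suc i, j)) l)" for H l
    unfolding fgl_apply_X using i
    by (intro mfps_supported_subst_rename inj_case_sum_Pair) (auto split: sum.splits)
  show "involves_points (Suc n) (mfps_subst (merge_points (\<lambda>j. mfps_map to_fract (G j)) i) f)"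
    using f by (rule mfps_supported_subst) (auto intro!: X GX)
qed

lemma list_coeff_group_diff:
  fixes G :: "'m::finite \<Rightarrow> ('m + 'm, 'r::{idom, ring_char_0}) mfps"
  assumes G: "formal_group_law G" and f: "involves_points n f" and w: "length w = Suc n"
    and c: "\<And>v. length v = n \<Longrightarrow> to_fract (c v) = list_coeff f v"
  shows "list_coeff (group_diff G n f) w = to_fract (structure_constants.diff (fgl_mu G) c w)"
proof -
  interpret structure_constants "fgl_mu G" by (rule structure_constants_fgl_mu[OF G])
  obtain a u where au: "w = a # u" using w by (cases w) auto
  have first: "list_coeff (mfps_subst (\<lambda>(k, l). mfps_X (Suc k, l)) f) w = (if a = 0 then to_fract (c u) else 0)"
    using w c by (simp add: au list_coeff_drop_first)
  have last: "list_coeff f w = (if last w = 0 then to_fract (c (butlast w)) else 0)"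
  proof -
    have "w = butlast w @ [last w]" using w by (cases w rule: rev_cases) auto
    then show ?thesis using list_coeff_drop_last[of "butlast w" f "last w"] f w c[of "butlast w"] by simp
  qed
  have middle: "list_coeff (mfps_subst (merge_points (\<lambda>j. mfps_map to_fract (G j)) i) f) w =
    to_fract (merge (w ! i) (w ! Suc i) (\<lambda>L. c (take i w @ L # drop (Suc (Suc i)) w)))" if i: "i < n" for i
  proof -
    let ?x = "take i w" and ?y = "drop (Suc (Suc i)) w"
    have split: "w = ?x @ w ! i # w ! Suc i # ?y"
      using i w by (metis Cons_nth_drop_Suc Suc_lessD append_take_drop_id not_less_eq)
    have len: "length ?x = i" "Suc (length (?x @ ?y)) = n" using i w by auto
    have "list_coeff (mfps_subst (merge_points (\<lambda>j. mfps_map to_fract (G j)) i) f) (?x @ w ! i # w ! Suc i # ?y) =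
      (\<Sum>L | exp_degree L \<le> exp_degree (w ! i) + exp_degree (w ! Suc i). to_fract (fgl_mu G (w ! i) (w ! Suc i) L) * list_coeff f (?x @ L # ?y))"
      using list_coeff_merge[OF G, of ?x ?y f "w ! i" "w ! Suc i"] f unfolding len by simp
    also have "\<dots> = to_fract (merge (w ! i) (w ! Suc i) (\<lambda>L. c (?x @ L # ?y)))"
    proof -
      have "list_coeff f (?x @ L # ?y) = to_fract (c (?x @ L # ?y))" for L
        using len by (intro c[symmetric]) simp
      then show ?thesis by (simp add: merge_def)
    qed
    finally show ?thesis using split by simp
  qed
  have "list_coeff (group_diff G n f) w = (if a = 0 then to_fract (c u) else 0) +
     (\<Sum>i<n. (-1) ^ Suc i * to_fract (merge (w ! i) (w ! Suc i) (\<lambda>L. c (take i w @ L # drop (Suc (Suc i)) w)))) +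
     (-1) ^ Suc n * (if last w = 0 then to_fract (c (butlast w)) else 0)"
    unfolding group_diff_def list_coeff_simps list_coeff_sum first last using middle by simp
  also have "\<dots> = to_fract (diff c w)"
    unfolding au diff.simps inner_diff_explicit[OF w[unfolded au]] by simp
  finally show ?thesis .
qed

section \<open>Group cochains as functions with values in the base ring\<close>

lemma group_cochains_simps [simp]:
  "\<zero>\<^bsub>group_cochains n\<^esub> = 0" "f \<oplus>\<^bsub>group_cochains n\<^esub> g = f + g"
  "r \<odot>\<^bsub>group_cochains n\<^esub> f = mfps_const (to_fract r) * f"
  by (simp_all add: group_cochains_def)

text \<open>Coefficients at exponents beyond the first \<open>n\<close> points are zero, so
  integrality only has to be checked at encoded lists of length \<open>n\<close>.\<close>

lemma mem_group_cochains:
  "f \<in> carrier (group_cochains n) \<longleftrightarrow>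
    involves_points n f \<and> (\<forall>w. length w = n \<longrightarrow> list_coeff f w \<in> range to_fract)"
proof
  assume "f \<in> carrier (group_cochains n)"
  then show "involves_points n f \<and> (\<forall>w. length w = n \<longrightarrow> list_coeff f w \<in> range to_fract)"
    by (auto simp: group_cochains_def mfps_supported_def list_coeff_def)
next
  assume f: "involves_points n f \<and> (\<forall>w. length w = n \<longrightarrow> list_coeff f w \<in> range to_fract)"
  have "of_nat (exp_fact e) * mfps_coeff f e \<in> range to_fract" for e
  proof (cases "mfps_coeff f e = 0")
    case True then show ?thesis by (simp add: range_eqI[of _ _ 0])
  next
    case False
    then have "keys e \<subseteq> {..<n} \<times> UNIV" using f by (simp add: mfps_supported_def)
    then obtain w where "length w = n" "encode w = e" by (rule encodeE)
    then show ?thesis using f by (auto simp: list_coeff_def)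
  qed
  then show "f \<in> carrier (group_cochains n)"
    using f by (auto simp: group_cochains_def mfps_supported_def)
qed

text \<open>The value \<open>0\<close> at other lengths makes a cochain of any degree a function on
  all lists, as \<open>diff\<close> expects, and frees later equations from conditions on the
  length.\<close>

definition cochain_fun :: "nat \<Rightarrow> (nat \<times> 'm::finite, 'r::idom fract) mfps \<Rightarrow> ('m \<Rightarrow>\<^sub>0 nat) list \<Rightarrow> 'r" where
  "cochain_fun n f w = (if length w = n then SOME r. to_fract r = list_coeff f w else 0)"

lemma to_fract_cochain_fun:
  assumes "f \<in> carrier (group_cochains n)" "length w = n"
  shows "to_fract (cochain_fun n f w) = list_coeff f w"
proof -
  have "list_coeff f w \<in> range to_fract" using assms unfolding mem_group_cochains by blast
  then have "\<exists>r. to_fract r = list_coeff f w" by (simp add: image_iff eq_commute)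
  from someI_ex[OF this] show ?thesis using assms(2) by (simp add: cochain_fun_def)
qed

lemma cochain_fun_eqI:
  "f \<in> carrier (group_cochains n) \<Longrightarrow> length w = n \<Longrightarrow> list_coeff f w = to_fract r \<Longrightarrow> cochain_fun n f w = r"
  using to_fract_cochain_fun by (metis to_fract_eq_iff)

lemma cochain_fun_length: "length w \<noteq> n \<Longrightarrow> cochain_fun n f w = 0"
  by (simp add: cochain_fun_def)

lemma group_cochains_closed:
  fixes f g :: "(nat \<times> 'm::finite, 'r::idom fract) mfps"
  shows "(0 :: (nat \<times> 'm, 'r fract) mfps) \<in> carrier (group_cochains n)"
  "f \<in> carrier (group_cochains n) \<Longrightarrow> g \<in> carrier (group_cochains n) \<Longrightarrow> f + g \<in> carrier (group_cochains n)"
  "f \<in> carrier (group_cochains n) \<Longrightarrow> mfps_const (to_fract r) * f \<in> carrier (group_cochains n)"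
proof -
  show "(0 :: (nat \<times> 'm, 'r fract) mfps) \<in> carrier (group_cochains n)"
    by (auto simp: mem_group_cochains mfps_supported_def intro!: range_eqI[of _ _ 0])
  show "f + g \<in> carrier (group_cochains n)" if fg: "f \<in> carrier (group_cochains n)" "g \<in> carrier (group_cochains n)"
    unfolding mem_group_cochains
  proof (intro conjI allI impI)
    show "involves_points n (f + g)" using fg by (intro mfps_supported_add) (simp_all add: mem_group_cochains)
    fix w :: "('m \<Rightarrow>\<^sub>0 nat) list" assume "length w = n"
    then obtain r s where "list_coeff f w = to_fract r" "list_coeff g w = to_fract s"
      using fg unfolding mem_group_cochains by blast
    then have "list_coeff (f + g) w = to_fract (r + s)" by simp
    then show "list_coeff (f + g) w \<in> range to_fract" by (rule range_eqI)
  qed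
  show "mfps_const (to_fract r) * f \<in> carrier (group_cochains n)" if f: "f \<in> carrier (group_cochains n)"
    unfolding mem_group_cochains
  proof (intro conjI allI impI)
    show "involves_points n (mfps_const (to_fract r) * f)" using f by (auto simp: mem_group_cochains mfps_supported_def)
    fix w :: "('m \<Rightarrow>\<^sub>0 nat) list" assume "length w = n"
    then obtain s where "list_coeff f w = to_fract s" using f unfolding mem_group_cochains by blast
    then have "list_coeff (mfps_const (to_fract r) * f) w = to_fract (r * s)" by simp
    then show "list_coeff (mfps_const (to_fract r) * f) w \<in> range to_fract" by (rule range_eqI)
  qed
qed

lemma cochain_fun_add:
  assumes "f \<in> carrier (group_cochains n)" "g \<in> carrier (group_cochains n)"
  shows "cochain_fun n (f + g) w = cochain_fun n f w + cochain_fun n g w"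
proof (cases "length w = n")
  case True
  then show ?thesis using assms
    by (intro cochain_fun_eqI group_cochains_closed) (simp_all add: to_fract_cochain_fun)
qed (simp add: cochain_fun_length)

lemma cochain_fun_scale:
  assumes "f \<in> carrier (group_cochains n)"
  shows "cochain_fun n (mfps_const (to_fract r) * f) w = r * cochain_fun n f w"
proof (cases "length w = n")
  case True
  then show ?thesis using assms
    by (intro cochain_fun_eqI group_cochains_closed) (simp_all add: to_fract_cochain_fun)
qed (simp add: cochain_fun_length)

lemma cochain_fun_inject:
  fixes f g :: "(nat \<times> 'm::finite, 'r::{idom, ring_char_0} fract) mfps"
  assumes f: "f \<in> carrier (group_cochains n)" and g: "g \<in> carrier (group_cochains n)"
    and eq: "\<And>w. length w = n \<Longrightarrow> cochain_fun n f w = cochain_fun n g w"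
  shows "f = g"
proof (rule mfps_eqI)
  fix e
  show "mfps_coeff f e = mfps_coeff g e"
  proof (cases "keys e \<subseteq> {..<n} \<times> UNIV")
    case True
    then obtain w where w: "length w = n" "encode w = e" by (rule encodeE)
    have "list_coeff f w = list_coeff g w"
      using to_fract_cochain_fun[OF f w(1)] to_fract_cochain_fun[OF g w(1)] eq[OF w(1)] by simp
    then show ?thesis by (simp add: list_coeff_def w)
  next
    case False
    moreover have "involves_points n f" "involves_points n g" using f g by (simp_all add: mem_group_cochains)
    ultimately show ?thesis by (metis mfps_coeff_eq_0_of_supported)
  qed
qed

text \<open>The prescribed values are divided by factorials in the fraction field, which is exactly
  what modified cochains permit.\<close>

lemma cochain_fun_surj:
  fixes c :: "('m::finite \<Rightarrow>\<^sub>0 nat) list \<Rightarrow> 'r::{idom, ring_char_0}"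
  obtains f where "f \<in> carrier (group_cochains n)" "\<And>w. length w = n \<Longrightarrow> cochain_fun n f w = c w"
proof -
  define dec where "dec e = (SOME w :: ('m \<Rightarrow>\<^sub>0 nat) list. length w = n \<and> encode w = e)" for e
  have dec: "dec (encode w) = w" if "length w = n" for w
  proof -
    have "length (dec (encode w)) = n \<and> encode (dec (encode w)) = encode w"
      unfolding dec_def by (rule someI[of _ w]) (simp add: that)
    then show ?thesis using encode_inject that by metis
  qed
  define f :: "(nat \<times> 'm, 'r fract) mfps" where
    "f = Abs_mfps (\<lambda>e. if keys e \<subseteq> {..<n} \<times> UNIV then to_fract (c (dec e)) / of_nat (exp_fact e) else 0)"
  have coeff: "list_coeff f w = to_fract (c w)" if "length w = n" for w
    using keys_encode[of w] that by (simp add: list_coeff_def f_def dec)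
  have f: "f \<in> carrier (group_cochains n)"
    unfolding mem_group_cochains using coeff by (auto simp: mfps_supported_def f_def split: if_splits)
  then show ?thesis using that coeff cochain_fun_eqI by blast
qed

lemma group_diff_cochain:
  fixes G :: "'m::finite \<Rightarrow> ('m + 'm, 'r::{idom, ring_char_0}) mfps"
  assumes G: "formal_group_law G" and f: "f \<in> carrier (group_cochains n)"
  shows "group_diff G n f \<in> carrier (group_cochains (Suc n))"
    and "cochain_fun (Suc n) (group_diff G n f) w = structure_constants.diff (fgl_mu G) (cochain_fun n f) w"
proof -
  interpret structure_constants "fgl_mu G" by (rule structure_constants_fgl_mu[OF G])
  have coeff: "list_coeff (group_diff G n f) w = to_fract (diff (cochain_fun n f) w)" if "length w = Suc n" for w
    using f that by (intro list_coeff_group_diff G) (auto simp: to_fract_cochain_fun mem_group_cochains)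
  then show *: "group_diff G n f \<in> carrier (group_cochains (Suc n))"
    using f by (simp add: mem_group_cochains involves_points_group_diff)
  show "cochain_fun (Suc n) (group_diff G n f) w = diff (cochain_fun n f) w"
  proof (cases "length w = Suc n")
    case True
    then show ?thesis using * coeff by (intro cochain_fun_eqI)
  next
    case False
    then have "diff (cochain_fun n f) w = diff (\<lambda>_. 0) w"
      by (intro diff_cong cochain_fun_length) auto
    then show ?thesis using False by (simp add: cochain_fun_length)
  qed
qed

text \<open>The derivatives are taken in distinct variables whose exponents in \<open>e\<close> are
  zero, so every factor they produce is \<open>1\<close>.\<close>

lemma mfps_coeff_foldr_deriv:
  assumes "distinct ks" "\<And>k. k \<in> set ks \<Longrightarrow> lookup e (k, j k) = 0"
  shows "mfps_coeff (foldr (\<lambda>k. mfps_deriv (k, j k)) ks f) e = mfps_coeff f (e + (\<Sum>k\<in>set ks. unit_exp (k, j k)))"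
  using assms
proof (induction ks arbitrary: e)
  case (Cons k ks)
  have "mfps_coeff (foldr (\<lambda>k. mfps_deriv (k, j k)) (k # ks) f) e =
    mfps_coeff (foldr (\<lambda>k. mfps_deriv (k, j k)) ks f) (e + unit_exp (k, j k))"
    using Cons.prems by (simp add: mfps_coeff_deriv)
  also have "\<dots> = mfps_coeff f ((e + unit_exp (k, j k)) + (\<Sum>k\<in>set ks. unit_exp (k, j k)))"
    using Cons.prems by (intro Cons.IH) (auto simp: lookup_add lookup_single when_def)
  finally show ?case using Cons.prems(1) by (simp add: add.assoc)
qed simp

lemma list_coeff_units:
  "list_coeff f (map unit_exp js) = mfps_coeff (foldr (\<lambda>k. mfps_deriv (k, js ! k)) [0..<length js] f) 0"
proof -
  have "encode (map unit_exp js) = (\<Sum>k\<in>set [0..<length js]. unit_exp (k, js ! k))"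
    unfolding encode_def by (intro sum.cong) auto
  moreover have "exp_fact (encode (map unit_exp js)) = 1"
    unfolding exp_fact_encode by (induction js) (auto simp: exp_fact_def)
  ultimately show ?thesis by (simp add: list_coeff_def mfps_coeff_foldr_deriv)
qed

section \<open>Antisymmetrization as a sum over permutations\<close>

lemma removal_sum_explicit:
  "removal_sum w F = (\<Sum>k<length w. (-1) ^ k * F (w ! k) (take k w @ drop (Suc k) w))"
  by (induction w arbitrary: F) (simp_all add: sum.lessThan_Suc_shift sum_negf del: sum.lessThan_Suc)

text \<open>Permutations are sorted by the image \<open>k\<close> of \<open>0\<close>;
  \<open>permutation_insert\<close> puts this value back in front of a permutation of the
  rest.\<close>

lemma sum_permutations_Suc:
  "(\<Sum>p | p permutes {0..<Suc n}. h p) =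
    (\<Sum>k<Suc n. \<Sum>q | q permutes {0..<n}. h (permutation_insert 0 k q))"
proof -
  have "{p. p permutes {0..<Suc n}} = (\<Union>k\<in>{..<Suc n}. {p. p permutes {0..<Suc n} \<and> p 0 = k})"
    using permutes_in_image by fastforce
  then have "(\<Sum>p | p permutes {0..<Suc n}. h p) =
    (\<Sum>k<Suc n. \<Sum>p | p permutes {0..<Suc n} \<and> p 0 = k. h p)"
    by (simp only:) (subst sum.UNION_disjoint, auto simp: finite_permutations)
  also have "\<dots> = (\<Sum>k<Suc n. \<Sum>q | q permutes {0..<n}. h (permutation_insert 0 k q))"
  proof (rule sum.cong[OF refl])
    fix k assume "k \<in> {..<Suc n}"
    then show "(\<Sum>p | p permutes {0..<Suc n} \<and> p 0 = k. h p) =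
        (\<Sum>q | q permutes {0..<n}. h (permutation_insert 0 k q))"
      by (subst permutation_fix) (auto simp: sum.reindex permutation_insert_inj_on)
  qed
  finally show ?thesis .
qed

text \<open>The entry placed first corresponds to the image of \<open>0\<close> under the
  permutation; bringing the entry at position \<open>k\<close> to the front costs the sign
  \<open>(-1) ^ k\<close>. This links the recursive form with the sum in
  \<open>tilde_phi\<close>.\<close>

lemma antisymmetrize_eq_sum_permutations:
  fixes g :: "'a list \<Rightarrow> 'b::comm_ring_1"
  shows "antisymmetrize g w = (\<Sum>p | p permutes {0..<length w}. of_int (sign p) * g (map (\<lambda>k. w ! p k) [0..<length w]))"
proof (induction "length w" arbitrary: g w)
  case 0
  then show ?case by simp
next
  case (Suc n)
  have "antisymmetrize g w = removal_sum w (\<lambda>a r. antisymmetrize (\<lambda>v. g (a # v)) r)"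
    using Suc.hyps(2) by (intro antisymmetrize_nonempty) auto
  also have "\<dots> = (\<Sum>k<Suc n. (-1) ^ k * (\<Sum>q | q permutes {0..<n}.
      of_int (sign q) * g (w ! k # map (\<lambda>i. (take k w @ drop (Suc k) w) ! q i) [0..<n])))"
    unfolding removal_sum_explicit Suc.hyps(2)[symmetric]
  proof (intro sum.cong refl arg_cong2[where f = "(*)"])
    fix k assume "k \<in> {..<Suc n}"
    then have len: "n = length (take k w @ drop (Suc k) w)" using Suc.hyps(2) by auto
    show "antisymmetrize (\<lambda>v. g (w ! k # v)) (take k w @ drop (Suc k) w) = (\<Sum>q | q permutes {0..<n}.
      of_int (sign q) * g (w ! k # map (\<lambda>i. (take k w @ drop (Suc k) w) ! q i) [0..<n]))"
      using Suc.hyps(1)[OF len] unfolding len[symmetric] .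
  qed
  also have "\<dots> = (\<Sum>k<Suc n. \<Sum>q | q permutes {0..<n}. of_int (sign (permutation_insert 0 k q)) *
      g (map (\<lambda>i. w ! permutation_insert 0 k q i) [0..<Suc n]))"
    unfolding sum_distrib_left
  proof (intro sum.cong refl)
    fix k q assume k: "k \<in> {..<Suc n}" and q: "q \<in> {q. q permutes {0..<n}}"
    have "(take k w @ drop (Suc k) w) ! q i = w ! permutation_insert 0 k q (Suc i)" if "i < n" for i
    proof -
      have "q i < n" using q that permutes_in_image[of q "{0..<n}" i] by simp
      then show ?thesis using k Suc.hyps(2)
        by (auto simp: permutation_insert_expand nth_append min_def)
    qed
    then have "map (\<lambda>i. w ! permutation_insert 0 k q i) [0..<Suc n] =
        w ! k # map (\<lambda>i. (take k w @ drop (Suc k) w) ! q i) [0..<n]"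
      by (simp add: upt_conv_Cons map_Suc_upt[symmetric] del: upt_Suc)
    moreover have "of_int (sign (permutation_insert 0 k q)) = ((-1) ^ k * of_int (sign q) :: 'b)"
      using signof_permutation_insert[of q n 0 k] k q by simp
    ultimately show "(-1) ^ k * (of_int (sign q) * g (w ! k # map (\<lambda>i. (take k w @ drop (Suc k) w) ! q i) [0..<n])) =
      of_int (sign (permutation_insert 0 k q)) * g (map (\<lambda>i. w ! permutation_insert 0 k q i) [0..<Suc n])"
      by (simp add: mult.assoc)
  qed
  also have "\<dots> = (\<Sum>p | p permutes {0..<Suc n}. of_int (sign p) * g (map (\<lambda>k. w ! p k) [0..<Suc n]))"
    by (rule sum_permutations_Suc[symmetric])
  finally show ?case unfolding Suc.hyps(2) .
qed

section \<open>Lie algebra cochains as functions on lists of indices\<close>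

text \<open>The multilinear form with coefficients \<open>\<alpha>\<close> in the standard basis,
  expanded in its first argument.\<close>

primrec multilinear_ext :: "('r::comm_ring_1 ^ 'm::finite) list \<Rightarrow> ('m list \<Rightarrow> 'r) \<Rightarrow> 'r" where
  "multilinear_ext [] \<alpha> = \<alpha> []"
| "multilinear_ext (x # xs) \<alpha> = (\<Sum>j\<in>UNIV. vec_nth x j * multilinear_ext xs (\<lambda>v. \<alpha> (j # v)))"

lemma multilinear_ext_cong:
  "(\<And>v. length v = length xs \<Longrightarrow> \<alpha> v = \<beta> v) \<Longrightarrow> multilinear_ext xs \<alpha> = multilinear_ext xs \<beta>"
proof (induction xs arbitrary: \<alpha> \<beta>)
  case (Cons x xs)
  have "multilinear_ext xs (\<lambda>v. \<alpha> (j # v)) = multilinear_ext xs (\<lambda>v. \<beta> (j # v))" for j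
    by (rule Cons.IH) (rule Cons.prems, simp)
  then show ?case by simp
qed simp

lemma multilinear_ext_add:
  "multilinear_ext xs (\<lambda>v. \<alpha> v + \<beta> v) = multilinear_ext xs \<alpha> + multilinear_ext xs \<beta>"
  by (induction xs arbitrary: \<alpha> \<beta>) (simp_all add: distrib_left sum.distrib)

lemma multilinear_ext_scale: "multilinear_ext xs (\<lambda>v. r * \<alpha> v) = r * multilinear_ext xs \<alpha>"
  by (induction xs arbitrary: \<alpha>) (simp_all add: sum_distrib_left mult.left_commute)

lemma multilinear_ext_minus: "multilinear_ext xs (\<lambda>v. - \<alpha> v) = - multilinear_ext xs \<alpha>"
  using multilinear_ext_scale[of xs "-1" \<alpha>] by simp

lemma multilinear_ext_diff:
  "multilinear_ext xs (\<lambda>v. \<alpha> v - \<beta> v) = multilinear_ext xs \<alpha> - multilinear_ext xs \<beta>"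
  using multilinear_ext_add[of xs \<alpha> "\<lambda>v. - \<beta> v"] by (simp add: multilinear_ext_minus)

lemma multilinear_ext_zero [simp]: "multilinear_ext xs (\<lambda>v. 0) = 0"
  using multilinear_ext_scale[of xs 0 "\<lambda>v. 0"] by simp

lemma multilinear_ext_sum:
  "finite I \<Longrightarrow> multilinear_ext xs (\<lambda>v. \<Sum>i\<in>I. \<alpha> i v) = (\<Sum>i\<in>I. multilinear_ext xs (\<alpha> i))"
  by (induction I rule: finite_induct) (simp_all add: multilinear_ext_add)

lemma multilinear_ext_update_add:
  "i < length xs \<Longrightarrow> multilinear_ext (xs[i := x + y]) \<alpha> =
    multilinear_ext (xs[i := x]) \<alpha> + multilinear_ext (xs[i := y]) \<alpha>"
  by (induction xs arbitrary: i \<alpha>) (auto simp: distrib_left distrib_right sum.distrib split: nat.split)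

lemma multilinear_ext_update_smult:
  "i < length xs \<Longrightarrow> multilinear_ext (xs[i := r *s x]) \<alpha> = r * multilinear_ext (xs[i := x]) \<alpha>"
  by (induction xs arbitrary: i \<alpha>) (auto simp: sum_distrib_left mult_ac split: nat.split)

lemma multilinear_ext_axis [simp]:
  "multilinear_ext (map (\<lambda>i. axis i 1) is) \<alpha> = \<alpha> is"
proof (induction "is" arbitrary: \<alpha>)
  case (Cons i "is")
  have "multilinear_ext (map (\<lambda>i. axis i 1) (i # is)) \<alpha> = (\<Sum>j\<in>UNIV. if j = i then \<alpha> (j # is) else 0)"
    unfolding list.map multilinear_ext.simps Cons.IH by (intro sum.cong) (auto simp: axis_def)
  then show ?case by simp
qed simp

lemma alternatingD:
  assumes "alternating \<alpha>"
  shows "\<alpha> (u @ a # b # v) = - \<alpha> (u @ b # a # v)" "\<alpha> (u @ a # a # v) = 0"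
  using assms unfolding alternating_def by blast+

lemma alternating_Cons:
  assumes "alternating \<alpha>"
  shows "alternating (\<lambda>v. \<alpha> (x # v))"
proof -
  have "\<alpha> (x # u @ a # b # v) = - \<alpha> (x # u @ b # a # v)" "\<alpha> (x # u @ a # a # v) = 0" for u a b v
    using alternatingD(1)[OF assms, of "x # u" a b v] alternatingD(2)[OF assms, of "x # u" a v] by simp_all
  then show ?thesis unfolding alternating_def by blast
qed

lemma alternating_multilinear_ext:
  fixes \<alpha> :: "'m::finite list \<Rightarrow> 'r::{idom, ring_char_0}"
  assumes "alternating \<alpha>"
  shows "alternating (\<lambda>xs. multilinear_ext xs \<alpha>)"
proof -
  have swap: "multilinear_ext (us @ x # y # vs) \<alpha> = - multilinear_ext (us @ y # x # vs) \<alpha>"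
    if "alternating \<alpha>" for us x y vs and \<alpha> :: "'m list \<Rightarrow> 'r"
    using that
  proof (induction us arbitrary: \<alpha>)
    case Nil
    have sw: "multilinear_ext vs (\<lambda>v. \<alpha> (j # k # v)) = - multilinear_ext vs (\<lambda>v. \<alpha> (k # j # v))" for j k
      unfolding multilinear_ext_minus[symmetric]
      using alternatingD(1)[OF Nil, of "[]" j k] by simp
    have "multilinear_ext (x # y # vs) \<alpha> =
      (\<Sum>j\<in>UNIV. \<Sum>k\<in>UNIV. - (vec_nth x j * vec_nth y k * multilinear_ext vs (\<lambda>v. \<alpha> (k # j # v))))"
      unfolding multilinear_ext.simps sum_distrib_left
      by (intro sum.cong refl, subst sw) (simp add: mult.assoc)
    also have "\<dots> = - multilinear_ext (y # x # vs) \<alpha>"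
      by (subst sum.swap) (simp add: sum_distrib_left sum_negf mult_ac)
    finally show ?case by simp
  next
    case (Cons u us)
    have "multilinear_ext (us @ x # y # vs) (\<lambda>v. \<alpha> (j # v)) = - multilinear_ext (us @ y # x # vs) (\<lambda>v. \<alpha> (j # v))" for j
      by (intro Cons.IH alternating_Cons Cons.prems)
    then show ?case by (simp add: sum_negf)
  qed
  \<comment> \<open>Skew-symmetry gives that twice the value is zero, and 2 can be cancelled in a
    domain of characteristic zero.\<close>
  have "multilinear_ext (us @ x # x # vs) \<alpha> = 0" for us x vs
  proof -
    have "multilinear_ext (us @ x # x # vs) \<alpha> + multilinear_ext (us @ x # x # vs) \<alpha> = 0"
      using swap[OF assms, of us x x vs] by (metis add.right_inverse)
    then have "2 * multilinear_ext (us @ x # x # vs) \<alpha> = 0" by simp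
    then show ?thesis by simp
  qed
  then show ?thesis using swap[OF assms] unfolding alternating_def by blast
qed

text \<open>The first of the two equal entries is moved to the right by exchanges of neighbours
  until it meets the second.\<close>

lemma alternating_repeat:
  assumes alt: "alternating \<beta>" and ij: "i < j" "j < length xs" "xs ! i = xs ! j"
  shows "\<beta> xs = 0"
proof -
  have sep: "\<beta> (u @ a # m @ a # v) = 0" for u a m v
  proof (induction m arbitrary: u)
    case Nil
    then show ?case using alternatingD(2)[OF alt] by simp
  next
    case (Cons b m)
    have "\<beta> (u @ a # b # m @ a # v) = - \<beta> (u @ b # a # m @ a # v)" by (rule alternatingD(1)[OF alt])
    then show ?case using Cons.IH[of "u @ [b]"] by simp
  qed
  have "xs = take i xs @ xs ! i # drop (Suc i) xs" using ij by (intro id_take_nth_drop) simp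
  also have "drop (Suc i) xs = take (j - Suc i) (drop (Suc i) xs) @ xs ! j # drop (Suc j) xs"
    using id_take_nth_drop[of "j - Suc i" "drop (Suc i) xs"] ij by simp
  finally show ?thesis using sep ij(3) by metis
qed

lemma multilinear_determined:
  fixes a :: "('r::comm_ring_1 ^ 'm::finite) list \<Rightarrow> 'r"
  assumes add: "\<And>us x y vs. length (us @ x # vs) = n \<Longrightarrow> a (us @ (x + y) # vs) = a (us @ x # vs) + a (us @ y # vs)"
    and smult: "\<And>us r x vs. length (us @ x # vs) = n \<Longrightarrow> a (us @ (r *s x) # vs) = r * a (us @ x # vs)"
    and len: "length xs = n"
  shows "a xs = multilinear_ext xs (\<lambda>is. a (map (\<lambda>i. axis i 1) is))"
proof -
  \<comment> \<open>In the induction \<open>us\<close> collects the basis vectors to which the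
    earlier entries have been reduced.\<close>
  have "a (us @ xs) = multilinear_ext xs (\<lambda>is. a (us @ map (\<lambda>i. axis i 1) is))"
    if "length (us @ xs) = n" for us xs
    using that
  proof (induction xs arbitrary: us)
    case (Cons x xs)
    have zero: "a (us @ 0 # xs) = 0"
      using smult[of us 0 xs 0] Cons.prems by simp
    have sum: "a (us @ (\<Sum>j\<in>J. f j *s axis j 1) # xs) = (\<Sum>j\<in>J. f j * a (us @ axis j 1 # xs))"
      if "finite J" for J f
      using that
    proof (induction J rule: finite_induct)
      case (insert j J)
      then show ?case using Cons.prems by (simp add: add smult)
    qed (simp add: zero)
    have "x = (\<Sum>j\<in>UNIV. vec_nth x j *s axis j 1)"
      by (simp add: Finite_Cartesian_Product.vec_eq_iff axis_def if_distrib[of "\<lambda>z. _ * z"] cong: if_cong)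
    then have "a (us @ x # xs) = (\<Sum>j\<in>UNIV. vec_nth x j * a (us @ axis j 1 # xs))"
      using sum[of UNIV "vec_nth x"] by simp
    also have "\<dots> = multilinear_ext (x # xs) (\<lambda>is. a (us @ map (\<lambda>i. axis i 1) is))"
      using Cons.IH[of "us @ [axis _ 1]"] Cons.prems by simp
    finally show ?case .
  qed simp
  from this[of "[]"] len show ?thesis by simp
qed

text \<open>Elements of the exterior power are cosets. The pullback of a functional to the free
  module replaces computations with cosets by the defining relations, on which it vanishes.\<close>

lemma lie_cochain_linear:
  fixes w :: "(('r::comm_ring_1 ^ 'm::finite) list \<Rightarrow>\<^sub>0 'r) set \<Rightarrow> 'r"
  assumes w: "w \<in> carrier (lie_cochains n)"
  obtains l where "\<And>xs. length xs = n \<Longrightarrow> l (single xs 1) = w (wedge xs)"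
    "\<And>p q. p \<in> carrier (free_tuples n) \<Longrightarrow> q \<in> carrier (free_tuples n) \<Longrightarrow> l (p + q) = l p + l q"
    "\<And>r p. p \<in> carrier (free_tuples n) \<Longrightarrow> l (Poly_Mapping.map ((*) r) p) = r * l p"
    "\<And>p. p \<in> wedge_relations n \<Longrightarrow> l p = 0"
proof
  let ?F = "free_tuples n :: ('r, ('r ^ 'm) list \<Rightarrow>\<^sub>0 'r) module"
  let ?E = "exterior_power n :: ('r, (('r ^ 'm) list \<Rightarrow>\<^sub>0 'r) set) module"
  define c where "c = a_r_coset ?F (wedge_relations n)"
  note E = exterior_power_simps[where 'r = 'r and 'm = 'm and n = n, folded c_def]
  define l where "l p = w (c p)" for p
  show "l (single xs 1) = w (wedge xs)" if "length xs = n" for xs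
    using that by (simp add: l_def c_def wedge_def)
  show add: "l (p + q) = l p + l q" if pq: "p \<in> carrier ?F" "q \<in> carrier ?F" for p q
  proof -
    have "w (c p \<oplus>\<^bsub>?E\<^esub> c q) = w (c p) + w (c q)"
      using w pq unfolding lie_cochains_def dual_module_def E(1) by auto
    then show ?thesis by (simp only: E(2)[OF pq] l_def)
  qed
  show "l (Poly_Mapping.map ((*) r) p) = r * l p" if p: "p \<in> carrier ?F" for r p
  proof -
    have "w (r \<odot>\<^bsub>?E\<^esub> c p) = r * w (c p)"
      using w p unfolding lie_cochains_def dual_module_def E(1) by auto
    then show ?thesis by (simp only: E(3) l_def)
  qed
  have zero: "l 0 = 0" using add[of 0 0] by simp
  show "l p = 0" if p: "p \<in> wedge_relations n" for p
  proof -
    have "c p = c 0"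
    proof
      show "c p \<subseteq> c 0" using wedge_relations_closed(2)[OF _ p] by (auto simp: E(4))
      show "c 0 \<subseteq> c p"
      proof
        fix q assume "q \<in> c 0"
        then have "q \<in> wedge_relations n" by (auto simp: E(4))
        then have "q + - p \<in> wedge_relations n" by (intro wedge_relations_closed(2,4) p)
        then show "q \<in> c p" unfolding E(4) by force
      qed
    qed
    then show ?thesis using zero by (simp add: l_def)
  qed
qed

lemma lie_cochain_multilinear:
  fixes w :: "(('r::comm_ring_1 ^ 'm::finite) list \<Rightarrow>\<^sub>0 'r) set \<Rightarrow> 'r"
  assumes w: "w \<in> carrier (lie_cochains n)"
  shows "length (us @ x # vs) = n \<Longrightarrow> w (wedge (us @ (x + y) # vs)) = w (wedge (us @ x # vs)) + w (wedge (us @ y # vs))"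
    and "length (us @ x # vs) = n \<Longrightarrow> w (wedge (us @ (r *s x) # vs)) = r * w (wedge (us @ x # vs))"
    and "length (us @ x # x # vs) = n \<Longrightarrow> w (wedge (us @ x # x # vs)) = 0"
proof -
  let ?F = "free_tuples n :: ('r, ('r ^ 'm) list \<Rightarrow>\<^sub>0 'r) module"
  let ?R = "{single (xs[i := x + y]) 1
         - single (xs[i := x]) 1 - single (xs[i := y]) 1
       | xs i x y. length xs = n \<and> i < n} \<union>
      {single (xs[i := r *s x]) 1 - single (xs[i := x]) r
       | xs i r x. length xs = n \<and> i < n} \<union>
      {single xs 1 | xs i j. length xs = n \<and> i < j \<and> j < n \<and> xs ! i = xs ! j} :: (('r ^ 'm) list \<Rightarrow>\<^sub>0 'r) set"
  obtain l where l: "\<And>xs. length xs = n \<Longrightarrow> l (single xs 1) = w (wedge xs)"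
    and l_add: "\<And>p q. p \<in> carrier ?F \<Longrightarrow> q \<in> carrier ?F \<Longrightarrow> l (p + q) = l p + l q"
    and l_smult: "\<And>r p. p \<in> carrier ?F \<Longrightarrow> l (Poly_Mapping.map ((*) r) p) = r * l p"
    and l_rel: "\<And>p. p \<in> wedge_relations n \<Longrightarrow> l p = 0"
    using lie_cochain_linear[OF w] by blast
  have base: "p \<in> wedge_relations n" if "p \<in> ?R" for p
    unfolding wedge_relations_def using that by (rule submodule_span.base)
  have single: "single xs r \<in> carrier ?F" if "length xs = n" for xs r
    using that by simp
  have closed: "p + q \<in> carrier ?F" if "p \<in> carrier ?F" "q \<in> carrier ?F" for p q
    using that keys_add[of p q] by auto
  have l_eq: "l p = l q" if "p - q \<in> wedge_relations n" "q \<in> carrier ?F" for p q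
    using l_add[of "p - q" q] l_rel[OF that(1)] that wedge_relations_subset[of n] by auto
  show "w (wedge (us @ (x + y) # vs)) = w (wedge (us @ x # vs)) + w (wedge (us @ y # vs))"
    if len: "length (us @ x # vs) = n"
  proof -
    have *: "single (us @ (x + y) # vs) 1 - single (us @ x # vs) 1 - single (us @ y # vs) (1 :: 'r) \<in> ?R"
      using len by (intro UnI1 CollectI exI[of _ "us @ x # vs"] exI[of _ "length us"] exI[of _ x] exI[of _ y]) simp
    have "l (single (us @ (x + y) # vs) 1) = l (single (us @ x # vs) 1 + single (us @ y # vs) 1)"
      using base[OF *] len by (intro l_eq closed single) (simp_all add: diff_diff_add)
    also have "\<dots> = l (single (us @ x # vs) 1) + l (single (us @ y # vs) 1)"
      using len by (intro l_add single) simp_all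
    finally show ?thesis using len by (simp add: l)
  qed
  show "w (wedge (us @ (r *s x) # vs)) = r * w (wedge (us @ x # vs))" if len: "length (us @ x # vs) = n"
  proof -
    have *: "single (us @ (r *s x) # vs) 1 - single (us @ x # vs) r \<in> ?R"
      using len by (intro UnI1 UnI2 CollectI exI[of _ "us @ x # vs"] exI[of _ "length us"] exI[of _ r] exI[of _ x]) simp
    have "l (single (us @ (r *s x) # vs) 1) = l (single (us @ x # vs) r)"
      using base[OF *] len by (intro l_eq single) simp_all
    also have "single (us @ x # vs) r = Poly_Mapping.map ((*) r) (single (us @ x # vs) 1)"
      by (rule poly_mapping_eqI) (simp add: lookup_single when_def)
    also have "l \<dots> = r * l (single (us @ x # vs) 1)"
      using len by (intro l_smult single) simp
    finally show ?thesis using len by (simp add: l)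
  qed
  show "w (wedge (us @ x # x # vs)) = 0" if len: "length (us @ x # x # vs) = n"
  proof -
    have "single (us @ x # x # vs) 1 \<in> ?R"
      using len by (intro UnI2 CollectI exI[of _ "us @ x # x # vs"] exI[of _ "length us"] exI[of _ "Suc (length us)"])
        (simp add: nth_append)
    from l_rel[OF base[OF this]] show ?thesis using len by (simp add: l)
  qed
qed

definition lie_coords :: "nat \<Rightarrow> ((('r::comm_ring_1 ^ 'm::finite) list \<Rightarrow>\<^sub>0 'r) set \<Rightarrow> 'r) \<Rightarrow> 'm list \<Rightarrow> 'r" where
  "lie_coords n w is = (if length is = n then w (wedge (map (\<lambda>i. axis i 1) is)) else 0)"

text \<open>Inverse to \<open>lie_coords\<close> on alternating functions. It has the form of the
  descriptions in \<open>lie_diff\<close> and \<open>tilde_phi\<close>, which are later recognized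
  as instances.\<close>

definition lie_of :: "nat \<Rightarrow> ('m::finite list \<Rightarrow> 'r::comm_ring_1) \<Rightarrow> (('r ^ 'm) list \<Rightarrow>\<^sub>0 'r) set \<Rightarrow> 'r" where
  "lie_of n \<alpha> = (THE w. w \<in> carrier (lie_cochains n) \<and> (\<forall>xs. length xs = n \<longrightarrow> w (wedge xs) = multilinear_ext xs \<alpha>))"

lemma lie_cochain_eq_multilinear_ext:
  assumes "w \<in> carrier (lie_cochains n)" "length xs = n"
  shows "w (wedge xs) = multilinear_ext xs (lie_coords n w)"
proof -
  have "w (wedge xs) = multilinear_ext xs (\<lambda>is. w (wedge (map (\<lambda>i. axis i 1) is)))"
    using lie_cochain_multilinear[OF assms(1)] assms(2)
    by (intro multilinear_determined[where a = "\<lambda>xs. w (wedge xs)"]) auto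
  also have "\<dots> = multilinear_ext xs (lie_coords n w)"
    using assms(2) by (intro multilinear_ext_cong) (simp add: lie_coords_def)
  finally show ?thesis .
qed

lemma alternating_lie_coords:
  assumes w: "w \<in> carrier (lie_cochains n)"
  shows "alternating (lie_coords n w)"
proof -
  have swap: "w (wedge (us @ x # y # vs)) = - w (wedge (us @ y # x # vs))" if len: "length (us @ x # y # vs) = n" for us x y vs
  proof -
    note add = lie_cochain_multilinear(1)[OF w] and alt = lie_cochain_multilinear(3)[OF w]
    \<comment> \<open>Polarization: the value at the repeated vector \<open>x + y\<close> is
      expanded.\<close>
    have "0 = w (wedge (us @ (x + y) # (x + y) # vs))" using len by (simp add: alt)
    also have "\<dots> = w (wedge (us @ x # (x + y) # vs)) + w (wedge (us @ y # (x + y) # vs))"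
      using len by (intro add) simp
    also have "w (wedge (us @ x # (x + y) # vs)) = w (wedge (us @ x # x # vs)) + w (wedge (us @ x # y # vs))"
      using add[of "us @ [x]" x vs y] len by simp
    also have "w (wedge (us @ y # (x + y) # vs)) = w (wedge (us @ y # x # vs)) + w (wedge (us @ y # y # vs))"
      using add[of "us @ [y]" x vs y] len by simp
    finally show ?thesis using len by (simp add: alt eq_neg_iff_add_eq_0)
  qed
  have "lie_coords n w (u @ a # b # v) = - lie_coords n w (u @ b # a # v)" for u a b v
  proof (cases "length (u @ a # b # v) = n")
    case True
    then have "length (map (\<lambda>i. axis i 1) u @ axis a 1 # axis b 1 # map (\<lambda>i. axis i 1) v) = n" by simp
    from swap[OF this] True show ?thesis by (simp add: lie_coords_def)
  qed (simp add: lie_coords_def)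
  moreover have "lie_coords n w (u @ a # a # v) = 0" for u a v
    by (simp add: lie_coords_def lie_cochain_multilinear(3)[OF w])
  ultimately show ?thesis unfolding alternating_def by blast
qed

lemma ex1_lie_of:
  fixes \<alpha> :: "'m::finite list \<Rightarrow> 'r::{idom, ring_char_0}"
  assumes "alternating \<alpha>"
  shows "\<exists>!w. w \<in> carrier (lie_cochains n) \<and> (\<forall>xs. length xs = n \<longrightarrow> w (wedge xs) = multilinear_ext xs \<alpha>)"
  by (rule ex1_lie_cochain)
    (auto simp: multilinear_ext_update_add multilinear_ext_update_smult
      intro: alternating_repeat[OF alternating_multilinear_ext[OF assms]])

lemma lie_of:
  fixes \<alpha> :: "'m::finite list \<Rightarrow> 'r::{idom, ring_char_0}"
  assumes "alternating \<alpha>"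
  shows "lie_of n \<alpha> \<in> carrier (lie_cochains n)"
    and "length is = n \<Longrightarrow> lie_coords n (lie_of n \<alpha>) is = \<alpha> is"
proof -
  note * = theI'[OF ex1_lie_of[OF assms, of n], folded lie_of_def]
  show "lie_of n \<alpha> \<in> carrier (lie_cochains n)" using * by blast
  show "lie_coords n (lie_of n \<alpha>) is = \<alpha> is" if "length is = n"
    using *[THEN conjunct2, rule_format, of "map (\<lambda>i. axis i 1) is"] that by (simp add: lie_coords_def)
qed

text \<open>The extensionality principle by which identities between Lie cochains are later reduced
  to coordinates.\<close>

lemma lie_coords_inject:
  fixes w v :: "(('r::{idom, ring_char_0} ^ 'm::finite) list \<Rightarrow>\<^sub>0 'r) set \<Rightarrow> 'r"
  assumes "w \<in> carrier (lie_cochains n)" "v \<in> carrier (lie_cochains n)"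
    "\<And>is. length is = n \<Longrightarrow> lie_coords n w is = lie_coords n v is"
  shows "w = v"
proof -
  have "v (wedge xs) = multilinear_ext xs (lie_coords n w)" if "length xs = n" for xs
    unfolding lie_cochain_eq_multilinear_ext[OF assms(2) that]
    using assms(3) that by (intro multilinear_ext_cong) simp
  moreover have "w (wedge xs) = multilinear_ext xs (lie_coords n w)" if "length xs = n" for xs
    by (rule lie_cochain_eq_multilinear_ext[OF assms(1) that])
  ultimately show ?thesis
    using ex1_lie_of[OF alternating_lie_coords[OF assms(1)], of n] assms(1,2) by blast
qed

lemma multilinear_ext_removal_sum:
  "multilinear_ext xs (\<lambda>is. removal_sum is F) =
    removal_sum xs (\<lambda>x r. \<Sum>j\<in>UNIV. vec_nth x j * multilinear_ext r (F j))"
proof (induction xs arbitrary: F)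
  case (Cons x xs)
  have "multilinear_ext (x # xs) (\<lambda>is. removal_sum is F) =
    (\<Sum>a\<in>UNIV. vec_nth x a * multilinear_ext xs (F a)) -
    (\<Sum>a\<in>UNIV. vec_nth x a * removal_sum xs (\<lambda>y r. \<Sum>j\<in>UNIV. vec_nth y j * multilinear_ext r (\<lambda>r. F j (a # r))))"
    by (simp add: multilinear_ext_diff Cons.IH right_diff_distrib sum_subtractf)
  also have "(\<Sum>a\<in>UNIV. vec_nth x a * removal_sum xs (\<lambda>y r. \<Sum>j\<in>UNIV. vec_nth y j * multilinear_ext r (\<lambda>r. F j (a # r)))) =
    removal_sum xs (\<lambda>y r. \<Sum>a\<in>UNIV. vec_nth x a * (\<Sum>j\<in>UNIV. vec_nth y j * multilinear_ext r (\<lambda>r. F j (a # r))))"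
    by (simp add: removal_sum_sum removal_sum_scale)
  also have "\<dots> = removal_sum xs (\<lambda>y r. \<Sum>j\<in>UNIV. vec_nth y j * multilinear_ext (x # r) (F j))"
  proof (rule removal_sum_cong)
    fix y r
    show "(\<Sum>a\<in>UNIV. vec_nth x a * (\<Sum>j\<in>UNIV. vec_nth y j * multilinear_ext r (\<lambda>r. F j (a # r)))) =
      (\<Sum>j\<in>UNIV. vec_nth y j * multilinear_ext (x # r) (F j))"
      unfolding sum_distrib_left multilinear_ext.simps by (subst sum.swap) (simp add: mult.left_commute)
  qed
  finally show ?case by simp
qed simp

lemma multilinear_ext_removal_sum2:
  "multilinear_ext xs (\<lambda>is. removal_sum2 is H) =
    removal_sum2 xs (\<lambda>x y r. \<Sum>a\<in>UNIV. \<Sum>b\<in>UNIV. vec_nth x a * vec_nth y b * multilinear_ext r (H a b))"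
  unfolding removal_sum2_def multilinear_ext_removal_sum
  by (simp add: removal_sum_sum removal_sum_scale sum_distrib_left mult.assoc)

text \<open>For \<open>r < s\<close>, removing \<open>r\<close> first moves \<open>s\<close> down by
  one and gives the sign opposite to \<open>(-1) ^ (r + s)\<close>, while removing \<open>s\<close>
  first gives \<open>(-1) ^ (r + s)\<close>. This converts the sum over unordered pairs in
  \<open>lie_diff\<close> into the sum over ordered pairs in \<open>ce_diff\<close>.\<close>

lemma sum_pairs_eq_removal_sum2:
  "(\<Sum>s<length xs. \<Sum>r<s. (-1) ^ (r + s) * (F (xs ! r) (xs ! s) (nths xs (- {r, s})) - F (xs ! s) (xs ! r) (nths xs (- {r, s})))) =
    - removal_sum2 xs F"
proof (induction xs arbitrary: F)
  case (Cons x xs)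
  have nths0: "nths (x # xs) (- {0, Suc s}) = take s xs @ drop (Suc s) xs" if "s < length xs" for s
  proof -
    have "nths (x # xs) (- {0, Suc s}) = nths xs (- {s})"
      by (simp add: nths_Cons) (rule arg_cong[where f = "nths xs"], auto)
    also have "\<dots> = nths (take s xs @ xs ! s # drop (Suc s) xs) (- {s})"
      using id_take_nth_drop[OF that] by simp
    also have "\<dots> = take s xs @ drop (Suc s) xs"
    proof -
      have "{j. j + length (take s xs) \<in> - {s}} = - {0}" using that by auto
      moreover have "{j. Suc j \<in> - {0}} = (UNIV :: nat set)" by auto
      moreover have "nths (take s xs) (- {s}) = take s xs"
        using that nths_all[of "take s xs" "- {s}"] by auto
      ultimately show ?thesis by (simp add: nths_append nths_Cons nths_all)
    qed
    finally show ?thesis .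
  qed
  have nthsS: "nths (x # xs) (- {Suc r, Suc s}) = x # nths xs (- {r, s})" for r s
    by (simp add: nths_Cons) (rule arg_cong[where f = "nths xs"], auto)
  let ?t = "\<lambda>ys F r s. (-1) ^ (r + s) * (F (ys ! r) (ys ! s) (nths ys (- {r, s})) - F (ys ! s) (ys ! r) (nths ys (- {r, s})))"
  have "(\<Sum>s<length (x # xs). \<Sum>r<s. ?t (x # xs) F r s) =
      (\<Sum>s<length xs. \<Sum>r<Suc s. ?t (x # xs) F r (Suc s))"
    by (simp add: sum.lessThan_Suc_shift del: sum.lessThan_Suc)
  also have "\<dots> = (\<Sum>s<length xs. ?t (x # xs) F 0 (Suc s)) + (\<Sum>s<length xs. \<Sum>r<s. ?t (x # xs) F (Suc r) (Suc s))"
    unfolding sum.lessThan_Suc_shift sum.distrib ..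
  also have "(\<Sum>s<length xs. ?t (x # xs) F 0 (Suc s)) =
      - (removal_sum xs (F x) - removal_sum xs (\<lambda>b. F b x))"
    unfolding removal_sum_explicit sum_subtractf[symmetric] sum_negf[symmetric]
    by (intro sum.cong refl) (simp add: nths0 right_diff_distrib)
  also have "(\<Sum>s<length xs. \<Sum>r<s. ?t (x # xs) F (Suc r) (Suc s)) =
      (\<Sum>s<length xs. \<Sum>r<s. ?t xs (\<lambda>b b' r. F b b' (x # r)) r s)"
    by (simp add: nthsS)
  finally show ?case using Cons.IH[of "\<lambda>b b' r. F b b' (x # r)"] by simp
qed simp

lemma (in structure_constants) alternating_ce_diff:
  assumes "alternating \<alpha>"
  shows "alternating (ce_diff gamma \<alpha>)"
proof -
  have "ce_diff gamma \<alpha> = tangent (diff (critical_extension \<alpha>))"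
    using tangent_critical_extension[OF assms] by (auto simp: tangent_diff)
  then show ?thesis using antisymmetrize_alternating by metis
qed

lemma ce_diff_length:
  assumes "\<And>is. length is \<noteq> n \<Longrightarrow> \<alpha> is = 0" "length is \<noteq> Suc n"
  shows "ce_diff \<gamma> \<alpha> is = 0"
proof -
  have "removal_sum2 is (\<lambda>a b r. \<Sum>j\<in>UNIV. \<gamma> j a b * \<alpha> (j # r)) = removal_sum2 is (\<lambda>a b r. 0)"
  proof (rule removal_sum2_cong)
    fix a b r assume "mset is = add_mset a (add_mset b (mset r))"
    from arg_cong[OF this, of size] assms(2) have "length (j # r) \<noteq> n" for j :: 'a by simp
    then show "(\<Sum>j\<in>UNIV. \<gamma> j a b * \<alpha> (j # r)) = 0" using assms(1) by simp
  qed
  then show ?thesis by (simp add: ce_diff_def removal_sum2_def)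
qed

lemma lie_diff_cochain:
  fixes G :: "'m::finite \<Rightarrow> ('m + 'm, 'r::{idom, ring_char_0}) mfps"
  assumes G: "formal_group_law G" and w: "w \<in> carrier (lie_cochains n)"
  shows "lie_diff (fgl_bracket G) n w \<in> carrier (lie_cochains (Suc n))"
    and "lie_coords (Suc n) (lie_diff (fgl_bracket G) n w) is = ce_diff (fgl_gamma G) (lie_coords n w) is"
proof -
  interpret structure_constants "fgl_mu G" by (rule structure_constants_fgl_mu[OF G])
  let ?\<alpha> = "lie_coords n w" and ?\<gamma> = "fgl_gamma G" and ?br = "fgl_bracket G"
  have gamma: "gamma = ?\<gamma>" by (intro ext) (rule fgl_mu_unit[OF G])
  have alt: "alternating (ce_diff ?\<gamma> ?\<alpha>)"
    using alternating_ce_diff[OF alternating_lie_coords[OF w]] unfolding gamma .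
  define F where "F x y r = (\<Sum>a\<in>UNIV. \<Sum>b\<in>UNIV. vec_nth x a * vec_nth y b *
      multilinear_ext r (\<lambda>v. \<Sum>j\<in>UNIV. ?\<gamma> j a b * ?\<alpha> (j # v)))" for x y :: "'r ^ 'm" and r
  \<comment> \<open>The bracket has antisymmetrized coefficients; its two halves are the two orders
    of \<open>x\<close> and \<open>y\<close> in \<open>F\<close>.\<close>
  have bracket: "w (wedge (?br x y # r)) = F x y r - F y x r" if "Suc (length r) = n" for x y r
  proof -
    have F: "F x y r = (\<Sum>j\<in>UNIV. (\<Sum>a\<in>UNIV. \<Sum>b\<in>UNIV. vec_nth x a * vec_nth y b * ?\<gamma> j a b) * multilinear_ext r (\<lambda>v. ?\<alpha> (j # v)))" for x y
    proof -
      have "F x y r = (\<Sum>a\<in>UNIV. \<Sum>b\<in>UNIV. \<Sum>j\<in>UNIV. vec_nth x a * vec_nth y b * ?\<gamma> j a b * multilinear_ext r (\<lambda>v. ?\<alpha> (j # v)))"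
        by (simp add: F_def multilinear_ext_sum multilinear_ext_scale sum_distrib_left mult.assoc)
      also have "\<dots> = (\<Sum>a\<in>UNIV. \<Sum>j\<in>UNIV. \<Sum>b\<in>UNIV. vec_nth x a * vec_nth y b * ?\<gamma> j a b * multilinear_ext r (\<lambda>v. ?\<alpha> (j # v)))"
        by (intro sum.cong refl sum.swap)
      also have "\<dots> = (\<Sum>j\<in>UNIV. \<Sum>a\<in>UNIV. \<Sum>b\<in>UNIV. vec_nth x a * vec_nth y b * ?\<gamma> j a b * multilinear_ext r (\<lambda>v. ?\<alpha> (j # v)))"
        by (rule sum.swap)
      finally show ?thesis by (simp add: sum_distrib_right)
    qed
    have swap: "(\<Sum>a\<in>UNIV. \<Sum>b\<in>UNIV. vec_nth x a * vec_nth y b * ?\<gamma> j b a) =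
      (\<Sum>a\<in>UNIV. \<Sum>b\<in>UNIV. vec_nth y a * vec_nth x b * ?\<gamma> j a b)" for j
      by (subst sum.swap) (simp add: mult.commute)
    have "w (wedge (?br x y # r)) = multilinear_ext (?br x y # r) ?\<alpha>"
      using that by (intro lie_cochain_eq_multilinear_ext[OF w]) simp
    also have "\<dots> = (\<Sum>j\<in>UNIV. ((\<Sum>a\<in>UNIV. \<Sum>b\<in>UNIV. vec_nth x a * vec_nth y b * ?\<gamma> j a b) -
        (\<Sum>a\<in>UNIV. \<Sum>b\<in>UNIV. vec_nth y a * vec_nth x b * ?\<gamma> j a b)) * multilinear_ext r (\<lambda>v. ?\<alpha> (j # v)))"
      by (simp add: fgl_bracket_def right_diff_distrib sum_subtractf swap)
    finally show ?thesis by (simp add: F left_diff_distrib sum_subtractf)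
  qed
  have rhs: "(\<Sum>s<Suc n. \<Sum>r<s. (-1) ^ (r + s) * w (wedge (?br (xs ! r) (xs ! s) # nths xs (- {r, s})))) =
    multilinear_ext xs (ce_diff ?\<gamma> ?\<alpha>)" if len: "length xs = Suc n" for xs
  proof -
    have "(\<Sum>s<Suc n. \<Sum>r<s. (-1) ^ (r + s) * w (wedge (?br (xs ! r) (xs ! s) # nths xs (- {r, s})))) =
      (\<Sum>s<length xs. \<Sum>r<s. (-1) ^ (r + s) * (F (xs ! r) (xs ! s) (nths xs (- {r, s})) - F (xs ! s) (xs ! r) (nths xs (- {r, s}))))"
      unfolding len
    proof (intro sum.cong refl arg_cong2[where f = "(*)"] bracket)
      fix s r assume "s \<in> {..<Suc n}" "r \<in> {..<s}"
      then have "{i. i < length xs \<and> i \<in> - {r, s}} = {..<Suc n} - {r, s}" "card ({..<Suc n} - {r, s}) = Suc n - 2"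
        "1 \<le> n"
        by (auto simp: len card_Diff_subset)
      then show "Suc (length (nths xs (- {r, s}))) = n" by (simp add: length_nths)
    qed
    also have "\<dots> = - removal_sum2 xs F" by (rule sum_pairs_eq_removal_sum2)
    also have "\<dots> = multilinear_ext xs (ce_diff ?\<gamma> ?\<alpha>)"
      unfolding ce_diff_def multilinear_ext_minus multilinear_ext_removal_sum2 F_def ..
    finally show ?thesis .
  qed
  \<comment> \<open>By \<open>rhs\<close> both definite descriptions have the same
    predicate.\<close>
  have eq: "lie_diff ?br n w = lie_of (Suc n) (ce_diff ?\<gamma> ?\<alpha>)"
    unfolding lie_diff_def lie_of_def using rhs by (intro arg_cong[where f = The] ext) auto
  show "lie_diff ?br n w \<in> carrier (lie_cochains (Suc n))"
    unfolding eq by (rule lie_of(1)[OF alt])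
  show "lie_coords (Suc n) (lie_diff ?br n w) is = ce_diff ?\<gamma> ?\<alpha> is"
  proof (cases "length is = Suc n")
    case True then show ?thesis unfolding eq by (rule lie_of(2)[OF alt])
  next
    case False
    then have "ce_diff ?\<gamma> ?\<alpha> is = 0" by (intro ce_diff_length) (simp_all add: lie_coords_def)
    then show ?thesis using False by (simp add: lie_coords_def)
  qed
qed

lemma tilde_phi_cochain:
  fixes f :: "(nat \<times> 'm::finite, 'r::{idom, ring_char_0} fract) mfps"
  assumes f: "f \<in> carrier (group_cochains n)"
  shows "tilde_phi n f \<in> carrier (lie_cochains n)"
    and "lie_coords n (tilde_phi n f) is = antisymmetrize (\<lambda>is. cochain_fun n f (map unit_exp is)) is"
proof -
  let ?\<beta> = "antisymmetrize (\<lambda>is. cochain_fun n f (map unit_exp is))"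
  have \<beta>: "(\<Sum>p | p permutes {..<n}. of_int (sign p) *
           mfps_coeff (foldr (\<lambda>k. mfps_deriv (k, is ! p k)) [0..<n] f) 0) = to_fract (?\<beta> is)"
    if len: "length is = n" for "is"
  proof -
    have "mfps_coeff (foldr (\<lambda>k. mfps_deriv (k, is ! p k)) [0..<n] f) 0 =
      to_fract (cochain_fun n f (map unit_exp (map (\<lambda>k. is ! p k) [0..<n])))" for p
    proof -
      have "foldr (\<lambda>k. mfps_deriv (k, is ! p k)) [0..<n] f =
        foldr (\<lambda>k. mfps_deriv (k, map (\<lambda>k. is ! p k) [0..<n] ! k)) [0..<n] f"
        by (intro foldr_cong) auto
      then show ?thesis
        using list_coeff_units[of f "map (\<lambda>k. is ! p k) [0..<n]"] by (simp add: to_fract_cochain_fun[OF f])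
    qed
    moreover have "of_int z = to_fract (of_int z :: 'r)" for z
      by (cases z) simp_all
    ultimately show ?thesis
      unfolding antisymmetrize_eq_sum_permutations len by (simp add: lessThan_atLeast0)
  qed
  \<comment> \<open>Prescribing the values on wedges of basis vectors is equivalent to prescribing
    them on all wedges, so the two definite descriptions agree.\<close>
  have eq: "tilde_phi n f = lie_of n ?\<beta>"
  proof -
    have "(\<forall>is. length is = n \<longrightarrow> to_fract (w (wedge (map (\<lambda>i. axis i 1) is))) =
        (\<Sum>p | p permutes {..<n}. of_int (sign p) * mfps_coeff (foldr (\<lambda>k. mfps_deriv (k, is ! p k)) [0..<n] f) 0))
      \<longleftrightarrow> (\<forall>xs. length xs = n \<longrightarrow> w (wedge xs) = multilinear_ext xs ?\<beta>)" (is "?L \<longleftrightarrow> ?R")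
      if w: "w \<in> carrier (lie_cochains n)" for w :: "(('r ^ 'm) list \<Rightarrow>\<^sub>0 'r) set \<Rightarrow> 'r"
    proof
      assume ?L
      then have "lie_coords n w is = ?\<beta> is" if "length is = n" for "is"
        using that by (simp add: \<beta> lie_coords_def)
      then show ?R using lie_cochain_eq_multilinear_ext[OF w] by (auto intro!: multilinear_ext_cong)
    next
      assume R: ?R
      show ?L
      proof (intro allI impI)
        fix "is" :: "'m list" assume "length is = n"
        then show "to_fract (w (wedge (map (\<lambda>i. axis i 1) is))) =
          (\<Sum>p | p permutes {..<n}. of_int (sign p) * mfps_coeff (foldr (\<lambda>k. mfps_deriv (k, is ! p k)) [0..<n] f) 0)"
          using R by (simp add: \<beta>)
      qed
    qed
    then show ?thesis unfolding tilde_phi_def lie_of_def by (intro arg_cong[where f = The] ext) blast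
  qed
  show "tilde_phi n f \<in> carrier (lie_cochains n)"
    unfolding eq by (rule lie_of(1)[OF antisymmetrize_alternating])
  show "lie_coords n (tilde_phi n f) is = ?\<beta> is"
  proof (cases "length is = n")
    case True then show ?thesis unfolding eq by (rule lie_of(2)[OF antisymmetrize_alternating])
  next
    case False
    have "?\<beta> is = 0"
    proof (rule antisymmetrize_eq_0)
      fix v assume "mset v = mset is"
      from arg_cong[OF this, of size] False show "cochain_fun n f (map unit_exp v) = 0" by (simp add: cochain_fun_length)
    qed
    then show ?thesis using False by (simp add: lie_coords_def)
  qed
qed

section \<open>Cohomology of complexes of modules\<close>

text \<open>The scalars form a type rather than a ring record, so the laws of scalar multiplication
  that the quotients require are stated directly.\<close>

locale cochain_complex =
  fixes K :: "nat \<Rightarrow> ('r, 'c) module" and d :: "nat \<Rightarrow> 'c \<Rightarrow> 'c"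
  assumes abelian_group: "abelian_group (K n)"
    and smult_closed: "x \<in> carrier (K n) \<Longrightarrow> r \<odot>\<^bsub>K n\<^esub> x \<in> carrier (K n)"
    and smult_add: "x \<in> carrier (K n) \<Longrightarrow> y \<in> carrier (K n) \<Longrightarrow>
      r \<odot>\<^bsub>K n\<^esub> (x \<oplus>\<^bsub>K n\<^esub> y) = r \<odot>\<^bsub>K n\<^esub> x \<oplus>\<^bsub>K n\<^esub> r \<odot>\<^bsub>K n\<^esub> y"
    and d_closed: "x \<in> carrier (K n) \<Longrightarrow> d n x \<in> carrier (K (Suc n))"
    and d_add: "x \<in> carrier (K n) \<Longrightarrow> y \<in> carrier (K n) \<Longrightarrow> d n (x \<oplus>\<^bsub>K n\<^esub> y) = d n x \<oplus>\<^bsub>K (Suc n)\<^esub> d n y"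
    and d_smult: "x \<in> carrier (K n) \<Longrightarrow> d n (r \<odot>\<^bsub>K n\<^esub> x) = r \<odot>\<^bsub>K (Suc n)\<^esub> d n x"
    and d_d: "x \<in> carrier (K n) \<Longrightarrow> d (Suc n) (d n x) = \<zero>\<^bsub>K (Suc (Suc n))\<^esub>"
begin

lemma zero_of_double:
  assumes "x \<in> carrier (K n)" "x \<oplus>\<^bsub>K n\<^esub> x = x"
  shows "x = \<zero>\<^bsub>K n\<^esub>"
proof -
  interpret abelian_group "K n" by (rule abelian_group)
  show ?thesis using assms add.l_cancel_one[of x x] by simp
qed

lemma zero_closed: "\<zero>\<^bsub>K n\<^esub> \<in> carrier (K n)"
  using abelian_groupE(2)[OF abelian_group] .

lemma smult_zero: "r \<odot>\<^bsub>K n\<^esub> \<zero>\<^bsub>K n\<^esub> = \<zero>\<^bsub>K n\<^esub>"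
proof (rule zero_of_double)
  interpret abelian_group "K n" by (rule abelian_group)
  show "r \<odot>\<^bsub>K n\<^esub> \<zero>\<^bsub>K n\<^esub> \<in> carrier (K n)" by (simp add: smult_closed)
  show "r \<odot>\<^bsub>K n\<^esub> \<zero>\<^bsub>K n\<^esub> \<oplus>\<^bsub>K n\<^esub> r \<odot>\<^bsub>K n\<^esub> \<zero>\<^bsub>K n\<^esub> = r \<odot>\<^bsub>K n\<^esub> \<zero>\<^bsub>K n\<^esub>"
    by (simp flip: smult_add)
qed

lemma d_zero: "d n \<zero>\<^bsub>K n\<^esub> = \<zero>\<^bsub>K (Suc n)\<^esub>"
proof (rule zero_of_double)
  interpret abelian_group "K n" by (rule abelian_group)
  show "d n \<zero>\<^bsub>K n\<^esub> \<in> carrier (K (Suc n))" by (simp add: d_closed)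
  show "d n \<zero>\<^bsub>K n\<^esub> \<oplus>\<^bsub>K (Suc n)\<^esub> d n \<zero>\<^bsub>K n\<^esub> = d n \<zero>\<^bsub>K n\<^esub>"
    by (simp flip: d_add)
qed

lemma cocyclesD: "x \<in> cocycles K d n \<Longrightarrow> x \<in> carrier (K n)" "x \<in> cocycles K d n \<Longrightarrow> d n x = \<zero>\<^bsub>K (Suc n)\<^esub>"
  by (simp_all add: cocycles_def)

lemma d_eq_0_of_add:
  assumes "y \<in> carrier (K n)" "x \<in> cocycles K d n" "y \<oplus>\<^bsub>K n\<^esub> x \<in> cocycles K d n"
  shows "y \<in> cocycles K d n"
proof -
  interpret L: abelian_group "K (Suc n)" by (rule abelian_group)
  have "d n y \<oplus>\<^bsub>K (Suc n)\<^esub> d n x = \<zero>\<^bsub>K (Suc n)\<^esub>"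
    using d_add[of y n x] cocyclesD(1)[OF assms(2)] cocyclesD(2)[OF assms(3)] assms(1) by simp
  then show ?thesis using assms cocyclesD(2)[OF assms(2)] by (simp add: cocycles_def d_closed)
qed

lemma abelian_group_cocycles: "abelian_group ((K n)\<lparr>carrier := cocycles K d n\<rparr>)"
proof -
  interpret M: abelian_group "K n" by (rule abelian_group)
  interpret N: abelian_group "K (Suc n)" by (rule abelian_group)
  have closed: "x \<oplus>\<^bsub>K n\<^esub> y \<in> cocycles K d n" if "x \<in> cocycles K d n" "y \<in> cocycles K d n" for x y
    using that by (simp add: cocycles_def d_add)
  have zero: "\<zero>\<^bsub>K n\<^esub> \<in> cocycles K d n" by (simp add: cocycles_def d_zero)
  have inv: "\<exists>y\<in>cocycles K d n. y \<oplus>\<^bsub>K n\<^esub> x = \<zero>\<^bsub>K n\<^esub>" if x: "x \<in> cocycles K d n" for x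
  proof
    show eq: "\<ominus>\<^bsub>K n\<^esub> x \<oplus>\<^bsub>K n\<^esub> x = \<zero>\<^bsub>K n\<^esub>" using cocyclesD(1)[OF x] by (rule M.l_neg)
    show "\<ominus>\<^bsub>K n\<^esub> x \<in> cocycles K d n"
      using zero unfolding eq[symmetric] by (rule d_eq_0_of_add[OF M.a_inv_closed[OF cocyclesD(1)[OF x]] x])
  qed
  show ?thesis
  proof (rule abelian_groupI)
    let ?Z = "(K n)\<lparr>carrier := cocycles K d n\<rparr>"
    fix x assume x: "x \<in> carrier ?Z"
    then have xc: "x \<in> carrier (K n)" by (simp add: cocycles_def)
    show "\<zero>\<^bsub>?Z\<^esub> \<oplus>\<^bsub>?Z\<^esub> x = x" using xc by simp
    show "\<exists>y\<in>carrier ?Z. y \<oplus>\<^bsub>?Z\<^esub> x = \<zero>\<^bsub>?Z\<^esub>" using inv[of x] x by simp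
    fix y assume y: "y \<in> carrier ?Z"
    then have yc: "y \<in> carrier (K n)" by (simp add: cocycles_def)
    show "x \<oplus>\<^bsub>?Z\<^esub> y \<in> carrier ?Z" using closed[of x y] x y by simp
    show "x \<oplus>\<^bsub>?Z\<^esub> y = y \<oplus>\<^bsub>?Z\<^esub> x" using M.a_comm[OF xc yc] by simp
    fix z assume "z \<in> carrier ?Z"
    then have zc: "z \<in> carrier (K n)" by (simp add: cocycles_def)
    show "x \<oplus>\<^bsub>?Z\<^esub> y \<oplus>\<^bsub>?Z\<^esub> z = x \<oplus>\<^bsub>?Z\<^esub> (y \<oplus>\<^bsub>?Z\<^esub> z)" using M.a_assoc[OF xc yc zc] by simp
  qed (simp add: zero)
qed

lemma abelian_subgroup_coboundaries:
  "abelian_subgroup (coboundaries K d n) ((K n)\<lparr>carrier := cocycles K d n\<rparr>)"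
proof -
  let ?Z = "(K n)\<lparr>carrier := cocycles K d n\<rparr>" and ?B = "coboundaries K d n"
  interpret M: abelian_group "K n" by (rule abelian_group)
  interpret Z: abelian_group ?Z by (rule abelian_group_cocycles)
  have sub: "?B \<subseteq> cocycles K d n"
    by (auto simp: coboundaries_def cocycles_def d_zero d_closed d_d zero_closed split: nat.splits)
  have zero: "\<zero>\<^bsub>K n\<^esub> \<in> ?B"
  proof (cases n)
    case (Suc k)
    interpret N: abelian_group "K k" by (rule abelian_group)
    show ?thesis using d_zero[of k] by (auto simp: Suc coboundaries_def intro!: image_eqI[of _ _ "\<zero>\<^bsub>K k\<^esub>"])
  qed (simp add: coboundaries_def)
  have closed: "x \<oplus>\<^bsub>K n\<^esub> y \<in> ?B" if "x \<in> ?B" "y \<in> ?B" for x y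
  proof (cases n)
    case (Suc k)
    interpret N: abelian_group "K k" by (rule abelian_group)
    obtain u where "u \<in> carrier (K k)" "x = d k u" using \<open>x \<in> ?B\<close> by (auto simp: Suc coboundaries_def)
    moreover obtain v where "v \<in> carrier (K k)" "y = d k v" using \<open>y \<in> ?B\<close> by (auto simp: Suc coboundaries_def)
    ultimately show ?thesis by (auto simp: Suc coboundaries_def d_add intro!: image_eqI[of _ _ "u \<oplus>\<^bsub>K k\<^esub> v"])
  next
    case 0
    then have "x = \<zero>\<^bsub>K n\<^esub>" "y = \<zero>\<^bsub>K n\<^esub>" using that by (simp_all add: coboundaries_def)
    then show ?thesis using zero by simp
  qed
  have inv: "\<ominus>\<^bsub>?Z\<^esub> x \<in> ?B" if x: "x \<in> ?B" for x
  proof -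
    have "\<exists>y\<in>?B. y \<oplus>\<^bsub>K n\<^esub> x = \<zero>\<^bsub>K n\<^esub>"
    proof (cases n)
      case 0
      then have "x = \<zero>\<^bsub>K n\<^esub>" using x by (simp add: coboundaries_def)
      then show ?thesis using zero by (intro bexI[of _ "\<zero>\<^bsub>K n\<^esub>"]) simp_all
    next
      case (Suc k)
      interpret N: abelian_group "K k" by (rule abelian_group)
      obtain u where u: "u \<in> carrier (K k)" "x = d k u" using x by (auto simp: Suc coboundaries_def)
      have "d k (\<ominus>\<^bsub>K k\<^esub> u) \<oplus>\<^bsub>K n\<^esub> d k u = d k (\<ominus>\<^bsub>K k\<^esub> u \<oplus>\<^bsub>K k\<^esub> u)"
        unfolding Suc using u(1) by (intro d_add[symmetric]) simp_all
      also have "\<dots> = \<zero>\<^bsub>K n\<^esub>" using u(1) d_zero[of k] by (simp add: N.l_neg Suc)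
      finally show ?thesis using u by (auto simp: Suc coboundaries_def)
    qed
    then obtain y where y: "y \<in> ?B" "y \<oplus>\<^bsub>K n\<^esub> x = \<zero>\<^bsub>K n\<^esub>" by blast
    then have "\<ominus>\<^bsub>?Z\<^esub> x = y" using sub x by (intro Z.minus_equality) auto
    then show ?thesis using y by simp
  qed
  have "subgroup ?B (add_monoid ?Z)"
    using sub zero closed inv by (intro subgroup.intro) (auto simp: a_inv_def)
  then show ?thesis
    by (intro abelian_subgroupI3 Z.abelian_group_axioms additive_subgroupI)
qed

text \<open>Cosets do not depend on the carrier, so they may be formed in the group of cocycles, in
  which the coboundaries are a subgroup.\<close>

lemma cohomology_class_cocycles:
  "cohomology_class K d n f = coboundaries K d n +>\<^bsub>(K n)\<lparr>carrier := cocycles K d n\<rparr>\<^esub> f"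
  by (simp add: cohomology_class_def a_r_coset_def r_coset_def)

lemma cohomology_class_eq: "cohomology_class K d n f = {b \<oplus>\<^bsub>K n\<^esub> f | b. b \<in> coboundaries K d n}"
  by (auto simp: cohomology_class_def a_r_coset_def r_coset_def)

lemma cohomology_class_eq_iff:
  assumes "x \<in> cocycles K d n" "y \<in> cocycles K d n"
  shows "cohomology_class K d n x = cohomology_class K d n y \<longleftrightarrow> (\<exists>b\<in>coboundaries K d n. x = b \<oplus>\<^bsub>K n\<^esub> y)"
proof -
  interpret abelian_subgroup "coboundaries K d n" "(K n)\<lparr>carrier := cocycles K d n\<rparr>"
    by (rule abelian_subgroup_coboundaries)
  show ?thesis
  proof
    assume "cohomology_class K d n x = cohomology_class K d n y"
    moreover have "x \<in> cohomology_class K d n x"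
      using a_rcos_self[of x] assms(1) by (simp add: cohomology_class_cocycles)
    ultimately show "\<exists>b\<in>coboundaries K d n. x = b \<oplus>\<^bsub>K n\<^esub> y" by (auto simp: cohomology_class_eq)
  next
    assume "\<exists>b\<in>coboundaries K d n. x = b \<oplus>\<^bsub>K n\<^esub> y"
    then have "x \<in> cohomology_class K d n y" by (auto simp: cohomology_class_eq)
    then show "cohomology_class K d n x = cohomology_class K d n y"
      using a_repr_independence'[of x y] assms(2) by (simp add: cohomology_class_cocycles)
  qed
qed

lemma smult_cocycles: "x \<in> cocycles K d n \<Longrightarrow> r \<odot>\<^bsub>K n\<^esub> x \<in> cocycles K d n"
  by (simp add: cocycles_def smult_closed d_smult smult_zero)

lemma smult_coboundaries: "x \<in> coboundaries K d n \<Longrightarrow> r \<odot>\<^bsub>K n\<^esub> x \<in> coboundaries K d n"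
  by (auto simp: coboundaries_def smult_zero d_smult[symmetric] smult_closed split: nat.splits)

lemma add_cocycles: "x \<in> cocycles K d n \<Longrightarrow> y \<in> cocycles K d n \<Longrightarrow> x \<oplus>\<^bsub>K n\<^esub> y \<in> cocycles K d n"
  using abelian_groupE(1)[OF abelian_group_cocycles] by simp

lemma coboundaries_subset: "coboundaries K d n \<subseteq> cocycles K d n"
proof -
  interpret abelian_subgroup "coboundaries K d n" "(K n)\<lparr>carrier := cocycles K d n\<rparr>"
    by (rule abelian_subgroup_coboundaries)
  show ?thesis using a_subset by simp
qed

lemma cohomology_simps:
  shows "carrier (cohomology K d n) = cohomology_class K d n ` cocycles K d n"
    and "x \<in> cocycles K d n \<Longrightarrow> y \<in> cocycles K d n \<Longrightarrow>
      cohomology_class K d n x \<oplus>\<^bsub>cohomology K d n\<^esub> cohomology_class K d n y = cohomology_class K d n (x \<oplus>\<^bsub>K n\<^esub> y)"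
    and "x \<in> cocycles K d n \<Longrightarrow>
      r \<odot>\<^bsub>cohomology K d n\<^esub> cohomology_class K d n x = cohomology_class K d n (r \<odot>\<^bsub>K n\<^esub> x)"
proof -
  let ?Z = "(K n)\<lparr>carrier := cocycles K d n\<rparr>" and ?B = "coboundaries K d n"
  interpret abelian_subgroup ?B ?Z by (rule abelian_subgroup_coboundaries)
  interpret M: abelian_group "K n" by (rule abelian_group)
  show "carrier (cohomology K d n) = cohomology_class K d n ` cocycles K d n"
    by (auto simp: cohomology_def quotient_module_def cohomology_class_def A_RCOSETS_def RCOSETS_def
        a_r_coset_def r_coset_def)
  show "cohomology_class K d n x \<oplus>\<^bsub>cohomology K d n\<^esub> cohomology_class K d n y = cohomology_class K d n (x \<oplus>\<^bsub>K n\<^esub> y)"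
    if "x \<in> cocycles K d n" "y \<in> cocycles K d n"
    using a_rcos_sum[of x y] that
    by (simp add: cohomology_def quotient_module_def cohomology_class_cocycles)
  show "r \<odot>\<^bsub>cohomology K d n\<^esub> cohomology_class K d n x = cohomology_class K d n (r \<odot>\<^bsub>K n\<^esub> x)"
    if x: "x \<in> cocycles K d n"
  proof -
    have "cohomology_class K d n (r \<odot>\<^bsub>K n\<^esub> y) = cohomology_class K d n (r \<odot>\<^bsub>K n\<^esub> x)"
      if "y \<in> cohomology_class K d n x" for y
    proof -
      obtain b where b: "b \<in> ?B" "y = b \<oplus>\<^bsub>K n\<^esub> x" using \<open>y \<in> _\<close> by (auto simp: cohomology_class_eq)
      then have "b \<in> cocycles K d n" using coboundaries_subset by blast
      then have "r \<odot>\<^bsub>K n\<^esub> y = r \<odot>\<^bsub>K n\<^esub> b \<oplus>\<^bsub>K n\<^esub> r \<odot>\<^bsub>K n\<^esub> x" "y \<in> cocycles K d n"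
        using x cocyclesD(1) by (auto simp: b(2) smult_add add_cocycles)
      then show ?thesis
        using cohomology_class_eq_iff[of "r \<odot>\<^bsub>K n\<^esub> y" n "r \<odot>\<^bsub>K n\<^esub> x"] b(1) x smult_coboundaries smult_cocycles
        by blast
    qed
    moreover have "x \<in> cohomology_class K d n x"
      using a_rcos_self[of x] x by (simp add: cohomology_class_cocycles)
    ultimately have "(\<Union>y\<in>cohomology_class K d n x. cohomology_class K d n (r \<odot>\<^bsub>K n\<^esub> y)) =
        cohomology_class K d n (r \<odot>\<^bsub>K n\<^esub> x)" by blast
    then show ?thesis
      by (simp add: cohomology_def quotient_module_def cohomology_class_cocycles)
  qed
qed

end

text \<open>One direction of \<open>coboundary\<close> makes the map on classes well defined, the
  other makes it injective. The lifts in \<open>surj\<close> are exact, not merely up to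
  coboundaries.\<close>

lemma ex_module_iso_cohomology:
  assumes K: "cochain_complex K d" and L: "cochain_complex L e"
    and \<phi>: "\<And>x. x \<in> cocycles K d n \<Longrightarrow> \<phi> x \<in> cocycles L e n"
    and add: "\<And>x y. x \<in> cocycles K d n \<Longrightarrow> y \<in> cocycles K d n \<Longrightarrow> \<phi> (x \<oplus>\<^bsub>K n\<^esub> y) = \<phi> x \<oplus>\<^bsub>L n\<^esub> \<phi> y"
    and smult: "\<And>r x. x \<in> cocycles K d n \<Longrightarrow> \<phi> (r \<odot>\<^bsub>K n\<^esub> x) = r \<odot>\<^bsub>L n\<^esub> \<phi> x"
    and coboundary: "\<And>x. x \<in> cocycles K d n \<Longrightarrow> \<phi> x \<in> coboundaries L e n \<longleftrightarrow> x \<in> coboundaries K d n"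
    and surj: "\<And>y. y \<in> cocycles L e n \<Longrightarrow> \<exists>x\<in>cocycles K d n. \<phi> x = y"
  shows "\<exists>\<Phi>. module_iso (cohomology K d n) (cohomology L e n) \<Phi> \<and>
    (\<forall>x\<in>cocycles K d n. \<Phi> (cohomology_class K d n x) = cohomology_class L e n (\<phi> x))"
proof -
  interpret K: cochain_complex K d by (rule K)
  interpret L: cochain_complex L e by (rule L)
  let ?c = "cohomology_class K d n" and ?c' = "cohomology_class L e n" and ?Z = "cocycles K d n"
  interpret Z: abelian_group "(K n)\<lparr>carrier := ?Z\<rparr>" by (rule K.abelian_group_cocycles)
  interpret M: abelian_group "L n" by (rule L.abelian_group)
  have class_iff: "?c x = ?c y \<longleftrightarrow> ?c' (\<phi> x) = ?c' (\<phi> y)" if x: "x \<in> ?Z" and y: "y \<in> ?Z" for x y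
  proof
    assume "?c x = ?c y"
    then obtain b where b: "b \<in> coboundaries K d n" "x = b \<oplus>\<^bsub>K n\<^esub> y"
      using K.cohomology_class_eq_iff[OF x y] by blast
    then have "b \<in> ?Z" using K.coboundaries_subset by blast
    then have "\<phi> x = \<phi> b \<oplus>\<^bsub>L n\<^esub> \<phi> y" "\<phi> b \<in> coboundaries L e n" using add y b coboundary by auto
    then show "?c' (\<phi> x) = ?c' (\<phi> y)" using L.cohomology_class_eq_iff[OF \<phi>[OF x] \<phi>[OF y]] by blast
  next
    assume "?c' (\<phi> x) = ?c' (\<phi> y)"
    then obtain b where b: "b \<in> coboundaries L e n" "\<phi> x = b \<oplus>\<^bsub>L n\<^esub> \<phi> y"
      using L.cohomology_class_eq_iff[OF \<phi>[OF x] \<phi>[OF y]] by blast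
    \<comment> \<open>The difference of \<open>x\<close> and \<open>y\<close>, formed in the group
      of cocycles.\<close>
    obtain z where z: "z \<in> ?Z" "x = z \<oplus>\<^bsub>K n\<^esub> y"
    proof
      let ?m = "a_inv ((K n)\<lparr>carrier := ?Z\<rparr>) y"
      have m: "?m \<in> ?Z" "?m \<oplus>\<^bsub>K n\<^esub> y = \<zero>\<^bsub>K n\<^esub>" using Z.a_inv_closed[of y] Z.l_neg[of y] y by simp_all
      show "x \<oplus>\<^bsub>K n\<^esub> ?m \<in> ?Z" using x m by (intro K.add_cocycles)
      show "x = (x \<oplus>\<^bsub>K n\<^esub> ?m) \<oplus>\<^bsub>K n\<^esub> y"
        using Z.a_assoc[of x ?m y] Z.r_zero[of x] m x y by simp
    qed
    have "\<phi> z \<oplus>\<^bsub>L n\<^esub> \<phi> y = b \<oplus>\<^bsub>L n\<^esub> \<phi> y" using b z add y by simp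
    moreover have "\<phi> z \<in> carrier (L n)" "b \<in> carrier (L n)" "\<phi> y \<in> carrier (L n)"
      using \<phi> z y b L.cocyclesD(1) L.coboundaries_subset by blast+
    ultimately have "\<phi> z = b" using M.add.right_cancel[of "\<phi> y" "\<phi> z" b] by blast
    then have "z \<in> coboundaries K d n" using b coboundary z by blast
    then show "?c x = ?c y" using K.cohomology_class_eq_iff[OF x y] z by blast
  qed
  define \<Phi> where "\<Phi> C = ?c' (\<phi> (SOME x. x \<in> ?Z \<and> ?c x = C))" for C
  have \<Phi>: "\<Phi> (?c x) = ?c' (\<phi> x)" if x: "x \<in> ?Z" for x
  proof -
    have "\<exists>y. y \<in> ?Z \<and> ?c y = ?c x" using x by blast
    from someI_ex[OF this] show ?thesis unfolding \<Phi>_def using class_iff[of _ x] x by blast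
  qed
  have "module_iso (cohomology K d n) (cohomology L e n) \<Phi>"
    unfolding module_iso_def K.cohomology_simps(1) L.cohomology_simps(1)
  proof (intro conjI ballI allI)
    show "bij_betw \<Phi> (?c ` ?Z) (?c' ` cocycles L e n)"
    proof (rule bij_betw_imageI)
      show "inj_on \<Phi> (?c ` ?Z)" by (rule inj_onI, elim imageE) (simp add: \<Phi> class_iff)
      show "\<Phi> ` ?c ` ?Z = ?c' ` cocycles L e n"
        using surj \<phi> by (fastforce simp: image_image \<Phi>)
    qed
    fix C r assume "C \<in> ?c ` ?Z"
    then obtain x where x: "x \<in> ?Z" "C = ?c x" by blast
    show "\<Phi> (r \<odot>\<^bsub>cohomology K d n\<^esub> C) = r \<odot>\<^bsub>cohomology L e n\<^esub> \<Phi> C"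
      using x \<phi> by (simp add: K.cohomology_simps(3) L.cohomology_simps(3) \<Phi> K.smult_cocycles smult)
    fix C' assume "C' \<in> ?c ` ?Z"
    then obtain y where y: "y \<in> ?Z" "C' = ?c y" by blast
    show "\<Phi> (C \<oplus>\<^bsub>cohomology K d n\<^esub> C') = \<Phi> C \<oplus>\<^bsub>cohomology L e n\<^esub> \<Phi> C'"
      using x y \<phi> by (simp add: K.cohomology_simps(2) L.cohomology_simps(2) \<Phi> K.add_cocycles add)
  qed
  then show ?thesis using \<Phi> by blast
qed

section \<open>The complexes of group and Lie algebra cochains\<close>

lemma cochain_complex_group:
  fixes G :: "'m::finite \<Rightarrow> ('m + 'm, 'r::{idom, ring_char_0}) mfps"
  assumes G: "formal_group_law G"
  shows "cochain_complex group_cochains (group_diff G)"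
proof -
  interpret structure_constants "fgl_mu G" by (rule structure_constants_fgl_mu[OF G])
  note closed = group_cochains_closed and diff = group_diff_cochain[OF G]
  show ?thesis
  proof (rule cochain_complex.intro)
    fix n
    show "abelian_group (group_cochains n :: ('r, (nat \<times> 'm, 'r fract) mfps) module)"
    proof (rule abelian_groupI)
      fix f assume f: "f \<in> carrier (group_cochains n :: ('r, (nat \<times> 'm, 'r fract) mfps) module)"
      have "mfps_const (to_fract (-1)) * f + f = 0"
        by (rule mfps_eqI) (simp del: to_fract_uminus, simp)
      then show "\<exists>g\<in>carrier (group_cochains n). g \<oplus>\<^bsub>group_cochains n\<^esub> f = \<zero>\<^bsub>group_cochains n\<^esub>"
        using closed(3)[OF f, of "-1"] by auto
    qed (simp_all add: closed add.assoc add.commute)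
  next
    fix n r and f g :: "(nat \<times> 'm, 'r fract) mfps"
    assume f: "f \<in> carrier (group_cochains n)"
    show "r \<odot>\<^bsub>group_cochains n\<^esub> f \<in> carrier (group_cochains n)" by (simp add: closed f)
    show "group_diff G n f \<in> carrier (group_cochains (Suc n))" by (rule diff(1)[OF f])
    show "group_diff G n (r \<odot>\<^bsub>group_cochains n\<^esub> f) = r \<odot>\<^bsub>group_cochains (Suc n)\<^esub> group_diff G n f"
      by (rule cochain_fun_inject[of _ "Suc n"])
        (simp_all add: f closed diff cochain_fun_scale cochain_fun_scale[OF f, abs_def] diff_scale)
    \<comment> \<open>On lists of exponents the claim becomes \<open>diff_diff\<close> for the bar
      complex.\<close>
    show "group_diff G (Suc n) (group_diff G n f) = \<zero>\<^bsub>group_cochains (Suc (Suc n))\<^esub>"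
    proof (rule cochain_fun_inject[of _ "Suc (Suc n)"])
      fix w :: "('m \<Rightarrow>\<^sub>0 nat) list"
      have "cochain_fun (Suc (Suc n)) (group_diff G (Suc n) (group_diff G n f)) w = 0"
        unfolding diff(2)[OF diff(1)[OF f]] diff(2)[OF f, abs_def] by (rule diff_diff)
      moreover have "cochain_fun (Suc (Suc n)) (0 :: (nat \<times> 'm, 'r fract) mfps) w = 0"
        using cochain_fun_scale[OF closed(1), of "Suc (Suc n)" 0 w] by (simp add: mfps_eqI)
      ultimately show "cochain_fun (Suc (Suc n)) (group_diff G (Suc n) (group_diff G n f)) w =
        cochain_fun (Suc (Suc n)) \<zero>\<^bsub>group_cochains (Suc (Suc n))\<^esub> w" by simp
    qed (simp_all add: diff f closed)
    assume g: "g \<in> carrier (group_cochains n)"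
    show "r \<odot>\<^bsub>group_cochains n\<^esub> (f \<oplus>\<^bsub>group_cochains n\<^esub> g) =
      r \<odot>\<^bsub>group_cochains n\<^esub> f \<oplus>\<^bsub>group_cochains n\<^esub> r \<odot>\<^bsub>group_cochains n\<^esub> g"
      by (simp add: distrib_left)
    show "group_diff G n (f \<oplus>\<^bsub>group_cochains n\<^esub> g) = group_diff G n f \<oplus>\<^bsub>group_cochains (Suc n)\<^esub> group_diff G n g"
      by (rule cochain_fun_inject[of _ "Suc n"])
        (simp_all add: f g closed diff cochain_fun_add cochain_fun_add[OF f g, abs_def] diff_add)
  qed
qed

lemma abelian_group_dual_module:
  assumes "\<And>x y. x \<in> carrier M \<Longrightarrow> y \<in> carrier M \<Longrightarrow> x \<oplus>\<^bsub>M\<^esub> y \<in> carrier M"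
    "\<And>r x. x \<in> carrier M \<Longrightarrow> r \<odot>\<^bsub>M\<^esub> x \<in> carrier M"
  shows "abelian_group (dual_module M)"
proof (rule abelian_groupI)
  fix w assume "w \<in> carrier (dual_module M)"
  then show "\<exists>v\<in>carrier (dual_module M). v \<oplus>\<^bsub>dual_module M\<^esub> w = \<zero>\<^bsub>dual_module M\<^esub>"
    by (intro bexI[of _ "\<lambda>x\<in>carrier M. - w x"]) (auto simp: dual_module_def assms fun_eq_iff)
qed (auto simp: dual_module_def assms fun_eq_iff algebra_simps extensional_def)

lemma wedge_carrier: "length xs = n \<Longrightarrow> wedge xs \<in> carrier (exterior_power n)"
  by (auto simp: wedge_def exterior_power_simps(1) intro!: imageI)

lemma exterior_power_closed:
  "x \<in> carrier (exterior_power n) \<Longrightarrow> y \<in> carrier (exterior_power n) \<Longrightarrow> x \<oplus>\<^bsub>exterior_power n\<^esub> y \<in> carrier (exterior_power n)"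
  "x \<in> carrier (exterior_power n) \<Longrightarrow> r \<odot>\<^bsub>exterior_power n\<^esub> x \<in> carrier (exterior_power n)"
  for x y :: "(('r::comm_ring_1 ^ 'm::finite) list \<Rightarrow>\<^sub>0 'r) set"
proof -
  interpret abelian_group "free_tuples n :: ('r, ('r ^ 'm) list \<Rightarrow>\<^sub>0 'r) module" by (rule abelian_group_free_tuples)
  show "x \<oplus>\<^bsub>exterior_power n\<^esub> y \<in> carrier (exterior_power n)"
    if x: "x \<in> carrier (exterior_power n)" and y: "y \<in> carrier (exterior_power n)"
  proof -
    obtain p where p: "x = wedge_relations n +>\<^bsub>free_tuples n\<^esub> p" "p \<in> carrier (free_tuples n)"
      using x unfolding exterior_power_simps(1) by (rule imageE)
    obtain q where q: "y = wedge_relations n +>\<^bsub>free_tuples n\<^esub> q" "q \<in> carrier (free_tuples n)"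
      using y unfolding exterior_power_simps(1) by (rule imageE)
    note pq = p(2) q(2) p(1) q(1)
    have "p + q \<in> carrier (free_tuples n)" using a_closed[OF pq(1,2)] by simp
    then show ?thesis unfolding pq(3,4) exterior_power_simps(2)[OF pq(1,2)] exterior_power_simps(1) by (rule imageI)
  qed
  show "r \<odot>\<^bsub>exterior_power n\<^esub> x \<in> carrier (exterior_power n)" if x: "x \<in> carrier (exterior_power n)"
  proof -
    obtain p where p: "x = wedge_relations n +>\<^bsub>free_tuples n\<^esub> p" "p \<in> carrier (free_tuples n)"
      using x unfolding exterior_power_simps(1) by (rule imageE)
    have "keys (Poly_Mapping.map ((*) r) p) \<subseteq> keys p" by (auto simp: in_keys_iff)
    then have "Poly_Mapping.map ((*) r) p \<in> carrier (free_tuples n)" using p(2) by auto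
    then show ?thesis unfolding p(1) exterior_power_simps(3) exterior_power_simps(1) by (rule imageI)
  qed
qed

lemma abelian_group_lie_cochains: "abelian_group (lie_cochains n)"
  unfolding lie_cochains_def by (intro abelian_group_dual_module exterior_power_closed)

lemma lie_cochains_smult_closed:
  "w \<in> carrier (lie_cochains n) \<Longrightarrow> r \<odot>\<^bsub>lie_cochains n\<^esub> w \<in> carrier (lie_cochains n)"
  by (auto simp: lie_cochains_def dual_module_def exterior_power_closed algebra_simps)

lemma lie_coords_simps:
  "lie_coords n (w \<oplus>\<^bsub>lie_cochains n\<^esub> v) is = lie_coords n w is + lie_coords n v is"
  "lie_coords n (r \<odot>\<^bsub>lie_cochains n\<^esub> w) is = r * lie_coords n w is"
  "lie_coords n \<zero>\<^bsub>lie_cochains n\<^esub> is = 0"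
  by (cases "length is = n", simp_all add: lie_coords_def lie_cochains_def dual_module_def wedge_carrier)+

lemma ce_diff_add: "ce_diff \<gamma> (\<lambda>is. \<alpha> is + \<beta> is) w = ce_diff \<gamma> \<alpha> w + ce_diff \<gamma> \<beta> w"
  by (simp add: ce_diff_def distrib_left sum.distrib removal_sum2_add)

lemma ce_diff_scale: "ce_diff \<gamma> (\<lambda>is. r * \<alpha> is) w = r * ce_diff \<gamma> \<alpha> w"
proof -
  have "(\<Sum>j\<in>UNIV. \<gamma> j a b * (r * \<alpha> (j # u))) = r * (\<Sum>j\<in>UNIV. \<gamma> j a b * \<alpha> (j # u))" for a b u
    by (simp add: sum_distrib_left mult.left_commute)
  then show ?thesis by (simp add: ce_diff_def removal_sum2_def removal_sum_scale)
qed

text \<open>The square vanishes because that of \<open>diff\<close> does. The Jacobi identity is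
  contained in the associativity of the algebra and is not verified separately.\<close>

lemma (in structure_constants) ce_diff_ce_diff:
  assumes "alternating \<alpha>"
  shows "ce_diff gamma (ce_diff gamma \<alpha>) w = 0"
proof -
  have "ce_diff gamma \<alpha> = tangent (diff (critical_extension \<alpha>))"
    using tangent_critical_extension[OF assms] by (auto simp: tangent_diff)
  then have "ce_diff gamma (ce_diff gamma \<alpha>) w = tangent (diff (diff (critical_extension \<alpha>))) w"
    by (simp add: tangent_diff)
  then show ?thesis by (simp add: diff_diff)
qed

lemma cochain_complex_lie:
  fixes G :: "'m::finite \<Rightarrow> ('m + 'm, 'r::{idom, ring_char_0}) mfps"
  assumes G: "formal_group_law G"
  shows "cochain_complex lie_cochains (lie_diff (fgl_bracket G))"
proof -
  interpret structure_constants "fgl_mu G" by (rule structure_constants_fgl_mu[OF G])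
  have gamma: "gamma = fgl_gamma G" by (intro ext) (rule fgl_mu_unit[OF G])
  note ld = lie_diff_cochain[OF G] and sc = lie_cochains_smult_closed
    and ac = abelian_groupE(1)[OF abelian_group_lie_cochains]
    and zc = abelian_groupE(2)[OF abelian_group_lie_cochains]
  show ?thesis
  proof (rule cochain_complex.intro)
    fix n r and w v :: "(('r ^ 'm) list \<Rightarrow>\<^sub>0 'r) set \<Rightarrow> 'r"
    show "abelian_group (lie_cochains n :: ('r, (('r ^ 'm) list \<Rightarrow>\<^sub>0 'r) set \<Rightarrow> 'r) module)"
      by (rule abelian_group_lie_cochains)
    assume w: "w \<in> carrier (lie_cochains n)"
    show "r \<odot>\<^bsub>lie_cochains n\<^esub> w \<in> carrier (lie_cochains n)" by (rule sc[OF w])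
    show "lie_diff (fgl_bracket G) n w \<in> carrier (lie_cochains (Suc n))" by (rule ld(1)[OF w])
    show "lie_diff (fgl_bracket G) n (r \<odot>\<^bsub>lie_cochains n\<^esub> w) = r \<odot>\<^bsub>lie_cochains (Suc n)\<^esub> lie_diff (fgl_bracket G) n w"
      by (intro lie_coords_inject[of _ "Suc n"] ld(1) sc w)
        (simp add: ld w sc lie_coords_simps lie_coords_simps(2)[abs_def] ce_diff_scale)
    show "lie_diff (fgl_bracket G) (Suc n) (lie_diff (fgl_bracket G) n w) = \<zero>\<^bsub>lie_cochains (Suc (Suc n))\<^esub>"
    proof (intro lie_coords_inject[of _ "Suc (Suc n)"] ld(1) w zc)
      fix "is" :: "'m list"
      have "lie_coords (Suc (Suc n)) (lie_diff (fgl_bracket G) (Suc n) (lie_diff (fgl_bracket G) n w)) is =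
        ce_diff (fgl_gamma G) (ce_diff (fgl_gamma G) (lie_coords n w)) is"
        unfolding ld(2)[OF ld(1)[OF w]] ld(2)[OF w, abs_def] ..
      also have "\<dots> = 0" using ce_diff_ce_diff[OF alternating_lie_coords[OF w]] unfolding gamma .
      finally show "lie_coords (Suc (Suc n)) (lie_diff (fgl_bracket G) (Suc n) (lie_diff (fgl_bracket G) n w)) is =
        lie_coords (Suc (Suc n)) \<zero>\<^bsub>lie_cochains (Suc (Suc n))\<^esub> is" by (simp add: lie_coords_simps)
    qed
    assume v: "v \<in> carrier (lie_cochains n)"
    show "r \<odot>\<^bsub>lie_cochains n\<^esub> (w \<oplus>\<^bsub>lie_cochains n\<^esub> v) =
      r \<odot>\<^bsub>lie_cochains n\<^esub> w \<oplus>\<^bsub>lie_cochains n\<^esub> r \<odot>\<^bsub>lie_cochains n\<^esub> v"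
      by (intro lie_coords_inject[of _ n] sc ac w v) (simp add: lie_coords_simps distrib_left)
    show "lie_diff (fgl_bracket G) n (w \<oplus>\<^bsub>lie_cochains n\<^esub> v) =
      lie_diff (fgl_bracket G) n w \<oplus>\<^bsub>lie_cochains (Suc n)\<^esub> lie_diff (fgl_bracket G) n v"
      by (intro lie_coords_inject[of _ "Suc n"] ld(1) ac w v)
        (simp add: ld w v ac lie_coords_simps lie_coords_simps(1)[abs_def] ce_diff_add)
  qed
qed

theorem corollary4p3:
  fixes G :: "'m::finite \<Rightarrow> ('m + 'm, 'r::{idom, ring_char_0}) mfps" and n :: nat
  assumes "formal_group_law G"
  shows "\<exists>\<Phi>. module_iso (group_cohomology G n) (lie_cohomology (fgl_bracket G) n) \<Phi> \<and>
    (\<forall>f \<in> cocycles group_cochains (group_diff G) n.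
       \<Phi> (cohomology_class group_cochains (group_diff G) n f) =
       cohomology_class lie_cochains (lie_diff (fgl_bracket G)) n (tilde_phi n f))"
proof -
  let ?d = "group_diff G" and ?e = "lie_diff (fgl_bracket G)"
  interpret structure_constants "fgl_mu G" by (rule structure_constants_fgl_mu[OF assms])
  interpret K: cochain_complex group_cochains ?d by (rule cochain_complex_group[OF assms])
  interpret L: cochain_complex lie_cochains ?e by (rule cochain_complex_lie[OF assms])
  have gamma: "gamma = fgl_gamma G" by (intro ext) (rule fgl_mu_unit[OF assms])
  note gd = group_diff_cochain[OF assms] and ld = lie_diff_cochain[OF assms]
  have coords: "lie_coords k (tilde_phi k f) = tangent (cochain_fun k f)"
    if "f \<in> carrier (group_cochains k)" for k and f :: "(nat \<times> 'm, 'r fract) mfps"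
    using tilde_phi_cochain(2)[OF that] by (intro ext)
  have zero: "cochain_fun k (0 :: (nat \<times> 'm, 'r fract) mfps) w = 0" for k w
    using cochain_fun_scale[OF group_cochains_closed(1), of k 0 w] by (simp add: mfps_eqI)
  \<comment> \<open>Both sides have the same coordinates by \<open>tangent_diff\<close>, so
    \<open>tilde_phi\<close> is a cochain map.\<close>
  have chain: "tilde_phi (Suc k) (?d k f) = ?e k (tilde_phi k f)" if f: "f \<in> carrier (group_cochains k)" for k f
  proof (rule lie_coords_inject[of _ "Suc k"])
    fix "is" :: "'m list"
    have "lie_coords (Suc k) (tilde_phi (Suc k) (?d k f)) is = tangent (diff (cochain_fun k f)) is"
      unfolding coords[OF gd(1)[OF f]] gd(2)[OF f] ..
    also have "\<dots> = ce_diff (fgl_gamma G) (tangent (cochain_fun k f)) is"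
      unfolding tangent_diff gamma ..
    also have "\<dots> = lie_coords (Suc k) (?e k (tilde_phi k f)) is"
      unfolding ld(2)[OF tilde_phi_cochain(1)[OF f]] coords[OF f] ..
    finally show "lie_coords (Suc k) (tilde_phi (Suc k) (?d k f)) is = lie_coords (Suc k) (?e k (tilde_phi k f)) is" .
  qed (simp_all add: tilde_phi_cochain gd f ld)
  have cocycle: "diff (cochain_fun k f) w = 0" if "f \<in> cocycles group_cochains ?d k" for k f w
    using gd(2)[OF K.cocyclesD(1)[OF that], of w] K.cocyclesD(2)[OF that] zero by simp
  show ?thesis
  proof (rule ex_module_iso_cohomology[OF K.cochain_complex_axioms L.cochain_complex_axioms])
    fix f :: "(nat \<times> 'm, 'r fract) mfps"
    assume f: "f \<in> cocycles group_cochains ?d n"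
    note fc = K.cocyclesD(1)[OF f]
    have "?e n (tilde_phi n f) = \<zero>\<^bsub>lie_cochains (Suc n)\<^esub>"
    proof (rule lie_coords_inject[of _ "Suc n"])
      fix "is" :: "'m list"
      show "lie_coords (Suc n) (?e n (tilde_phi n f)) is = lie_coords (Suc n) \<zero>\<^bsub>lie_cochains (Suc n)\<^esub> is"
        unfolding chain[OF fc, symmetric] coords[OF gd(1)[OF fc]] gd(2)[OF fc]
        by (simp add: cocycle[OF f] lie_coords_simps)
    qed (simp_all add: ld tilde_phi_cochain fc abelian_groupE(2)[OF abelian_group_lie_cochains])
    then show "tilde_phi n f \<in> cocycles lie_cochains ?e n"
      by (simp add: cocycles_def tilde_phi_cochain fc)
    show "tilde_phi n (r \<odot>\<^bsub>group_cochains n\<^esub> f) = r \<odot>\<^bsub>lie_cochains n\<^esub> tilde_phi n f" for r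
      by (rule lie_coords_inject[of _ n])
        (simp_all add: tilde_phi_cochain fc group_cochains_closed lie_cochains_smult_closed lie_coords_simps
          cochain_fun_scale antisymmetrize_scale)
    show "tilde_phi n (f \<oplus>\<^bsub>group_cochains n\<^esub> g) = tilde_phi n f \<oplus>\<^bsub>lie_cochains n\<^esub> tilde_phi n g"
      if "g \<in> cocycles group_cochains ?d n" for g
      using K.cocyclesD(1)[OF that]
      by (intro lie_coords_inject[of _ n])
        (simp_all add: tilde_phi_cochain fc group_cochains_closed abelian_groupE(1)[OF abelian_group_lie_cochains]
          lie_coords_simps cochain_fun_add antisymmetrize_add)
    show "tilde_phi n f \<in> coboundaries lie_cochains ?e n \<longleftrightarrow> f \<in> coboundaries group_cochains ?d n"
    proof
      assume phi: "tilde_phi n f \<in> coboundaries lie_cochains ?e n"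
      \<comment> \<open>In degree zero a coboundary is zero and the zero function serves; in higher
        degrees the coordinates of a primitive of \<open>tilde_phi n f\<close> do.\<close>
      obtain \<eta> where \<eta>: "alternating \<eta>" "\<And>w. tangent (cochain_fun n f) w = ce_diff gamma \<eta> w"
      proof (cases n)
        case 0
        have "tangent (cochain_fun n f) w = ce_diff gamma (\<lambda>_. 0) w" for w
          using phi unfolding coords[OF fc, symmetric]
          by (simp add: 0 coboundaries_def lie_coords_simps ce_diff_def removal_sum2_def)
        then show ?thesis by (rule that[rotated]) (simp add: alternating_def)
      next
        case (Suc k)
        then obtain v where v: "v \<in> carrier (lie_cochains k)" "tilde_phi n f = ?e k v"
          using phi by (auto simp: coboundaries_def)
        have "tangent (cochain_fun n f) w = ce_diff gamma (lie_coords k v) w" for w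
          unfolding coords[OF fc, symmetric] v(2) unfolding Suc ld(2)[OF v(1)] gamma ..
        then show ?thesis by (rule that[OF alternating_lie_coords[OF v(1)]])
      qed
      obtain b where b: "\<And>w. cochain_fun n f w = diff b w"
        using ex_diff_of_tangent[of "cochain_fun n f" \<eta>] cocycle[OF f] \<eta> by blast
      show "f \<in> coboundaries group_cochains ?d n"
      proof (cases n)
        case 0
        \<comment> \<open>Only the empty list has length zero, and there \<open>diff b\<close> is
          zero by definition.\<close>
        have "f = 0"
          using b[of "[]"] by (intro cochain_fun_inject[OF fc group_cochains_closed(1)]) (simp add: zero 0)
        then show ?thesis by (simp add: 0 coboundaries_def)
      next
        case (Suc k)
        \<comment> \<open>\<open>b\<close> is defined on lists of all lengths, but
          \<open>diff b\<close> at length \<open>n\<close> depends only on its values at length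
          \<open>k\<close>, and these form a cochain.\<close>
        obtain g where g: "g \<in> carrier (group_cochains k)" "\<And>w. length w = k \<Longrightarrow> cochain_fun k g w = b w"
          using cochain_fun_surj[of k b] by blast
        have "f = ?d k g"
        proof (rule cochain_fun_inject[OF fc])
          show "?d k g \<in> carrier (group_cochains n)" unfolding Suc by (rule gd(1)[OF g(1)])
          fix w :: "('m \<Rightarrow>\<^sub>0 nat) list" assume "length w = n"
          then show "cochain_fun n f w = cochain_fun n (?d k g) w"
            unfolding b unfolding Suc gd(2)[OF g(1)] by (intro diff_cong) (simp add: g(2))
        qed
        then show ?thesis using g(1) by (simp add: Suc coboundaries_def)
      qed
    next
      assume cob: "f \<in> coboundaries group_cochains ?d n"
      then show "tilde_phi n f \<in> coboundaries lie_cochains ?e n"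
      proof (cases n)
        case 0
        then have "f = 0" using cob by (simp add: coboundaries_def)
        have "tilde_phi n f = \<zero>\<^bsub>lie_cochains n\<^esub>"
          by (rule lie_coords_inject[of _ n])
            (simp_all add: tilde_phi_cochain fc abelian_groupE(2)[OF abelian_group_lie_cochains] lie_coords_simps
              zero \<open>f = 0\<close> group_cochains_closed)
        then show ?thesis by (simp add: 0 coboundaries_def)
      next
        case (Suc k)
        then obtain g where "g \<in> carrier (group_cochains k)" "f = ?d k g"
          using cob by (auto simp: coboundaries_def)
        then show ?thesis by (simp add: Suc coboundaries_def chain tilde_phi_cochain)
      qed
    qed
  next
    fix v :: "(('r ^ 'm) list \<Rightarrow>\<^sub>0 'r) set \<Rightarrow> 'r"
    assume v: "v \<in> cocycles lie_cochains ?e n"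
    note vc = L.cocyclesD(1)[OF v]
    have "ce_diff gamma (lie_coords n v) w = 0" for w
      using ld(2)[OF vc, of w] L.cocyclesD(2)[OF v] unfolding gamma by (simp add: lie_coords_simps)
    then obtain c where c: "\<And>w. diff c w = 0" "tangent c = lie_coords n v"
      using ex_cocycle_of_tangent[OF alternating_lie_coords[OF vc]] by blast
    \<comment> \<open>The part of \<open>c\<close> at length \<open>n\<close>; the tangent at length
      \<open>n\<close> and \<open>diff\<close> at length \<open>Suc n\<close> depend on this part
      only.\<close>
    obtain f where f: "f \<in> carrier (group_cochains n)" "\<And>w. length w = n \<Longrightarrow> cochain_fun n f w = c w"
      using cochain_fun_surj[of n c] by blast
    have "?d n f = 0"
    proof (rule cochain_fun_inject[OF gd(1)[OF f(1)] group_cochains_closed(1)])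
      fix w :: "('m \<Rightarrow>\<^sub>0 nat) list" assume "length w = Suc n"
      then have "diff (cochain_fun n f) w = diff c w" by (intro diff_cong) (simp add: f(2))
      then show "cochain_fun (Suc n) (?d n f) w = cochain_fun (Suc n) 0 w" by (simp add: gd(2)[OF f(1)] c(1) zero)
    qed
    then have "f \<in> cocycles group_cochains ?d n" using f(1) by (simp add: cocycles_def)
    moreover have "tilde_phi n f = v"
    proof (rule lie_coords_inject[OF tilde_phi_cochain(1)[OF f(1)] vc])
      fix "is" :: "'m list" assume len: "length is = n"
      have "tangent (cochain_fun n f) is = tangent c is"
      proof (rule antisymmetrize_cong)
        fix u assume "mset u = mset is"
        from arg_cong[OF this, of size] len show "cochain_fun n f (map unit_exp u) = c (map unit_exp u)"
          by (simp add: f(2))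
      qed
      then show "lie_coords n (tilde_phi n f) is = lie_coords n v is" by (simp add: coords[OF f(1)] c(2))
    qed
    ultimately show "\<exists>f\<in>cocycles group_cochains ?d n. tilde_phi n f = v" by blast
  qed
qed

end
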